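(* Let $g$ be a $q$-wavelet associated with the $q$-Bessel operator in $\mathcal{S}_{*q,\alpha}(\mathbb{R}_q)$. Then for $a\in\mathbb{R}_{q,+}$ and $b\in\widetilde{\mathbb{R}}_{q,+}$: 1) for every $f\in\mathcal{S}_{*q,\alpha}(\mathbb{R}_q)$, $$\Psi_{q,g}^\alpha(f)(a,b)=\frac{1}{a^{2\alpha+1}}R_{\alpha,q}\left[\Phi_{q,K_{\alpha,q,1}\circ W_{\alpha,q}(g)}\left(W_{\alpha,q}(f)\right)(a,\cdot)\right](b);$$ 2) for every $f\in\mathcal{S}_{*q,-1/2}(\mathbb{R}_q)$, $$\Phi_{q,W_{\alpha,q}(g)}(f)(a,b)=\frac{1}{a^{2\alpha+1}}W_{\alpha,q}\left[\Psi_{q,K_{\alpha,q,2}(g)}^\alpha\left(R_{\alpha,q}(f)\right)(a,\cdot)\right](b).$$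
   Context: Fix $q\in\,]0,1[$ with $\frac{\log(1-q)}{\log q}\in\mathbb{Z}$ and $\alpha>-\frac12$. Functions are complex valued. $(a;q)_0=1$, $(a;q)_n=\prod_{k=0}^{n-1}(1-aq^k)$, $(a;q)_\infty=\prod_{k\ge0}(1-aq^k)$; $\Gamma_q(x)=\frac{(q;q)_\infty}{(q^x;q)_\infty}(1-q)^{1-x}$, and $\Gamma_{q^2}$ is the same with $q$ replaced by $q^2$. $\mathbb{R}_{q,+}=\{q^n:n\in\mathbb{Z}\}$, $\widetilde{\mathbb{R}}_{q,+}=\mathbb{R}_{q,+}\cup\{0\}$, $\mathbb{R}_q=\{\pm q^n:n\in\mathbb{Z}\}\cup\{0\}$. Jackson integrals: $\int_0^af(x)d_qx=(1-q)a\sum_{n\ge0}f(aq^n)q^n$, $\int_0^\infty f(x)d_qx=(1-q)\sum_{n\in\mathbb{Z}}f(q^n)q^n$, $\int_a^\infty=\int_0^\infty-\int_0^a$. $q$-derivative: $D_qf(x)=\frac{f(x)-f(qx)}{(1-q)x}$ for $x\ne0$, $D_qf(0)=f'(0)$. $\mathcal{S}_{*q}(\mathbb{R}_q)$: the restrictions to $\mathbb{R}_q$ of even, infinitely $q$-differentiable functions $f$ on $\mathbb{R}$ with $P_{n,m,q}(f)=\sup_{x\in\mathbb{R},\,0\le k\le n}|(1+x^2)^mD_q^kf(x)|<\infty$ for all $n,m\in\mathbb{N}$, with the induced topology of these semi-norms. For $\beta\in\{\alpha,-\frac12\}$, $\mathcal{S}_{*q,\beta}(\mathbb{R}_q)=\{f\in\mathcal{S}_{*q}(\mathbb{R}_q):\int_0^\infty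 f(x)x^{2k+2\beta+1}d_qx=0,\ k=0,1,\dots\}$. For $\beta\in\{\alpha,-\frac12\}$: $j_\beta^{(3)}(z;q^2)=\sum_{n\ge0}\frac{(-1)^nq^{n(n-1)}(1-q)^{2n}z^{2n}}{(q^2;q^2)_n(q^{2\beta+2};q^2)_n}$, $c_{\beta,q}=\frac{(1+q^{-1})^{-\beta}}{\Gamma_{q^2}(\beta+1)}$, $\mathcal{F}_{\beta,q}(f)(\lambda)=c_{\beta,q}\int_0^\infty f(x)j_\beta^{(3)}(\lambda x;q^2)x^{2\beta+1}d_qx$, with $\mathcal{F}_{\beta,q}^{-1}=q^{-4\beta-2}\mathcal{F}_{\beta,q}$. $\mathcal{F}_{\alpha,q}$ is the $q$-Bessel Fourier transform and $\mathcal{F}_q=\mathcal{F}_{-1/2,q}$ the $q$-Fourier-cosine transform. For $x\in\widetilde{\mathbb{R}}_{q,+}$ the translation $T^\beta_{q,x}$ is given by $\mathcal{F}_{\beta,q}(T^\beta_{q,x}f)(\lambda)=j_\beta^{(3)}(\lambda x;q^2)\mathcal{F}_{\beta,q}(f)(\lambda)$; $T_{q,x}=T^{-1/2}_{q,x}$. $q$-Riemann-Liouville transform: $R_{\alpha,q}(f)(x)=\frac{(1+q)\Gamma_{q^2}(\alpha+1)}{\Gamma_{q^2}(1/2)\Gamma_{q^2}(\alpha+1/2)}\int_0^1\frac{(t^2q^2;q^2)_\infty}{(t^2q^{2\alpha+1};q^2)_\infty}f(xt)\,d_qt$. $q$-Weyl transform: $W_{\alpha,q}(f)(x)=\frac{q(1+q^{-1})^{-\alpha+1/2}}{\Gamma_{q^2}(\alpha+1/2)}\int_{qx}^\infty\frac{(q^2x^2/t^2;q^2)_\infty}{(q^{2\alpha+1}x^2/t^2;q^2)_\infty}f(t)t^{2\alpha}d_qt$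 for $x\in\widetilde{\mathbb{R}}_{q,+}$, extended evenly; $\mathcal{F}_{\alpha,q}=\mathcal{F}_q\circ W_{\alpha,q}$ on $\mathcal{S}_{*q}(\mathbb{R}_q)$. With $\kappa_\alpha=\frac{\Gamma_{q^2}(1/2)}{q^{3\alpha+3/2}(1+q)^{\alpha+1/2}\Gamma_{q^2}(\alpha+1)}$: $K_{\alpha,q,1}(f)=\kappa_\alpha\,\mathcal{F}_q^{-1}(|\lambda|^{2\alpha+1}\mathcal{F}_q(f))$ on $\mathcal{S}_{*q,-1/2}(\mathbb{R}_q)$, and $K_{\alpha,q,2}(f)=\kappa_\alpha\,\mathcal{F}_{\alpha,q}^{-1}(|\lambda|^{2\alpha+1}\mathcal{F}_{\alpha,q}(f))$ on $\mathcal{S}_{*q,\alpha}(\mathbb{R}_q)$. A $q$-wavelet associated with the $q$-Bessel operator is an even $g$, square integrable on $\mathbb{R}_{q,+}$ for $x^{2\alpha+1}d_qx$, with $0<C_g=\int_0^\infty|\mathcal{F}_{\alpha,q}(g)(a)|^2\frac{d_qa}{a}<\infty$. For $a\in\mathbb{R}_{q,+}$, $b\in\widetilde{\mathbb{R}}_{q,+}$: $g_a(x)=a^{-2\alpha-2}g(x/a)$, $g_{a,b}=\sqrt a\,T_{q,b}^\alpha(g_a)$, $\Psi^{\alpha}_{q,g}(f)(a,b)=c_{\alpha,q}\int_0^\infty f(x)\overline{g_{a,b}(x)}\,x^{2\alpha+1}d_qx$. A $q$-wavelet is an even $h$, square integrable on $\mathbb{R}_{q,+}$ for $d_qx$, with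 $0<C_h^c=\int_0^\infty|\mathcal{F}_q(h)(a)|^2\frac{d_qa}{a}<\infty$. With $H_a(h)(x)=\frac1{\sqrt a}h(x/a)$ and $h^c_{a,b}=T_{q,b}(H_a(h))$, the continuous $q$-wavelet transform is $\Phi_{q,h}(f)(a,b)=c_{-1/2,q}\int_0^\infty f(x)\overline{h^c_{a,b}(x)}\,d_qx$, $a\in\mathbb{R}_{q,+}$, $b\in\widetilde{\mathbb{R}}_{q,+}$. *)

theory Defs
  imports "HOL-Analysis.Analysis"
begin

text \<open>
  A function on \<open>Rq q\<close> is represented by a total function \<open>real \<Rightarrow> complex\<close> whose values off \<open>Rq q\<close> are
  irrelevant: at a point of \<open>Rq q\<close>, every operator below reads its argument only at points of \<open>Rq q\<close>
  (the \<open>q\<close>-derivative is applied only to functions on all of \<open>\<real>\<close>).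
  Real exponents are written with \<open>powr\<close>; their bases are nonnegative throughout.
\<close>

subsection \<open>\<open>q\<close>-shifted factorials and the \<open>q\<close>-Gamma function\<close>

definition qpoch :: "real \<Rightarrow> real \<Rightarrow> nat \<Rightarrow> real" where
  "qpoch a q n = (\<Prod>k<n. 1 - a * q ^ k)"

definition qpoch_inf :: "real \<Rightarrow> real \<Rightarrow> real" where
  "qpoch_inf a q = (\<Prod>k. 1 - a * q ^ k)"

definition qGamma :: "real \<Rightarrow> real \<Rightarrow> real" where
  "qGamma q x = qpoch_inf q q / qpoch_inf (q powr x) q * (1 - q) powr (1 - x)"

subsection \<open>Lattices and Jackson integrals\<close>

definition Rq_pos :: "real \<Rightarrow> real set" where
  "Rq_pos q = {q powi n | n. True}"

definition Rq_nonneg :: "real \<Rightarrow> real set" where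
  "Rq_nonneg q = insert 0 (Rq_pos q)"

definition Rq :: "real \<Rightarrow> real set" where
  "Rq q = insert 0 (Rq_pos q \<union> uminus ` Rq_pos q)"

definition jackson_upto :: "real \<Rightarrow> real \<Rightarrow> (real \<Rightarrow> 'a::real_normed_vector) \<Rightarrow> 'a" where
  "jackson_upto q a f = ((1 - q) * a) *\<^sub>R (\<Sum>n. q ^ n *\<^sub>R f (a * q ^ n))"

definition jackson_integrable :: "real \<Rightarrow> (real \<Rightarrow> 'a::real_normed_vector) \<Rightarrow> bool" where
  "jackson_integrable q f \<longleftrightarrow> (\<lambda>n::int. (q powi n) *\<^sub>R f (q powi n)) summable_on UNIV"

definition jackson :: "real \<Rightarrow> (real \<Rightarrow> 'a::real_normed_vector) \<Rightarrow> 'a" where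
  "jackson q f = (1 - q) *\<^sub>R (\<Sum>\<^sub>\<infinity>n::int. (q powi n) *\<^sub>R f (q powi n))"

definition jackson_from :: "real \<Rightarrow> real \<Rightarrow> (real \<Rightarrow> 'a::real_normed_vector) \<Rightarrow> 'a" where
  "jackson_from q a f = jackson q f - jackson_upto q a f"

subsection \<open>\<open>q\<close>-derivative and \<open>q\<close>-Schwartz spaces\<close>

definition qderiv :: "real \<Rightarrow> (real \<Rightarrow> complex) \<Rightarrow> real \<Rightarrow> complex" where
  "qderiv q f x =
     (if x = 0 then vector_derivative f (at 0)
      else (f x - f (q * x)) / complex_of_real ((1 - q) * x))"

text \<open>Away from \<open>0\<close> the \<open>q\<close>-derivative always exists, so only differentiability at \<open>0\<close> is a condition.\<close>

definition infinitely_q_differentiable :: "real \<Rightarrow> (real \<Rightarrow> complex) \<Rightarrow> bool" where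
  "infinitely_q_differentiable q f \<longleftrightarrow> (\<forall>k. (qderiv q ^^ k) f differentiable at 0)"

definition schwartz_seminorm :: "real \<Rightarrow> nat \<Rightarrow> nat \<Rightarrow> (real \<Rightarrow> complex) \<Rightarrow> ennreal" where
  "schwartz_seminorm q n m f =
     (SUP (x, k) \<in> UNIV \<times> {..n}. ennreal ((1 + x\<^sup>2) ^ m * cmod ((qderiv q ^^ k) f x)))"

definition Schwartz :: "real \<Rightarrow> (real \<Rightarrow> complex) set" where
  "Schwartz q = {f. \<exists>F. (\<forall>x. F (- x) = F x) \<and> infinitely_q_differentiable q F \<and>
     (\<forall>n m. schwartz_seminorm q n m F < \<infinity>) \<and> (\<forall>x\<in>Rq q. f x = F x)}"

definition Schwartz0 :: "real \<Rightarrow> real \<Rightarrow> (real \<Rightarrow> complex) set" where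
  "Schwartz0 q \<beta> = {f \<in> Schwartz q.
     \<forall>k::nat. jackson q (\<lambda>x. f x * complex_of_real (x powr (2 * real k + 2 * \<beta> + 1))) = 0}"

subsection \<open>\<open>q\<close>-Bessel Fourier transform and translation\<close>

definition qBessel :: "real \<Rightarrow> real \<Rightarrow> real \<Rightarrow> real" where
  "qBessel q \<beta> z =
     (\<Sum>n. (- 1) ^ n * q ^ (n * (n - 1)) * (1 - q) ^ (2 * n) * z ^ (2 * n)
          / (qpoch (q\<^sup>2) (q\<^sup>2) n * qpoch (q powr (2 * \<beta> + 2)) (q\<^sup>2) n))"

definition qF_const :: "real \<Rightarrow> real \<Rightarrow> real" where
  "qF_const q \<beta> = (1 + inverse q) powr (- \<beta>) / qGamma (q\<^sup>2) (\<beta> + 1)"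

text \<open>\<open>\<beta> = \<alpha>\<close> is the \<open>q\<close>-Bessel Fourier transform, \<open>\<beta> = -1/2\<close> the \<open>q\<close>-Fourier-cosine transform.\<close>

definition qF :: "real \<Rightarrow> real \<Rightarrow> (real \<Rightarrow> complex) \<Rightarrow> real \<Rightarrow> complex" where
  "qF q \<beta> f y = complex_of_real (qF_const q \<beta>) *
     jackson q (\<lambda>x. f x * complex_of_real (qBessel q \<beta> (y * x) * x powr (2 * \<beta> + 1)))"

definition qF_inv :: "real \<Rightarrow> real \<Rightarrow> (real \<Rightarrow> complex) \<Rightarrow> real \<Rightarrow> complex" where
  "qF_inv q \<beta> f y = complex_of_real (q powr (- 4 * \<beta> - 2)) * qF q \<beta> f y"

text \<open>
  The translate of \<open>f\<close> by \<open>x\<close> is determined by its transform \<open>qBessel q \<beta> (y * x) * qF q \<beta> f y\<close>;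
  it is recovered from it with the inverse transform.
\<close>

definition qtrans :: "real \<Rightarrow> real \<Rightarrow> real \<Rightarrow> (real \<Rightarrow> complex) \<Rightarrow> real \<Rightarrow> complex" where
  "qtrans q \<beta> x f = qF_inv q \<beta> (\<lambda>y. complex_of_real (qBessel q \<beta> (y * x)) * qF q \<beta> f y)"

subsection \<open>\<open>q\<close>-Riemann-Liouville and \<open>q\<close>-Weyl transforms\<close>

definition qRL :: "real \<Rightarrow> real \<Rightarrow> (real \<Rightarrow> complex) \<Rightarrow> real \<Rightarrow> complex" where
  "qRL q \<alpha> f x =
     complex_of_real ((1 + q) * qGamma (q\<^sup>2) (\<alpha> + 1)
       / (qGamma (q\<^sup>2) (1/2) * qGamma (q\<^sup>2) (\<alpha> + 1/2))) *
     jackson_upto q 1 (\<lambda>t. complex_of_real (qpoch_inf (t\<^sup>2 * q\<^sup>2) (q\<^sup>2)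
       / qpoch_inf (t\<^sup>2 * q powr (2 * \<alpha> + 1)) (q\<^sup>2)) * f (x * t))"

text \<open>
  The absolute value implements the even extension. If \<open>2 * \<alpha> + 1\<close> is an even integer, the quotient
  below is formally \<open>0 / 0\<close> at lattice points \<open>t \<le> q * \<bar>x\<bar>\<close>; their contributions cancel in
  \<open>jackson_from\<close> whatever the value.
\<close>

definition qWeyl :: "real \<Rightarrow> real \<Rightarrow> (real \<Rightarrow> complex) \<Rightarrow> real \<Rightarrow> complex" where
  "qWeyl q \<alpha> f x =
     complex_of_real (q * (1 + inverse q) powr (- \<alpha> + 1/2) / qGamma (q\<^sup>2) (\<alpha> + 1/2)) *
     jackson_from q (q * \<bar>x\<bar>) (\<lambda>t. complex_of_real (qpoch_inf (q\<^sup>2 * x\<^sup>2 / t\<^sup>2) (q\<^sup>2)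
       / qpoch_inf (q powr (2 * \<alpha> + 1) * x\<^sup>2 / t\<^sup>2) (q\<^sup>2)) * f t * complex_of_real (t powr (2 * \<alpha>)))"

definition qkappa :: "real \<Rightarrow> real \<Rightarrow> real" where
  "qkappa q \<alpha> = qGamma (q\<^sup>2) (1/2)
     / (q powr (3 * \<alpha> + 3/2) * (1 + q) powr (\<alpha> + 1/2) * qGamma (q\<^sup>2) (\<alpha> + 1))"

definition qK1 :: "real \<Rightarrow> real \<Rightarrow> (real \<Rightarrow> complex) \<Rightarrow> real \<Rightarrow> complex" where
  "qK1 q \<alpha> f x = complex_of_real (qkappa q \<alpha>) *
     qF_inv q (- 1/2) (\<lambda>y. complex_of_real (\<bar>y\<bar> powr (2 * \<alpha> + 1)) * qF q (- 1/2) f y) x"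

definition qK2 :: "real \<Rightarrow> real \<Rightarrow> (real \<Rightarrow> complex) \<Rightarrow> real \<Rightarrow> complex" where
  "qK2 q \<alpha> f x = complex_of_real (qkappa q \<alpha>) *
     qF_inv q \<alpha> (\<lambda>y. complex_of_real (\<bar>y\<bar> powr (2 * \<alpha> + 1)) * qF q \<alpha> f y) x"

subsection \<open>\<open>q\<close>-wavelets and continuous \<open>q\<close>-wavelet transforms\<close>

definition admissibility_const :: "real \<Rightarrow> real \<Rightarrow> (real \<Rightarrow> complex) \<Rightarrow> real" where
  "admissibility_const q \<alpha> g = jackson q (\<lambda>a. (cmod (qF q \<alpha> g a))\<^sup>2 / a)"

definition qBessel_wavelet :: "real \<Rightarrow> real \<Rightarrow> (real \<Rightarrow> complex) \<Rightarrow> bool" where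
  "qBessel_wavelet q \<alpha> g \<longleftrightarrow>
     (\<forall>x\<in>Rq q. g (- x) = g x) \<and>
     jackson_integrable q (\<lambda>x. (cmod (g x))\<^sup>2 * x powr (2 * \<alpha> + 1)) \<and>
     jackson_integrable q (\<lambda>a. (cmod (qF q \<alpha> g a))\<^sup>2 / a) \<and>
     0 < admissibility_const q \<alpha> g"

definition qBessel_atom ::
    "real \<Rightarrow> real \<Rightarrow> (real \<Rightarrow> complex) \<Rightarrow> real \<Rightarrow> real \<Rightarrow> real \<Rightarrow> complex" where
  "qBessel_atom q \<alpha> g a b x = complex_of_real (sqrt a) *
     qtrans q \<alpha> b (\<lambda>y. complex_of_real (a powr (- 2 * \<alpha> - 2)) * g (y / a)) x"

definition qBessel_wavelet_transform ::
    "real \<Rightarrow> real \<Rightarrow> (real \<Rightarrow> complex) \<Rightarrow> (real \<Rightarrow> complex) \<Rightarrow> real \<Rightarrow> real \<Rightarrow> complex" where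
  "qBessel_wavelet_transform q \<alpha> g f a b = complex_of_real (qF_const q \<alpha>) *
     jackson q (\<lambda>x. f x * cnj (qBessel_atom q \<alpha> g a b x) * complex_of_real (x powr (2 * \<alpha> + 1)))"

definition q_atom :: "real \<Rightarrow> (real \<Rightarrow> complex) \<Rightarrow> real \<Rightarrow> real \<Rightarrow> real \<Rightarrow> complex" where
  "q_atom q h a b = qtrans q (- 1/2) b (\<lambda>y. complex_of_real (1 / sqrt a) * h (y / a))"

definition q_wavelet_transform ::
    "real \<Rightarrow> (real \<Rightarrow> complex) \<Rightarrow> (real \<Rightarrow> complex) \<Rightarrow> real \<Rightarrow> real \<Rightarrow> complex" where
  "q_wavelet_transform q h f a b = complex_of_real (qF_const q (- 1/2)) *
     jackson q (\<lambda>x. f x * cnj (q_atom q h a b x))"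

end

theory Submission
  imports Defs
begin

text \<open>
  On the lattice of integer powers of \<open>q\<close> all transforms are sums, and both identities compare one and
  the same sum once everything is moved to the transform side. Write \<open>F\<^sub>\<beta>\<close> for the \<open>q\<close>-Bessel Fourier
  transform, \<open>j\<^sub>\<beta>\<close> for its kernel, \<open>R\<close> and \<open>W\<close> for the Riemann-Liouville and Weyl transforms.

  A translation by \<open>b\<close> multiplies a transform by \<open>j\<^sub>\<beta> (k b)\<close>, a dilation by \<open>a\<close> rescales its argument, and the
  kernel is symmetric. Hence each wavelet transform of \<open>f\<close> with wavelet \<open>g\<close> equals
  \<open>sqrt a\<close> times \<open>F\<^sub>\<beta>\<close>-inverse of \<open>k \<mapsto> F\<^sub>\<beta> f k * cnj (F\<^sub>\<beta> g (a k))\<close>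
  (\<open>translate_inner_product\<close>, \<open>qBessel_wavelet_transform_eq\<close>, \<open>q_wavelet_transform_eq\<close>).

  The transforms \<open>R\<close> and \<open>W\<close> act on kernels. Integrating the power series of \<open>j\<^bsub>-1/2\<^esub>\<close> term by term gives
  \<open>q\<close>-beta integrals, which the \<open>q\<close>-binomial theorem evaluates, so \<open>R\<close> maps \<open>j\<^bsub>-1/2\<^esub> (k \<cdot>)\<close> to
  \<open>j\<^sub>\<alpha> (k \<cdot>)\<close> (\<open>qBessel_weighted_integral\<close>). Interchanging sums then gives \<open>F\<^bsub>-1/2\<^esub> W = F\<^sub>\<alpha>\<close>
  (\<open>qF_qWeyl\<close>), and with the inversion formula \<open>W\<close> maps \<open>j\<^sub>\<alpha> (k \<cdot>)\<close> to a multiple of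
  \<open>k\<^bsup>-2\<alpha>-1\<^esup> j\<^bsub>-1/2\<^esub> (k \<cdot>)\<close> (\<open>Weyl_qBessel\<close>). Superposing kernels yields \<open>qRL_qF_inv\<close> and
  \<open>qWeyl_qF_inv\<close>. By inversion, \<open>K\<^sub>1\<close> and \<open>K\<^sub>2\<close> multiply a transform by the constant \<open>\<kappa>\<close> times
  \<open>k\<^bsup>2\<alpha>+1\<^esup>\<close>. At the point \<open>a k\<close> this is the power of \<open>k\<close> that \<open>R\<close> introduces, together with the factor
  \<open>a\<^bsup>2\<alpha>+1\<^esup>\<close> of the two identities; the remaining constants agree by \<open>qkappa_eq\<close>.

  The inversion formula (\<open>qF_qF\<close>) is the orthogonality of the functions \<open>j\<^sub>\<beta> (k \<cdot>)\<close> on the lattice. For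
  different \<open>k\<close> the second-order \<open>q\<close>-difference equation of \<open>j\<^sub>\<beta>\<close> turns the sum of products into a telescoping
  one (\<open>qBessel_orthogonal\<close>); the norm is found by transforming \<open>(q\<^sup>2 x\<^sup>2; q\<^sup>2)\<^sub>\<infinity>\<close> twice (\<open>j_norm_eq\<close>).

  Convergence rests on the decay \<open>\<bar>j\<^sub>\<beta> x\<bar> \<le> C x\<^bsup>-\<theta>\<^esup>\<close> on the lattice for every \<open>\<theta> \<ge> 0\<close>
  (\<open>qBessel_decay\<close>), where the hypothesis on \<open>log (1 - q) / log q\<close> enters. With \<open>x\<close> replaced by \<open>k x\<close> the
  bound is a product, so a suitable \<open>\<theta>\<close> separates the variables of a double sum, and it is enough to know for which
  exponents \<open>s\<close> the sums of \<open>\<bar>H x\<bar> x\<^sup>s\<close> converge. For the transform of a Schwartz function they do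
  whenever \<open>0 < s < 2\<beta> + 3\<close> (\<open>mellin_hankel_Schwartz\<close>); going beyond \<open>2\<beta> + 2\<close> is what makes the
  transform integrable, and it needs differentiability at \<open>0\<close>.
\<close>

section \<open>Shifted factorials and the \<open>q\<close>-binomial theorem\<close>

lemma qpoch_0 [simp]: "qpoch a p 0 = 1" by (simp add: qpoch_def)
lemma qpoch_Suc: "qpoch a p (Suc n) = qpoch a p n * (1 - a * p ^ n)" by (simp add: qpoch_def)
lemma qpoch_add: "qpoch a p (n + m) = qpoch a p n * qpoch (a * p ^ n) p m"
  by (induction m) (auto simp: qpoch_Suc power_add mult_ac)

lemma qpoch_tendsto:
  assumes "0 < p" "p < 1" shows "(\<lambda>n. qpoch a p n) \<longlonglongrightarrow> qpoch_inf a (p::real)"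
proof -
  have "summable (\<lambda>k. norm ((1 - a * p ^ k) - 1))"
    using assms by (simp add: abs_mult summable_mult summable_geometric power_abs)
  then have "convergent_prod (\<lambda>k. 1 - a * p ^ k)"
    using abs_convergent_prod_imp_convergent_prod abs_convergent_prod_conv_summable by blast
  from convergent_prod_LIMSEQ[OF this]
  have "(\<lambda>n. qpoch a p (Suc n)) \<longlonglongrightarrow> qpoch_inf a p"
    by (simp add: qpoch_def qpoch_inf_def lessThan_Suc_atMost)
  then show ?thesis by (rule LIMSEQ_imp_Suc)
qed

lemma qpoch_inf_split:
  assumes "0 < p" "p < 1" shows "qpoch_inf a p = qpoch a p n * qpoch_inf (a * p ^ n) (p::real)"
proof -
  have "(\<lambda>m. qpoch a p (n + m)) \<longlonglongrightarrow> qpoch_inf a p"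
    using LIMSEQ_ignore_initial_segment[OF qpoch_tendsto[OF assms], of a n] by (simp add: add.commute)
  moreover have "(\<lambda>m. qpoch a p (n + m)) \<longlonglongrightarrow> qpoch a p n * qpoch_inf (a * p ^ n) p"
    unfolding qpoch_add by (intro tendsto_mult tendsto_const qpoch_tendsto assms)
  ultimately show ?thesis using LIMSEQ_unique by blast
qed

lemma qpoch_inf_eq_0:
  assumes "0 < p" "p < 1" "a * p ^ n = 1" shows "qpoch_inf a (p::real) = 0"
  using qpoch_inf_split[OF assms(1,2), of a "Suc n"] assms(3) by (simp add: qpoch_Suc)

text \<open>
  The lower bound is the Weierstrass inequality for the product \<open>(a; p)\<^sub>n\<close> followed by a geometric series. It
  controls \<open>(a; p)\<^sub>\<infinity>\<close> near \<open>a = 0\<close>.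
\<close>

lemma qpoch_bounds:
  assumes "0 < p" "p < 1" "0 \<le> a" "a \<le> (1::real)"
  shows "0 \<le> qpoch a p n \<and> qpoch a p n \<le> 1 \<and> 1 - a / (1 - p) \<le> qpoch a p n"
proof -
  have f: "0 \<le> a * p ^ k" "a * p ^ k \<le> 1" for k
    using assms by (auto simp: power_le_one mult_le_one)
  have A: "0 \<le> qpoch a p n \<and> qpoch a p n \<le> 1" for n
    unfolding qpoch_def using f by (auto intro!: prod_nonneg prod_le_1 )
  have B: "1 - (\<Sum>k<n. a * p ^ k) \<le> qpoch a p n"
  proof (induction n)
    case (Suc n)
    have "qpoch a p n * (a * p ^ n) \<le> 1 * (a * p ^ n)" using A f by (intro mult_right_mono) auto
    then show ?case using Suc by (simp add: qpoch_Suc algebra_simps)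
  qed simp
  have "(\<Sum>k<n. a * p ^ k) = a * ((1 - p ^ n) / (1 - p))"
    using assms by (simp add: sum_distrib_left[symmetric] sum_gp_strict)
  also have "\<dots> \<le> a * (1 / (1 - p))"
    using assms by (intro mult_left_mono divide_right_mono) auto
  finally show ?thesis using A B[of ] by simp
qed

lemma qpoch_inf_bounds:
  assumes "0 < p" "p < 1" "0 \<le> a" "a \<le> (1::real)"
  shows "0 \<le> qpoch_inf a p" "qpoch_inf a p \<le> 1" "1 - a / (1 - p) \<le> qpoch_inf a p"
  using qpoch_bounds[OF assms] LIMSEQ_le_const[OF qpoch_tendsto[OF assms(1,2)]]
    LIMSEQ_le_const2[OF qpoch_tendsto[OF assms(1,2)]]
  by blast+

lemma qpoch_inf_0: "0 < p \<Longrightarrow> p < 1 \<Longrightarrow> qpoch_inf 0 (p::real) = 1"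
  using qpoch_inf_bounds[of p 0] by simp

lemma qpoch_pos:
  assumes "0 < p" "p < 1" "0 \<le> a" "a < (1::real)"
  shows "0 < qpoch a p n"
proof -
  have "a * p ^ k < 1" for k
    using assms mult_left_le[of "p ^ k" a] by (auto simp: power_le_one intro: le_less_trans)
  then show ?thesis unfolding qpoch_def by (intro prod_pos) auto
qed

text \<open>
  Far out in the product the Weierstrass lower bound is positive; the finitely many factors before that are
  positive one by one.
\<close>

lemma qpoch_inf_pos:
  assumes "0 < p" "p < 1" "0 \<le> a" "a < (1::real)"
  shows "0 < qpoch_inf a p"
proof -
  have "(\<lambda>n. a * p ^ n) \<longlonglongrightarrow> a * 0"
    using assms by (intro tendsto_mult tendsto_const LIMSEQ_power_zero) auto
  then have "eventually (\<lambda>n. a * p ^ n < 1 - p) sequentially"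
    using assms by (intro order_tendstoD(2)) auto
  then obtain n where n: "a * p ^ n < 1 - p" by (auto simp: eventually_sequentially)
  have "a * p ^ n \<le> 1" using assms by (auto simp: power_le_one mult_le_one)
  then have "1 - a * p ^ n / (1 - p) \<le> qpoch_inf (a * p ^ n) p"
    using assms by (intro qpoch_inf_bounds) auto
  moreover have "0 < 1 - a * p ^ n / (1 - p)" using n assms by simp
  ultimately show ?thesis
    using qpoch_inf_split[OF assms(1,2), of a n] qpoch_pos[OF assms] by simp
qed

lemma qpoch_inf_le_qpoch:
  assumes "0 < p" "p < 1" "0 \<le> a" "a \<le> (1::real)"
  shows "qpoch_inf a p \<le> qpoch a p n"
proof -
  have "a * p ^ n \<le> 1" using assms by (auto simp: power_le_one mult_le_one)
  then have "qpoch_inf (a * p ^ n) p \<le> 1" using assms by (intro qpoch_inf_bounds) auto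
  then have "qpoch a p n * qpoch_inf (a * p ^ n) p \<le> qpoch a p n * 1"
    using qpoch_bounds[OF assms] by (intro mult_left_mono) auto
  then show ?thesis using qpoch_inf_split[OF assms(1,2), of a n] by simp
qed

text \<open>
  Each use of the equation splits off one factor of either product and multiplies the argument by \<open>p\<close>. In the limit
  the argument is \<open>0\<close>, where \<open>f\<close> is continuous.
\<close>

lemma qpoch_inf_functional_equation:
  fixes f :: "real \<Rightarrow> real"
  assumes p: "0 < p" "p < 1" and f: "isCont f 0" "f 0 = 1"
    and rec: "\<And>x. \<bar>x\<bar> \<le> \<bar>z\<bar> \<Longrightarrow> (1 - c * x) * f x = (1 - a * x) * f (p * x)"
  shows "qpoch_inf (c * z) p * f z = qpoch_inf (a * z) p"
proof -
  have small: "\<bar>p ^ n * z\<bar> \<le> \<bar>z\<bar>" for n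
    using p by (simp add: abs_mult power_le_one mult_left_le_one_le)
  have iter: "qpoch (c * z) p n * f z = qpoch (a * z) p n * f (p ^ n * z)" for n
  proof (induction n)
    case (Suc n)
    then have "qpoch (c * z) p (Suc n) * f z = qpoch (a * z) p n * ((1 - c * (p ^ n * z)) * f (p ^ n * z))"
      by (simp add: qpoch_Suc algebra_simps)
    also have "\<dots> = qpoch (a * z) p (Suc n) * f (p ^ Suc n * z)"
      by (subst rec[OF small]) (simp add: qpoch_Suc algebra_simps)
    finally show ?case .
  qed simp
  have "(\<lambda>n. p ^ n * z) \<longlonglongrightarrow> 0 * z"
    using p by (intro tendsto_mult tendsto_const LIMSEQ_power_zero) auto
  then have "(\<lambda>n. f (p ^ n * z)) \<longlonglongrightarrow> f 0"
    using isCont_tendsto_compose[OF f(1)] by simp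
  then have "(\<lambda>n. qpoch (c * z) p n * f z) \<longlonglongrightarrow> qpoch_inf (a * z) p * 1"
    unfolding iter f(2) by (intro tendsto_mult qpoch_tendsto p)
  moreover have "(\<lambda>n. qpoch (c * z) p n * f z) \<longlonglongrightarrow> qpoch_inf (c * z) p * f z"
    by (intro tendsto_mult qpoch_tendsto p tendsto_const)
  ultimately show ?thesis using LIMSEQ_unique by fastforce
qed

text \<open>
  The series satisfies \<open>(1 - z) f z = (1 - a z) f (p z)\<close>, by comparison of coefficients.
\<close>

lemma q_binomial:
  fixes p a z :: real
  assumes p: "0 < p" "p < 1" and a: "0 \<le> a" "a \<le> 1" and z: "0 \<le> z" "z < 1"
  shows "(\<lambda>n. qpoch a p n / qpoch p p n * z ^ n) sums (qpoch_inf (a * z) p / qpoch_inf z p)"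
proof -
  define c where "c = (\<lambda>n. qpoch a p n / qpoch p p n)"
  define f where "f = (\<lambda>z. \<Sum>n. c n * z ^ n)"
  have pp: "0 < qpoch p p n" for n using qpoch_pos[of p p] p by simp
  have c_bd: "norm (c n) \<le> 1 / qpoch_inf p p" for n
    unfolding c_def using qpoch_bounds[OF p a, of n] qpoch_inf_le_qpoch[OF p, of p n] qpoch_inf_pos[OF p, of p] p pp[of n]
    by (auto intro!: frac_le)
  have sm: "summable (\<lambda>n. c n * x ^ n)" if "\<bar>x\<bar> < 1" for x
  proof (rule summable_comparison_test')
    show "summable (\<lambda>n. 1 / qpoch_inf p p * \<bar>x\<bar> ^ n)" using that by (intro summable_mult summable_geometric) auto
    show "norm (c n * x ^ n) \<le> 1 / qpoch_inf p p * \<bar>x\<bar> ^ n" for n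
      using mult_right_mono[OF c_bd[of n], of "\<bar>x\<bar> ^ n"] by (simp add: abs_mult power_abs)
  qed
  have rec: "(1 - x) * f x = (1 - a * x) * f (p * x)" if "\<bar>x\<bar> < 1" for x
  proof -
    have px: "\<bar>p * x\<bar> < 1"
      using mult_le_less_imp_less[of p 1 "\<bar>x\<bar>" 1] mult_left_le_one_le[of "\<bar>x\<bar>" p] that p by (simp add: abs_mult)
    have "f x - f (p * x) = (\<Sum>n. c n * x ^ n - c n * (p * x) ^ n)"
      unfolding f_def by (rule suminf_diff[OF sm[OF that] sm[OF px]])
    also have "\<dots> = (\<Sum>n. c (Suc n) * x ^ Suc n - c (Suc n) * (p * x) ^ Suc n)"
      by (subst suminf_split_head) (intro summable_diff sm that px, simp)
    also have "\<dots> = (\<Sum>n. x * (c n * x ^ n) - a * x * (c n * (p * x) ^ n))"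
    proof (rule suminf_cong)
      fix n
      have "p * p ^ n < 1" using p power_Suc_less_one[of p n] by simp
      then have "c (Suc n) * (1 - p ^ Suc n) = c n * (1 - a * p ^ n)"
        unfolding c_def qpoch_Suc using pp[of n] by (simp add: field_simps)
      moreover have "c (Suc n) * x ^ Suc n - c (Suc n) * (p * x) ^ Suc n = (c (Suc n) * (1 - p ^ Suc n)) * x ^ Suc n"
        by (simp add: power_mult_distrib algebra_simps)
      moreover have "(c n * (1 - a * p ^ n)) * x ^ Suc n = x * (c n * x ^ n) - a * x * (c n * (p * x) ^ n)"
        by (simp add: power_mult_distrib algebra_simps)
      ultimately show "c (Suc n) * x ^ Suc n - c (Suc n) * (p * x) ^ Suc n
          = x * (c n * x ^ n) - a * x * (c n * (p * x) ^ n)"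
        by simp
    qed
    also have "\<dots> = x * f x - a * x * f (p * x)"
      unfolding f_def by (subst suminf_diff[symmetric])
          (auto intro!: summable_mult sm that px simp: suminf_mult sm that px)
    finally show ?thesis by (simp add: algebra_simps)
  qed
  have "isCont f 0"
    unfolding f_def by (rule isCont_powser[OF sm[of "1/2"]]) auto
  moreover have "f 0 = 1" unfolding f_def using powser_zero[of c] by (simp add: c_def)
  ultimately have "qpoch_inf (1 * z) p * f z = qpoch_inf (a * z) p"
    by (rule qpoch_inf_functional_equation[OF p]) (simp only: mult_1, rule rec, use z in linarith)
  then have "f z = qpoch_inf (a * z) p / qpoch_inf z p"
    using qpoch_inf_pos[OF p z] by (simp add: field_simps)
  then show ?thesis using sm[of z] z unfolding f_def c_def by (auto simp: sums_iff)
qed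

section \<open>Interchanging sums\<close>

text \<open>
  This justifies interchanging sums: the decay of the kernels provides majorants with separated variables.
\<close>

lemma summable_on_product_majorant:
  fixes F :: "'a \<Rightarrow> 'b \<Rightarrow> 'c::banach" and G :: "'a \<Rightarrow> real" and H :: "'b \<Rightarrow> real"
  assumes G: "G summable_on A" and H: "H summable_on B"
    and G0: "\<And>x. x \<in> A \<Longrightarrow> 0 \<le> G x" and H0: "\<And>y. y \<in> B \<Longrightarrow> 0 \<le> H y"
    and le: "\<And>x y. x \<in> A \<Longrightarrow> y \<in> B \<Longrightarrow> norm (F x y) \<le> G x * H y"
  shows "(\<lambda>(x, y). F x y) summable_on A \<times> B"
proof -
  have "(\<lambda>(x, y). G x * H y) summable_on A \<times> B"
  proof (rule summable_on_SigmaI)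
    fix x assume "x \<in> A"
    show "((\<lambda>y. case (x, y) of (x, y) \<Rightarrow> G x * H y) has_sum G x * infsum H B) B"
      using H by (auto intro!: has_sum_cmult_right)
  qed (auto intro!: summable_on_cmult_left G mult_nonneg_nonneg G0 H0)
  then have "(\<lambda>z. norm ((\<lambda>(x, y). F x y) z)) summable_on A \<times> B"
    by (rule Infinite_Sum.abs_summable_on_comparison_test') (auto intro: le)
  then show ?thesis by (rule abs_summable_summable)
qed

lemma infsum_nat_eq_suminf:
  fixes f :: "nat \<Rightarrow> 'a::banach"
  assumes "summable (\<lambda>n. norm (f n))" shows "infsum f UNIV = suminf f"
  using norm_summable_imp_has_sum[OF assms summable_sums[OF summable_norm_cancel[OF assms]]] infsumI by blast

lemma suminf_swap_product_majorant:
  fixes F :: "nat \<Rightarrow> nat \<Rightarrow> real"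
  assumes G: "summable G" and H: "summable H" and G0: "\<And>n. 0 \<le> G n" and H0: "\<And>m. 0 \<le> H m"
    and le: "\<And>n m. \<bar>F n m\<bar> \<le> G n * H m"
  shows "(\<Sum>n. \<Sum>m. F n m) = (\<Sum>m. \<Sum>n. F n m)"
proof -
  have "(\<lambda>(n, m). F n m) summable_on UNIV \<times> UNIV"
    by (rule summable_on_product_majorant[where G = G and H = H])
       (use assms summable_nonneg_imp_summable_on in auto)
  from infsum_swap_banach[OF this]
  have sw: "(\<Sum>\<^sub>\<infinity>n. \<Sum>\<^sub>\<infinity>m. F n m) = (\<Sum>\<^sub>\<infinity>m. \<Sum>\<^sub>\<infinity>n. F n m)" .
  have r: "summable (\<lambda>m. norm (F n m))" for n
    by (rule summable_comparison_test'[OF summable_mult[OF H, of "G n"]]) (simp add: le)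
  have c: "summable (\<lambda>n. norm (F n m))" for m
    by (rule summable_comparison_test'[OF summable_mult2[OF G, of "H m"]]) (simp add: le)
  have r': "norm (\<Sum>m. F n m) \<le> G n * suminf H" for n
    using summable_norm[OF r[of n]] suminf_le[OF le r[of n, simplified] summable_mult[OF H]] suminf_mult[OF H, of "G n"]
    by simp
  have c': "norm (\<Sum>n. F n m) \<le> suminf G * H m" for m
    using summable_norm[OF c[of m]] suminf_le[OF le c[of m, simplified] summable_mult2[OF G]] suminf_mult2[OF G, of "H m"]
    by simp
  have R: "summable (\<lambda>n. norm (\<Sum>m. F n m))"
    by (rule summable_comparison_test'[OF summable_mult2[OF G, of "suminf H"]]) (use r' in simp)
  have C: "summable (\<lambda>m. norm (\<Sum>n. F n m))"
    by (rule summable_comparison_test'[OF summable_mult[OF H, of "suminf G"]]) (use c' in simp)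
  show ?thesis
    using sw by (simp add: infsum_nat_eq_suminf[OF r] infsum_nat_eq_suminf[OF c] infsum_nat_eq_suminf[OF R] infsum_nat_eq_suminf[OF C])
qed

lemma infsum_complex_of_real: "(\<Sum>\<^sub>\<infinity>x\<in>A. complex_of_real (f x)) = complex_of_real (infsum f A)"
proof (cases "f summable_on A")
  case True
  then show ?thesis by (intro infsumI has_sum_of_real has_sum_infsum)
next
  case False
  have "\<not> (\<lambda>x. complex_of_real (f x)) summable_on A"
  proof
    assume "(\<lambda>x. complex_of_real (f x)) summable_on A"
    from summable_on_Re[OF this] False show False by simp
  qed
  with False show ?thesis by (simp add: infsum_not_exists)
qed

section \<open>The Hahn-Exton series\<close>

locale q_base =
  fixes q :: real
  assumes q_pos: "0 < q" and q_less_1: "q < 1"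
begin

lemma qsq_pos: "0 < q\<^sup>2" and qsq_less_1: "q\<^sup>2 < 1"
  using q_pos q_less_1 by (auto simp: power_less_one_iff)

abbreviation (input) "cx \<equiv> complex_of_real"
abbreviation "poch2 \<equiv> \<lambda>a. qpoch a (q\<^sup>2)"
abbreviation "poch2_inf \<equiv> \<lambda>a. qpoch_inf a (q\<^sup>2)"

lemma gauss_summable: "summable (\<lambda>n. q ^ (n * (n - 1)) * R ^ n)" if "0 \<le> R"
proof -
  have "(\<lambda>n. (q\<^sup>2) ^ n * R) \<longlonglongrightarrow> 0 * R"
    using qsq_pos qsq_less_1 by (intro tendsto_mult tendsto_const LIMSEQ_power_zero) auto
  then have "eventually (\<lambda>n. (q\<^sup>2) ^ n * R < 1/2) sequentially"
    by (intro order_tendstoD(2)) auto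
  then obtain N where N: "\<And>n. n \<ge> N \<Longrightarrow> (q\<^sup>2) ^ n * R < 1/2" by (auto simp: eventually_sequentially)
  show ?thesis
  proof (rule summable_ratio_test)
    show "(1/2::real) < 1" by simp
    fix n assume n: "n \<ge> N"
    have e: "Suc n * (Suc n - 1) = n * (n - 1) + 2 * n" by (cases n) auto
    have "q ^ (Suc n * (Suc n - 1)) * R ^ Suc n = ((q\<^sup>2) ^ n * R) * (q ^ (n * (n - 1)) * R ^ n)"
      unfolding e by (simp add: power_add power_mult)
    moreover have "\<dots> \<le> 1/2 * (q ^ (n * (n - 1)) * R ^ n)"
      using N[OF n] q_pos that by (intro mult_right_mono) auto
    moreover have "0 \<le> q ^ k * R ^ m" for k m using q_pos that by simp
    ultimately show "norm (q ^ (Suc n * (Suc n - 1)) * R ^ Suc n) \<le> 1/2 * norm (q ^ (n * (n - 1)) * R ^ n)"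
      by (metis abs_of_nonneg real_norm_def)
  qed
qed

lemma poch2_q_ge: "poch2_inf (q\<^sup>2) \<le> poch2 (q\<^sup>2) n" and poch2_inf_q_pos: "0 < poch2_inf (q\<^sup>2)"
  using qpoch_inf_le_qpoch[of "q\<^sup>2" "q\<^sup>2"] qpoch_inf_pos[of "q\<^sup>2" "q\<^sup>2"] qsq_pos qsq_less_1 by auto

lemma euler_summable:
  "summable (\<lambda>n. norm ((- 1) ^ n * q ^ (n * (n - 1)) * z ^ n / poch2 (q\<^sup>2) n))"
proof (rule summable_comparison_test')
  show "summable (\<lambda>n. 1 / poch2_inf (q\<^sup>2) * (q ^ (n * (n - 1)) * \<bar>z\<bar> ^ n))"
    by (intro summable_mult gauss_summable) auto
  have p: "0 < poch2 (q\<^sup>2) n" for n using less_le_trans[OF poch2_inf_q_pos poch2_q_ge] .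
  show "norm (norm ((- 1) ^ n * q ^ (n * (n - 1)) * z ^ n / poch2 (q\<^sup>2) n))
      \<le> 1 / poch2_inf (q\<^sup>2) * (q ^ (n * (n - 1)) * \<bar>z\<bar> ^ n)" for n
    using poch2_q_ge[of n] poch2_inf_q_pos q_pos p[of n]
    by (auto simp: abs_mult power_abs divide_simps intro!: mult_right_mono mult_left_mono)
qed

text \<open>
  Euler's expansion of \<open>(z; q\<^sup>2)\<^sub>\<infinity>\<close>. The functional equation is now \<open>f z = (1 - z) f (q\<^sup>2 z)\<close>, and the
  Gaussian factor makes the series converge for all \<open>z\<close>.
\<close>

lemma euler_sums:
  "(\<lambda>n. (- 1) ^ n * q ^ (n * (n - 1)) * z ^ n / poch2 (q\<^sup>2) n) sums poch2_inf z"
proof -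
  define p where "p = q\<^sup>2"
  have p: "0 < p" "p < 1" using qsq_pos qsq_less_1 by (auto simp: p_def)
  define c where "c = (\<lambda>n. (- 1) ^ n * q ^ (n * (n - 1)) / qpoch p p n)"
  define f where "f = (\<lambda>z. \<Sum>n. c n * z ^ n)"
  have pp: "0 < qpoch p p n" for n using qpoch_pos[of p p] p by simp
  have sm: "summable (\<lambda>n. c n * x ^ n)" for x
    using summable_norm_cancel[OF euler_summable[of x]] by (simp add: c_def p_def)
  have rec: "f x = (1 - x) * f (p * x)" for x
  proof -
    have "f x - f (p * x) = (\<Sum>n. c n * x ^ n - c n * (p * x) ^ n)"
      unfolding f_def by (rule suminf_diff[OF sm sm])
    also have "\<dots> = (\<Sum>n. c (Suc n) * x ^ Suc n - c (Suc n) * (p * x) ^ Suc n)"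
      by (subst suminf_split_head) (intro summable_diff sm, simp)
    also have "\<dots> = (\<Sum>n. - x * (c n * (p * x) ^ n))"
    proof (rule suminf_cong)
      fix n
      have "p * p ^ n < 1" using p power_Suc_less_one[of p n] by simp
      have e: "Suc n * (Suc n - 1) = n * (n - 1) + 2 * n" by (cases n) auto
      have "q ^ (Suc n * (Suc n - 1)) = q ^ (n * (n - 1)) * p ^ n"
        unfolding e by (simp add: power_add power_mult p_def)
      with \<open>p * p ^ n < 1\<close> have "c (Suc n) * (1 - p ^ Suc n) = - (c n * p ^ n)"
        unfolding c_def qpoch_Suc using pp[of n] by (simp add: divide_simps del: mult_Suc)
      moreover have "c (Suc n) * x ^ Suc n - c (Suc n) * (p * x) ^ Suc n = (c (Suc n) * (1 - p ^ Suc n)) * x ^ Suc n"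
        by (simp add: power_mult_distrib algebra_simps)
      ultimately show "c (Suc n) * x ^ Suc n - c (Suc n) * (p * x) ^ Suc n = - x * (c n * (p * x) ^ n)"
        by (simp add: power_mult_distrib)
    qed
    also have "\<dots> = - x * f (p * x)"
      unfolding f_def by (rule suminf_mult[OF sm])
    finally show ?thesis by (simp add: algebra_simps)
  qed
  have "isCont f 0"
    unfolding f_def by (rule isCont_powser[OF sm[of "1/2"]]) auto
  moreover have "f 0 = 1" unfolding f_def using powser_zero[of c] by (simp add: c_def)
  ultimately have "qpoch_inf (0 * z) p * f z = qpoch_inf (1 * z) p"
    by (rule qpoch_inf_functional_equation[OF p]) (simp only: mult_1 mult_zero_left diff_zero, rule rec)
  then have "f z = qpoch_inf z p" by (simp add: qpoch_inf_0[OF p])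
  then show ?thesis using sm[of z] unfolding f_def c_def p_def by (simp add: sums_iff)
qed

text \<open>
  The basic hypergeometric series \<open>\<^sub>1\<phi>\<^sub>1 (0; w; q\<^sup>2, z)\<close> of the third Jackson (Hahn-Exton) Bessel function. The
  lower parameter is \<open>w = q\<^bsup>2\<beta>+2\<^esup>\<close> for Bessel index \<open>\<beta>\<close>, while \<open>w = 0\<close> gives back Euler's product.
\<close>

definition hahn_exton :: "real \<Rightarrow> real \<Rightarrow> real" where
  "hahn_exton w z = (\<Sum>n. (- 1) ^ n * q ^ (n * (n - 1)) * z ^ n / (poch2 (q\<^sup>2) n * poch2 w n))"

lemma qBessel_eq_hahn_exton: "qBessel q \<beta> x = hahn_exton (q powr (2 * \<beta> + 2)) (((1 - q) * x)\<^sup>2)"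
  unfolding qBessel_def hahn_exton_def
  by (intro suminf_cong) (simp add: power_mult_distrib power_mult[symmetric] mult_ac)

definition hahn_exton_coeff :: "real \<Rightarrow> nat \<Rightarrow> real" where
  "hahn_exton_coeff w n = (- 1) ^ n * q ^ (n * (n - 1)) / (poch2 (q\<^sup>2) n * poch2 w n)"

lemma hahn_exton_eq: "hahn_exton w z = (\<Sum>n. hahn_exton_coeff w n * z ^ n)"
  unfolding hahn_exton_def hahn_exton_coeff_def by (intro suminf_cong) simp

lemma poch2_pos: "0 \<le> w \<Longrightarrow> w < 1 \<Longrightarrow> 0 < poch2 w n"
  using qpoch_pos qsq_pos qsq_less_1 by blast

lemma poch2_inf_pos: "0 \<le> w \<Longrightarrow> w < 1 \<Longrightarrow> 0 < poch2_inf w"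
  using qpoch_inf_pos qsq_pos qsq_less_1 by blast

lemma hahn_exton_coeff_bound:
  assumes "0 \<le> w" "w < 1"
  shows "\<bar>hahn_exton_coeff w n\<bar> \<le> 1 / (poch2_inf (q\<^sup>2) * poch2_inf w) * q ^ (n * (n - 1))"
proof -
  have "\<bar>hahn_exton_coeff w n\<bar> = q ^ (n * (n - 1)) / (poch2 (q\<^sup>2) n * poch2 w n)"
    using poch2_pos[OF assms, of n] poch2_pos[of "q\<^sup>2" n] qsq_pos qsq_less_1 q_pos
    by (simp add: hahn_exton_coeff_def abs_mult power_abs)
  also have "\<dots> \<le> q ^ (n * (n - 1)) / (poch2_inf (q\<^sup>2) * poch2_inf w)"
    using poch2_inf_pos[OF assms] poch2_inf_q_pos poch2_q_ge[of n] qpoch_inf_le_qpoch[OF qsq_pos qsq_less_1, of w n] assms q_pos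
    by (intro divide_left_mono mult_mono mult_pos_pos) (auto intro: less_le_trans)
  finally show ?thesis by simp
qed

lemma hahn_exton_abs_summable:
  assumes "0 \<le> w" "w < 1"
  shows "summable (\<lambda>n. norm (hahn_exton_coeff w n * z ^ n))"
proof (rule summable_comparison_test')
  show "summable (\<lambda>n. 1 / (poch2_inf (q\<^sup>2) * poch2_inf w) * (q ^ (n * (n - 1)) * \<bar>z\<bar> ^ n))"
    by (intro summable_mult gauss_summable) auto
  show "norm (norm (hahn_exton_coeff w n * z ^ n))
      \<le> 1 / (poch2_inf (q\<^sup>2) * poch2_inf w) * (q ^ (n * (n - 1)) * \<bar>z\<bar> ^ n)" for n
    using mult_right_mono[OF hahn_exton_coeff_bound[OF assms, of n], of "\<bar>z\<bar> ^ n"]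
      by (simp add: abs_mult power_abs mult_ac)
qed

lemmas hahn_exton_summable = summable_norm_cancel[OF hahn_exton_abs_summable]

text \<open>
  The coefficients satisfy \<open>c\<^sub>n\<^sub>+\<^sub>1 (1 - q\<^bsup>2n+2\<^esup>) (1 - w q\<^bsup>2n\<^esup>) = - q\<^bsup>2n\<^esup> c\<^sub>n\<close>. The factors on the
  left are the eigenvalues of dilation operators on \<open>z\<^bsup>n+1\<^esup>\<close>, so the recurrence is a \<open>q\<close>-difference equation.
\<close>

lemma hahn_exton_rec:
  assumes w: "0 < w" "w < 1"
  shows "hahn_exton w z - (1 + w / q\<^sup>2) * hahn_exton w (q\<^sup>2 * z) + w / q\<^sup>2 * hahn_exton w (q\<^sup>2 * (q\<^sup>2 * z))
      = - z * hahn_exton w (q\<^sup>2 * z)"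
proof -
  define p where "p = q\<^sup>2"
  have p: "0 < p" "p < 1" using qsq_pos qsq_less_1 by (auto simp: p_def)
  note sm = hahn_exton_summable[OF less_imp_le[OF w(1)] w(2)]
  let ?c = "hahn_exton_coeff w"
  have c: "?c (Suc n) * ((1 - p ^ Suc n) * (1 - w * p ^ n)) = - (?c n * p ^ n)" for n
  proof -
    have e: "q ^ (Suc n * (Suc n - 1)) = q ^ (n * (n - 1)) * p ^ n"
      by (cases n) (simp_all add: power_add power_mult p_def power2_eq_square algebra_simps power_mult_distrib)
    have "0 < 1 - p * p ^ n" using p power_Suc_less_one[of p n] by simp
    moreover have "w * p ^ n \<le> w * 1" using p w by (intro mult_left_mono) (auto simp: power_le_one)
    then have "0 < 1 - w * p ^ n" using w(2) by linarith
    ultimately show ?thesis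
      using poch2_pos[of w n] poch2_pos[of p n] w p
      unfolding hahn_exton_coeff_def e by (simp add: qpoch_Suc p_def[symmetric] divide_simps)
  qed
  have fac: "?c n * z ^ n - (1 + v) * (?c n * (p * z) ^ n) + v * (?c n * (p * (p * z)) ^ n)
      = ?c n * ((1 - p ^ n) * (1 - v * p ^ n)) * z ^ n" for n v
    by (simp add: power_mult_distrib algebra_simps)
  have "hahn_exton w z - (1 + w / p) * hahn_exton w (p * z) + w / p * hahn_exton w (p * (p * z))
     = (\<Sum>n. ?c n * z ^ n - (1 + w / p) * (?c n * (p * z) ^ n) + w / p * (?c n * (p * (p * z)) ^ n))"
    unfolding hahn_exton_eq
    by (intro sums_unique sums_add sums_diff sums_mult summable_sums sm)
  also have "\<dots> = (\<Sum>n. ?c n * ((1 - p ^ n) * (1 - w / p * p ^ n)) * z ^ n)"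
    by (simp only: fac)
  also have "\<dots> = (\<Sum>n. ?c (Suc n) * ((1 - p ^ Suc n) * (1 - w / p * p ^ Suc n)) * z ^ Suc n)"
  proof (subst suminf_split_head)
    have "summable (\<lambda>n. ?c n * z ^ n - (1 + w / p) * (?c n * (p * z) ^ n) + w / p * (?c n * (p * (p * z)) ^ n))"
      by (intro summable_add summable_diff summable_mult sm)
    then show "summable (\<lambda>n. ?c n * ((1 - p ^ n) * (1 - w / p * p ^ n)) * z ^ n)"
      by (simp only: fac)
  qed simp
  also have "\<dots> = (\<Sum>n. - z * (?c n * (p * z) ^ n))"
  proof (rule suminf_cong)
    fix n
    have "w / p * p ^ Suc n = w * p ^ n" using p by simp
    then show "?c (Suc n) * ((1 - p ^ Suc n) * (1 - w / p * p ^ Suc n)) * z ^ Suc n = - z * (?c n * (p * z) ^ n)"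
      using c[of n] by (simp only: ) (simp add: power_mult_distrib)
  qed
  also have "\<dots> = - z * hahn_exton w (p * z)" unfolding hahn_exton_eq by (rule suminf_mult[OF sm])
  finally show ?thesis by (simp add: p_def)
qed

text \<open>
  Expanding \<open>(w q\<^bsup>2n\<^esup>; q\<^sup>2)\<^sub>\<infinity>\<close> by Euler's formula gives a double series that is symmetric in \<open>w\<close> and
  \<open>z\<close>. Summing it over the other index recovers a product again, now one that depends on \<open>z\<close>.
\<close>

lemma hahn_exton_symmetric_expansion:
  assumes w: "0 \<le> w" "w < 1"
  shows "poch2_inf w * hahn_exton w z
      = (\<Sum>m. (- 1) ^ m * q ^ (m * (m - 1)) * w ^ m / poch2 (q\<^sup>2) m * poch2_inf (z * (q\<^sup>2) ^ m))"
proof -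
  define p where "p = q\<^sup>2"
  have p: "0 < p" "p < 1" using qsq_pos qsq_less_1 by (auto simp: p_def)
  define e where "e = (\<lambda>n. (- 1) ^ n * q ^ (n * (n - 1)) / poch2 p n)"
  have eul: "(\<lambda>n. e n * z ^ n) sums poch2_inf z" for z
    using euler_sums[of z] by (simp add: e_def p_def)
  have eul_abs: "summable (\<lambda>n. norm (e n * z ^ n))" for z
    using euler_summable[of z] by (simp add: e_def p_def)
  have sm: "poch2_inf (x * p ^ n) * (e n * y ^ n) = (\<Sum>m. e n * y ^ n * (e m * x ^ m * p ^ (n * m)))" for n x y
  proof -
    have "(\<lambda>m. e n * y ^ n * (e m * (x * p ^ n) ^ m)) sums (e n * y ^ n * poch2_inf (x * p ^ n))"
      by (rule sums_mult[OF eul])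
    then show ?thesis by (simp add: sums_iff power_mult_distrib power_mult[symmetric] mult_ac)
  qed
  have "poch2_inf w * hahn_exton w z = (\<Sum>n. poch2_inf w * (hahn_exton_coeff w n * z ^ n))"
    unfolding hahn_exton_eq by (rule suminf_mult[symmetric, OF hahn_exton_summable[OF w]])
  also have "\<dots> = (\<Sum>n. poch2_inf (w * p ^ n) * (e n * z ^ n))"
  proof (rule suminf_cong)
    fix n
    show "poch2_inf w * (hahn_exton_coeff w n * z ^ n) = poch2_inf (w * p ^ n) * (e n * z ^ n)"
      using poch2_pos[OF w, of n] qpoch_inf_split[OF qsq_pos qsq_less_1, of w n]
      by (simp add: hahn_exton_coeff_def e_def p_def)
  qed
  also have "\<dots> = (\<Sum>n. \<Sum>m. e n * z ^ n * (e m * w ^ m * p ^ (n * m)))" by (simp add: sm)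
  also have "\<dots> = (\<Sum>m. \<Sum>n. e n * z ^ n * (e m * w ^ m * p ^ (n * m)))"
  proof (rule suminf_swap_product_majorant)
    show "summable (\<lambda>n. norm (e n * z ^ n))" "summable (\<lambda>m. norm (e m * w ^ m))" by (rule eul_abs)+
    fix n m
    have "p ^ (n * m) \<le> 1" using p by (auto simp: power_le_one)
    then have "\<bar>e n * z ^ n * (e m * w ^ m)\<bar> * p ^ (n * m) \<le> \<bar>e n * z ^ n * (e m * w ^ m)\<bar> * 1"
      by (intro mult_left_mono) auto
    then show "\<bar>e n * z ^ n * (e m * w ^ m * p ^ (n * m))\<bar> \<le> norm (e n * z ^ n) * norm (e m * w ^ m)"
      using p by (simp add: abs_mult mult_ac)
  qed auto
  also have "\<dots> = (\<Sum>m. poch2_inf (z * p ^ m) * (e m * w ^ m))"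
    unfolding sm by (intro suminf_cong) (simp add: mult_ac)
  finally show ?thesis by (simp add: e_def p_def mult_ac)
qed

text \<open>
  At \<open>z = q\<^bsup>-2k\<^esup>\<close> the product \<open>(z q\<^bsup>2m\<^esup>; q\<^sup>2)\<^sub>\<infinity>\<close> contains the factor \<open>0\<close> for all \<open>m \<le> k\<close>. The
  symmetric expansion therefore starts at \<open>m = k + 1\<close>, and from there its Gaussian coefficients are smaller than any
  geometric sequence.
\<close>

lemma hahn_exton_decay:
  assumes w: "0 \<le> w" "w < 1" and r: "0 < r" "r \<le> 1"
  shows "\<exists>C. \<forall>k. \<bar>hahn_exton w (1 / (q\<^sup>2) ^ k)\<bar> \<le> C * r ^ k"
proof -
  define p where "p = q\<^sup>2"
  have p: "0 < p" "p < 1" using qsq_pos qsq_less_1 by (auto simp: p_def)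
  define P where "P = poch2_inf p"
  have P: "0 < P" "P \<le> poch2 p n" for n using poch2_inf_q_pos poch2_q_ge by (auto simp: P_def p_def)
  let ?T = "\<lambda>m. q ^ (m * (m - 1)) * (w / r) ^ m / P"
  have smT: "summable ?T" using w r by (intro summable_divide gauss_summable) auto
  have b: "\<bar>(- 1) ^ m * q ^ (m * (m - 1)) * w ^ m / poch2 p m * poch2_inf (1 / p ^ k * p ^ m)\<bar> \<le> r ^ k * ?T m" for k m
  proof (cases "m \<le> k")
    case True
    then have "p ^ m * p ^ (k - m) = p ^ k" by (simp add: power_add[symmetric])
    then have "1 / p ^ k * p ^ m * p ^ (k - m) = 1" using p by simp
    then have "poch2_inf (1 / p ^ k * p ^ m) = 0"
      using qpoch_inf_eq_0[OF p] unfolding p_def by blast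
    then show ?thesis using w r P q_pos by simp
  next
    case False
    then have "1 / p ^ k * p ^ m = p ^ (m - k)" using p by (simp add: power_diff)
    moreover have "0 \<le> p ^ (m - k)" "p ^ (m - k) \<le> 1" using p by (auto simp: power_le_one)
    ultimately have 1: "0 \<le> poch2_inf (1 / p ^ k * p ^ m)" "poch2_inf (1 / p ^ k * p ^ m) \<le> 1"
      using qpoch_inf_bounds[OF p] by (auto simp: p_def)
    have "\<bar>(- 1) ^ m * q ^ (m * (m - 1)) * w ^ m / poch2 p m * poch2_inf (1 / p ^ k * p ^ m)\<bar>
       = q ^ (m * (m - 1)) * w ^ m / poch2 p m * poch2_inf (1 / p ^ k * p ^ m)"
      using P(2)[of m] P(1) 1 w q_pos by (simp add: abs_mult power_abs)
    also have "\<dots> \<le> q ^ (m * (m - 1)) * w ^ m / P * 1"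
      using P(2)[of m] P(1) 1 w q_pos by (intro mult_mono divide_left_mono) (auto intro: mult_pos_pos less_le_trans)
    also have "\<dots> \<le> q ^ (m * (m - 1)) * w ^ m / P * (r ^ k / r ^ m)"
    proof (intro mult_left_mono)
      have "r ^ m \<le> r ^ k" using False r by (intro power_decreasing) auto
      then show "1 \<le> r ^ k / r ^ m" using r by simp
    qed (use w P q_pos in auto)
    also have "\<dots> = r ^ k * ?T m" by (simp add: power_divide mult_ac)
    finally show ?thesis .
  qed
  have "\<bar>hahn_exton w (1 / p ^ k)\<bar> \<le> suminf ?T / poch2_inf w * r ^ k" for k
  proof -
    let ?S = "\<lambda>m. (- 1) ^ m * q ^ (m * (m - 1)) * w ^ m / poch2 p m * poch2_inf (1 / p ^ k * p ^ m)"
    have sS: "summable (\<lambda>m. \<bar>?S m\<bar>)"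
      by (rule summable_comparison_test'[OF summable_mult[OF smT, of "r ^ k"]]) (use b in simp)
    have "poch2_inf w * \<bar>hahn_exton w (1 / p ^ k)\<bar> = \<bar>suminf ?S\<bar>"
      using hahn_exton_symmetric_expansion[OF w, of "1 / p ^ k"] poch2_inf_pos[OF w]
      by (simp add: p_def[symmetric] abs_mult[symmetric]) (metis abs_mult abs_of_pos)
    also have "\<dots> \<le> (\<Sum>m. \<bar>?S m\<bar>)" using summable_rabs[OF sS] .
    also have "\<dots> \<le> (\<Sum>m. r ^ k * ?T m)" by (intro suminf_le b sS summable_mult smT)
    also have "\<dots> = r ^ k * suminf ?T" by (rule suminf_mult[OF smT])
    finally show ?thesis using poch2_inf_pos[OF w] by (simp add: field_simps)
  qed
  then show ?thesis unfolding p_def by blast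
qed

lemma hahn_exton_near_0:
  assumes w: "0 \<le> w" "w < 1"
  shows "\<exists>C\<ge>0. \<forall>z. 0 \<le> z \<and> z \<le> 1 \<longrightarrow> \<bar>hahn_exton w z - 1\<bar> \<le> C * z"
proof (intro exI conjI allI impI)
  have sm: "summable (\<lambda>n. \<bar>hahn_exton_coeff w (Suc n)\<bar>)"
    using hahn_exton_abs_summable[OF w, of 1] summable_Suc_iff[of "\<lambda>n. \<bar>hahn_exton_coeff w n\<bar>"] by simp
  show "0 \<le> (\<Sum>n. \<bar>hahn_exton_coeff w (Suc n)\<bar>)" by (intro suminf_nonneg sm) auto
  fix z :: real assume z: "0 \<le> z \<and> z \<le> 1"
  have le: "\<bar>hahn_exton_coeff w (Suc n) * z ^ Suc n\<bar> \<le> \<bar>hahn_exton_coeff w (Suc n)\<bar> * z" for n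
    using z power_decreasing[of 1 "Suc n" z] by (simp add: abs_mult mult_left_mono del: power_Suc)
  have sm2: "summable (\<lambda>n. \<bar>hahn_exton_coeff w (Suc n) * z ^ Suc n\<bar>)"
    using hahn_exton_abs_summable[OF w, of z] summable_Suc_iff[of "\<lambda>n. \<bar>hahn_exton_coeff w n * z ^ n\<bar>"] by simp
  have "hahn_exton w z - 1 = (\<Sum>n. hahn_exton_coeff w (Suc n) * z ^ Suc n)"
    unfolding hahn_exton_eq
      by (subst suminf_split_head[OF hahn_exton_summable[OF w]]) (simp add: hahn_exton_coeff_def)
  then have "\<bar>hahn_exton w z - 1\<bar> \<le> (\<Sum>n. \<bar>hahn_exton_coeff w (Suc n) * z ^ Suc n\<bar>)"
    using summable_rabs[OF sm2] by simp
  also have "\<dots> \<le> (\<Sum>n. \<bar>hahn_exton_coeff w (Suc n)\<bar> * z)"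
    by (intro suminf_le le sm2 summable_mult2 sm)
  also have "\<dots> = (\<Sum>n. \<bar>hahn_exton_coeff w (Suc n)\<bar>) * z" by (rule suminf_mult2[OF sm, symmetric])
  finally show "\<bar>hahn_exton w z - 1\<bar> \<le> (\<Sum>n. \<bar>hahn_exton_coeff w (Suc n)\<bar>) * z" .
qed

end

section \<open>Sums over the lattice and Mellin exponents\<close>

text \<open>
  The argument \<open>(1 - q) x\<close> of the Bessel series lies on the lattice together with \<open>x\<close> exactly because
  \<open>1 - q\<close> does. The decay of the kernel holds at lattice points, hence the assumption.
\<close>

locale q_lattice = q_base +
  assumes lattice: "1 - q \<in> Rq_pos q"
begin

abbreviation "L \<equiv> Rq_pos q"
abbreviation "j \<equiv> qBessel q"

lemma L_iff: "x \<in> L \<longleftrightarrow> (\<exists>n. x = q powi n)" by (auto simp: Rq_pos_def)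

lemma L_pos: "x \<in> L \<Longrightarrow> 0 < x" using q_pos by (auto simp: L_iff)
lemma L_nz: "x \<in> L \<Longrightarrow> x \<noteq> 0" using L_pos by blast
lemma L_one: "1 \<in> L" unfolding L_iff by (rule exI[of _ 0]) simp
lemma L_q: "q \<in> L" unfolding L_iff by (rule exI[of _ 1]) simp

lemma L_mult: "x \<in> L \<Longrightarrow> y \<in> L \<Longrightarrow> x * y \<in> L"
  using q_pos unfolding L_iff by (metis less_irrefl power_int_add)

lemma L_inverse: "x \<in> L \<Longrightarrow> inverse x \<in> L"
  unfolding L_iff by (metis power_int_minus)

lemma L_divide: "x \<in> L \<Longrightarrow> y \<in> L \<Longrightarrow> x / y \<in> L"
  by (simp add: divide_inverse L_mult L_inverse)

lemma L_power: "x \<in> L \<Longrightarrow> x ^ n \<in> L"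
  by (induction n) (auto simp: L_one L_mult)

lemma L_cases:
  assumes "x \<in> L"
  obtains n :: nat where "x = q ^ n" | k :: nat where "x = 1 / q ^ Suc k"
proof -
  from assms obtain n :: int where n: "x = q powi n" by (auto simp: L_iff)
  show thesis
  proof (cases "0 \<le> n")
    case True
    then show ?thesis using n that(1)[of "nat n"] by (simp add: power_int_def)
  next
    case False
    then obtain k where "nat (- n) = Suc k" by (cases "nat (- n)") auto
    then show ?thesis using n that(2)[of k] False by (simp add: power_int_def power_inverse divide_inverse)
  qed
qed

lemma L_scale_bij: "c \<in> L \<Longrightarrow> bij_betw (\<lambda>x. c * x) L L"
  by (rule bij_betwI[where g = "\<lambda>x. x / c"]) (auto simp: L_mult L_divide L_nz)

lemma infsum_L_scale: "c \<in> L \<Longrightarrow> infsum (\<lambda>x. f (c * x)) L = infsum f L"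
  by (rule infsum_reindex_bij_betw[OF L_scale_bij])

lemma summable_L_scale: "c \<in> L \<Longrightarrow> (\<lambda>x. f (c * x)) summable_on L \<longleftrightarrow> f summable_on L"
  by (rule summable_on_reindex_bij_betw[OF L_scale_bij])

lemma q_power_inj: "inj (\<lambda>n::nat. q ^ n)"
proof (rule injI)
  fix m n :: nat assume "q ^ m = q ^ n"
  then show "m = n" using power_inject_exp'[of q m n] q_pos q_less_1 by auto
qed

lemma L_unit_range: "{x \<in> L. x \<le> 1} = range (\<lambda>n::nat. q ^ n)"
proof safe
  fix x assume "x \<in> L" "x \<le> 1"
  then show "x \<in> range (\<lambda>n::nat. q ^ n)"
  proof (cases rule: L_cases)
    case (2 k)
    have "q ^ Suc k < 1" using q_pos q_less_1 by (rule power_Suc_less_one)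
    then have "1 < x" using 2 q_pos by simp
    then show ?thesis using \<open>x \<le> 1\<close> by simp
  qed auto
qed (use q_pos q_less_1 in \<open>auto simp: power_le_one intro!: L_power L_q\<close>)

lemma L_gt_1: assumes "x \<in> L" "1 < x" obtains k where "x = 1 / q ^ Suc k"
  using assms(1)
proof (cases rule: L_cases)
  case (1 n)
  then show ?thesis using assms(2) q_pos q_less_1 power_le_one[of q n] by simp
qed (use that in blast)

lemma infsum_L_unit:
  assumes "\<And>x. x \<in> L \<Longrightarrow> 1 < x \<Longrightarrow> f x = 0"
  shows "infsum f L = infsum (\<lambda>n::nat. f (q ^ n)) UNIV"
proof -
  have "infsum f L = infsum f {x \<in> L. x \<le> 1}"
    by (rule infsum_cong_neutral) (use assms in force)+
  also have "\<dots> = infsum (\<lambda>n::nat. f (q ^ n)) UNIV"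
    unfolding L_unit_range by (subst infsum_reindex[OF q_power_inj]) (simp add: o_def)
  finally show ?thesis .
qed

lemma summable_powr_small: "0 < s \<Longrightarrow> (\<lambda>x. x powr s) summable_on {x \<in> L. x \<le> 1}"
proof -
  assume s: "0 < s"
  have "q powr s < 1" using s q_pos q_less_1 by (simp add: powr01_less_one)
  then have "summable (\<lambda>n. (q powr s) ^ n)" by simp
  then have "(\<lambda>n::nat. (q powr s) ^ n) summable_on UNIV"
    by (rule summable_nonneg_imp_summable_on) simp
  moreover have "(q powr s) ^ n = (q ^ n) powr s" for n
    using q_pos by (simp add: powr_power powr_realpow[symmetric] powr_powr mult.commute)
  ultimately show ?thesis
    unfolding L_unit_range by (subst summable_on_reindex[OF q_power_inj]) (simp add: o_def)
qed

lemma summable_powr_large: "0 < s \<Longrightarrow> (\<lambda>x. x powr - s) summable_on {x \<in> L. 1 \<le> x}"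
proof -
  assume s: "0 < s"
  have "bij_betw inverse {x \<in> L. 1 \<le> x} {x \<in> L. x \<le> 1}"
    by (rule bij_betwI[where g = inverse]) (auto simp: L_inverse inverse_le_1_iff one_le_inverse dest: L_pos)
  from summable_on_reindex_bij_betw[OF this, of "\<lambda>x. x powr s"] summable_powr_small[OF s]
  have "(\<lambda>x. inverse x powr s) summable_on {x \<in> L. 1 \<le> x}" by simp
  then show ?thesis
    by (rule summable_on_cong[THEN iffD1, rotated]) (auto simp: powr_minus inverse_powr dest: L_pos)
qed

text \<open>
  Absolute convergence of the Jackson integral \<open>\<integral> H x x\<^bsup>s-1\<^esup> d\<^sub>qx\<close>, the Mellin transform of \<open>H\<close> at the exponent
  \<open>s\<close>. Convergence conditions are stated through such exponents.
\<close>

definition mellin :: "real \<Rightarrow> (real \<Rightarrow> 'a::real_normed_vector) \<Rightarrow> bool" where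
  "mellin s H \<longleftrightarrow> (\<lambda>x. norm (H x) * x powr s) summable_on L"

lemma mellin_le:
  assumes "mellin s G" "\<And>x. x \<in> L \<Longrightarrow> norm (H x) \<le> C * norm (G x)"
  shows "mellin s H"
  unfolding mellin_def
proof (rule summable_on_comparison_test)
  show "(\<lambda>x. C * (norm (G x) * x powr s)) summable_on L"
    using assms(1) unfolding mellin_def by (rule summable_on_cmult_right)
  show "norm (H x) * x powr s \<le> C * (norm (G x) * x powr s)" if "x \<in> L" for x
    using mult_right_mono[OF assms(2)[OF that], of "x powr s"] by (simp add: mult_ac)
qed auto

lemma mellin_cong: "(\<And>x. x \<in> L \<Longrightarrow> norm (H x) = norm (G x)) \<Longrightarrow> mellin s H \<longleftrightarrow> mellin s G"
  unfolding mellin_def by (rule summable_on_cong) simp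

lemma mellin_add:
  fixes F G :: "real \<Rightarrow> 'a::real_normed_vector"
  assumes "mellin s F" "mellin s G" shows "mellin s (\<lambda>x. F x + G x)"
  unfolding mellin_def
proof (rule summable_on_comparison_test)
  show "(\<lambda>x. norm (F x) * x powr s + norm (G x) * x powr s) summable_on L"
    using assms unfolding mellin_def by (rule summable_on_add)
  show "norm (F x + G x) * x powr s \<le> norm (F x) * x powr s + norm (G x) * x powr s" for x
    using mult_right_mono[OF norm_triangle_ineq[of "F x" "G x"], of "x powr s"] by (simp add: algebra_simps)
qed auto

lemma mellin_powr_shift: "mellin s (\<lambda>x. H x * cx (x powr r)) \<longleftrightarrow> mellin (s + r) H"
  unfolding mellin_def by (intro summable_on_cong) (auto simp: norm_mult powr_add mult_ac)

lemma mellin_powr_mult: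
  assumes "mellin (s + r) H" "\<And>x. x \<in> L \<Longrightarrow> norm (G x) \<le> C * norm (H x) * x powr r"
  shows "mellin s G"
  unfolding mellin_def
proof (rule summable_on_comparison_test)
  show "(\<lambda>x. C * (norm (H x) * x powr (s + r))) summable_on L"
    using assms(1) unfolding mellin_def by (rule summable_on_cmult_right)
  show "norm (G x) * x powr s \<le> C * (norm (H x) * x powr (s + r))" if "x \<in> L" for x
    using mult_right_mono[OF assms(2)[OF that], of "x powr s"] by (simp add: mult_ac powr_add)
qed auto

lemma mellin_scale: "c \<in> L \<Longrightarrow> mellin s H \<Longrightarrow> mellin s (\<lambda>x. H (c * x))"
proof -
  assume c: "c \<in> L" and H: "mellin s H"
  have "(\<lambda>x. norm (H (c * x)) * (c * x) powr s) summable_on L"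
    using H unfolding mellin_def by (subst summable_L_scale[OF c])
  then have "(\<lambda>x. norm (H (c * x)) * (c * x) powr s * (1 / c powr s)) summable_on L"
    by (rule summable_on_cmult_left)
  then show ?thesis unfolding mellin_def
    by (rule summable_on_cong[THEN iffD1, rotated]) (use L_pos[OF c] L_pos in \<open>auto simp: powr_mult less_imp_le\<close>)
qed

lemma mellin_of_bounds:
  assumes "a < s" "s < b"
    and small: "\<And>x. x \<in> L \<Longrightarrow> x \<le> 1 \<Longrightarrow> norm (H x) \<le> C * x powr - a"
    and large: "\<And>x. x \<in> L \<Longrightarrow> 1 \<le> x \<Longrightarrow> norm (H x) \<le> D * x powr - b"
  shows "mellin s H"
proof -
  have "(\<lambda>x. norm (H x) * x powr s) summable_on {x \<in> L. x \<le> 1}"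
  proof (rule summable_on_comparison_test)
    show "(\<lambda>x. C * x powr (s - a)) summable_on {x \<in> L. x \<le> 1}"
      using assms by (intro summable_on_cmult_right summable_powr_small) simp
    show "norm (H x) * x powr s \<le> C * x powr (s - a)" if "x \<in> {x \<in> L. x \<le> 1}" for x
      using mult_right_mono[OF small[of x], of "x powr s"] that by (simp add: mult_ac powr_add[symmetric])
  qed auto
  moreover have "(\<lambda>x. norm (H x) * x powr s) summable_on {x \<in> L. 1 \<le> x}"
  proof (rule summable_on_comparison_test)
    show "(\<lambda>x. D * x powr - (b - s)) summable_on {x \<in> L. 1 \<le> x}"
      using assms by (intro summable_on_cmult_right summable_powr_large) simp
    show "norm (H x) * x powr s \<le> D * x powr - (b - s)" if "x \<in> {x \<in> L. 1 \<le> x}" for x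
      using mult_right_mono[OF large[of x], of "x powr s"] that by (simp add: mult_ac powr_add[symmetric])
  qed auto
  ultimately have "(\<lambda>x. norm (H x) * x powr s) summable_on {x \<in> L. x \<le> 1} \<union> {x \<in> L. 1 \<le> x}"
    by (rule summable_on_union)
  moreover have "{x \<in> L. x \<le> 1} \<union> {x \<in> L. 1 \<le> x} = L" by auto
  ultimately show ?thesis unfolding mellin_def by simp
qed

section \<open>The \<open>q\<close>-Bessel function on the lattice\<close>

lemma qBessel_parameter_bounds: "- 1 < \<beta> \<Longrightarrow> 0 < q powr (2 * \<beta> + 2) \<and> q powr (2 * \<beta> + 2) < 1"
  using q_pos q_less_1 by (simp add: powr01_less_one)

lemma qBessel_0 [simp]: "j \<beta> 0 = 1"
proof -
  have "j \<beta> 0 = (\<Sum>n. hahn_exton_coeff (q powr (2 * \<beta> + 2)) n * 0 ^ n)"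
    by (simp add: qBessel_eq_hahn_exton hahn_exton_eq)
  then show ?thesis using powser_zero[of "hahn_exton_coeff (q powr (2 * \<beta> + 2))"] by (simp add: hahn_exton_coeff_def)
qed

text \<open>
  Up to the point where \<open>(1 - q) x\<close> reaches \<open>1\<close> the function is bounded and \<open>x\<^bsup>-\<theta>\<^esup>\<close> is bounded below; beyond
  it the squares \<open>((1 - q) x)\<^sup>2\<close> are the points \<open>q\<^bsup>-2k\<^esup>\<close> at which the Hahn-Exton series decays.
\<close>

lemma qBessel_decay:
  assumes b: "- 1 < \<beta>" and th: "0 \<le> \<theta>"
  shows "\<exists>C>0. \<forall>x\<in>L. \<bar>j \<beta> x\<bar> \<le> C * x powr - \<theta>"
proof -
  define w where "w = q powr (2 * \<beta> + 2)"
  have w: "0 \<le> w" "w < 1" using qBessel_parameter_bounds[OF b] by (auto simp: w_def)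
  obtain C1 where C1: "C1 \<ge> 0" "\<And>z. 0 \<le> z \<and> z \<le> 1 \<Longrightarrow> \<bar>hahn_exton w z - 1\<bar> \<le> C1 * z"
    using hahn_exton_near_0[OF w] by blast
  have r: "0 < q powr \<theta>" "q powr \<theta> \<le> 1" using q_pos q_less_1 th by (auto simp: powr_le1)
  obtain C2 where C2: "\<And>k. \<bar>hahn_exton w (1 / (q\<^sup>2) ^ k)\<bar> \<le> C2 * (q powr \<theta>) ^ k"
    using hahn_exton_decay[OF w r] by blast
  define C where "C = 1 + C1 + \<bar>C2\<bar>"
  have C: "0 < C" using C1 by (simp add: C_def)
  have *: "\<bar>hahn_exton w (X\<^sup>2)\<bar> \<le> C * X powr - \<theta>" if "X \<in> L" for X
    using that
  proof (cases rule: L_cases)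
    case (1 n)
    have X: "0 < X" "X \<le> 1" using 1 q_pos q_less_1 by (auto simp: power_le_one)
    then have X2: "X\<^sup>2 \<le> 1" by (simp add: power_le_one)
    have "\<bar>hahn_exton w (X\<^sup>2)\<bar> \<le> 1 + C1 * X\<^sup>2" using C1(2)[of "X\<^sup>2"] X2 by auto
    also have "\<dots> \<le> C * 1" using mult_left_mono[OF X2 C1(1)] by (simp add: C_def)
    also have "\<dots> \<le> C * X powr - \<theta>"
      using powr_mono'[of "- \<theta>" 0 X] X th C by (intro mult_left_mono) auto
    finally show ?thesis .
  next
    case (2 k)
    have "(q powr \<theta>) ^ Suc k = X powr - \<theta>"
      using q_pos 2 by (simp add: powr_minus powr_divide powr_power[symmetric] powr_mult powr_realpow[symmetric] powr_powr inverse_powr  algebra_simps powr_add)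
    moreover have "X\<^sup>2 = 1 / (q\<^sup>2) ^ Suc k" using 2
      by (simp add: power_divide power_mult[symmetric] power_mult_distrib mult.commute)
    ultimately have "\<bar>hahn_exton w (X\<^sup>2)\<bar> \<le> C2 * X powr - \<theta>" using C2[of "Suc k"] by simp
    also have "\<dots> \<le> C * X powr - \<theta>" using C1(1) by (intro mult_right_mono) (auto simp: C_def)
    finally show ?thesis .
  qed
  show ?thesis
  proof (intro exI conjI ballI)
    show "0 < C * (1 - q) powr - \<theta>" using C q_less_1 by simp
    fix x assume x: "x \<in> L"
    have "\<bar>j \<beta> x\<bar> \<le> C * ((1 - q) * x) powr - \<theta>"
      unfolding qBessel_eq_hahn_exton w_def[symmetric] by (intro * L_mult lattice x)
    then show "\<bar>j \<beta> x\<bar> \<le> C * (1 - q) powr - \<theta> * x powr - \<theta>"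
      using q_less_1 L_pos[OF x] by (simp add: powr_mult less_imp_le mult.assoc)
  qed
qed

lemma qBessel_bounded: "- 1 < \<beta> \<Longrightarrow> \<exists>C\<ge>1. \<forall>x\<in>insert 0 L. \<bar>j \<beta> x\<bar> \<le> C"
proof -
  assume "- 1 < \<beta>"
  then obtain C where C: "C > 0" "\<forall>x\<in>L. \<bar>j \<beta> x\<bar> \<le> C * x powr - 0" using qBessel_decay[of \<beta> 0] by auto
  have "\<bar>j \<beta> x\<bar> \<le> C + 1" if "x \<in> insert 0 L" for x
    using that C L_nz by fastforce
  then show ?thesis using C(1) by (intro exI[of _ "C + 1"]) auto
qed

lemma qBessel_near_0:
  assumes b: "- 1 < \<beta>" shows "\<exists>C\<ge>0. \<forall>x\<in>L. \<bar>j \<beta> x - 1\<bar> \<le> C * x\<^sup>2"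
proof -
  define w where "w = q powr (2 * \<beta> + 2)"
  have w: "0 \<le> w" "w < 1" using qBessel_parameter_bounds[OF b] by (auto simp: w_def)
  obtain C1 where C1: "C1 \<ge> 0" "\<And>z. 0 \<le> z \<and> z \<le> 1 \<Longrightarrow> \<bar>hahn_exton w z - 1\<bar> \<le> C1 * z"
    using hahn_exton_near_0[OF w] by blast
  obtain B where B: "B \<ge> 1" "\<And>x. x \<in> L \<Longrightarrow> \<bar>j \<beta> x\<bar> \<le> B" using qBessel_bounded[OF b] by auto
  have "\<bar>j \<beta> x - 1\<bar> \<le> (C1 + B + 1) * ((1 - q) * x)\<^sup>2" if x: "x \<in> L" for x
  proof (cases "(1 - q) * x \<le> 1")
    case True
    have "0 \<le> (1 - q) * x" using L_pos[OF x] q_less_1 by simp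
    then have "((1 - q) * x)\<^sup>2 \<le> 1" using True by (simp add: power_le_one)
    then have "\<bar>j \<beta> x - 1\<bar> \<le> C1 * ((1 - q) * x)\<^sup>2"
      unfolding qBessel_eq_hahn_exton w_def[symmetric] by (intro C1) auto
    also have "\<dots> \<le> (C1 + B + 1) * ((1 - q) * x)\<^sup>2" using B by (intro mult_right_mono) auto
    finally show ?thesis .
  next
    case False
    then have "1 \<le> ((1 - q) * x)\<^sup>2" by (simp add: one_le_power)
    then have le: "(C1 + B + 1) * 1 \<le> (C1 + B + 1) * ((1 - q) * x)\<^sup>2" using C1 B by (intro mult_left_mono) auto
    have "\<bar>j \<beta> x - 1\<bar> \<le> (C1 + B + 1) * 1" using B(2)[OF x] C1(1) abs_triangle_ineq4[of "j \<beta> x" 1] by simp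
    then show ?thesis using le by (rule order_trans)
  qed
  then show ?thesis using C1(1) B(1)
    by (intro exI[of _ "(C1 + B + 1) * (1 - q)\<^sup>2"]) (auto simp: power_mult_distrib mult.assoc)
qed

lemma mellin_qBessel:
  assumes b: "- 1 < \<beta>" and y: "y \<in> L" and s: "0 < s"
  shows "mellin s (\<lambda>x. j \<beta> (y * x))"
proof -
  obtain C where C: "\<forall>x\<in>L. \<bar>j \<beta> x\<bar> \<le> C * x powr - 0" using qBessel_decay[OF b, of 0] by auto
  obtain D where D: "\<forall>x\<in>L. \<bar>j \<beta> x\<bar> \<le> D * x powr - (s + 1)" using qBessel_decay[OF b, of "s + 1"] s by auto
  have "mellin s (j \<beta>)"
    by (rule mellin_of_bounds[where a = 0 and b = "s + 1" and C = C and D = D]) (use s C D in auto)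
  then show ?thesis by (rule mellin_scale[OF y])
qed

lemma qBessel_rec:
  assumes b: "- 1 < \<beta>"
  shows "j \<beta> x - (1 + q powr (2 * \<beta>)) * j \<beta> (q * x) + q powr (2 * \<beta>) * j \<beta> (q * (q * x))
      = - ((1 - q) * x)\<^sup>2 * j \<beta> (q * x)"
proof -
  have "q powr (2 * \<beta> + 2) / q\<^sup>2 = q powr (2 * \<beta>)"
    using q_pos by (simp add: powr_add flip: powr_numeral)
  moreover have "((1 - q) * (q * y))\<^sup>2 = q\<^sup>2 * ((1 - q) * y)\<^sup>2" for y by (simp add: power_mult_distrib)
  ultimately show ?thesis
    using hahn_exton_rec[of "q powr (2 * \<beta> + 2)" "((1 - q) * x)\<^sup>2"] qBessel_parameter_bounds[OF b]
      by (simp only: qBessel_eq_hahn_exton)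
qed

text \<open>
  Two kernels solve \<open>q\<close>-difference equations that differ only in the eigenvalues \<open>k\<^sup>2\<close> and \<open>m\<^sup>2\<close>. As for
  Sturm-Liouville problems, the product of the solutions times the difference of the eigenvalues is then the difference of
  a weighted Casoratian at \<open>q x\<close> and at \<open>x\<close>. The weighted Casoratian is summable over the lattice, and its sum does
  not change under the shift \<open>x \<mapsto> q x\<close>.
\<close>

lemma qBessel_orthogonal:
  assumes b: "- 1 < \<beta>" and l: "k \<in> L" and m: "m \<in> L" and ne: "k \<noteq> m"
  shows "(\<Sum>\<^sub>\<infinity>x\<in>L. j \<beta> (k * x) * j \<beta> (m * x) * x powr (2 * \<beta> + 2)) = 0"
proof -
  let ?u = "\<lambda>x. j \<beta> (k * x)" and ?v = "\<lambda>x. j \<beta> (m * x)"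
  define W where "W = (\<lambda>x. ?u x * ?v (q * x) - ?v x * ?u (q * x))"
  define E where "E = (\<lambda>x. x powr (2 * \<beta>) * W x)"
  obtain B where B: "B \<ge> 1" "\<And>x. x \<in> L \<Longrightarrow> \<bar>j \<beta> x\<bar> \<le> B" using qBessel_bounded[OF b] by auto
  obtain C where C: "C \<ge> 0" "\<And>x. x \<in> L \<Longrightarrow> \<bar>j \<beta> x - 1\<bar> \<le> C * x\<^sup>2" using qBessel_near_0[OF b] by blast
  \<comment> \<open>any decay rate above \<open>2 \<beta>\<close> makes the weighted Casoratian summable at infinity\<close>
  define \<theta> where "\<theta> = 2 * \<bar>\<beta>\<bar> + 1"
  obtain D where D: "D > 0" "\<And>x. x \<in> L \<Longrightarrow> \<bar>j \<beta> x\<bar> \<le> D * x powr - \<theta>"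
    using qBessel_decay[OF b, of \<theta>] by (auto simp: \<theta>_def)
  have E_summable: "E summable_on L"
  proof -
    let ?M = "B * C * k\<^sup>2 + C * m\<^sup>2 * q\<^sup>2 + B * C * m\<^sup>2 + C * k\<^sup>2 * q\<^sup>2"
    let ?M' = "D * B * (k powr - \<theta> + m powr - \<theta>)"
    have "mellin 0 E"
    proof (rule mellin_of_bounds)
      show "- (2 * \<beta> + 2) < (0::real)" "0 < \<theta> - 2 * \<beta>" using b by (auto simp: \<theta>_def)
      fix x assume x: "x \<in> L"
      note xm = L_mult[OF l x] L_mult[OF m x] L_mult[OF l L_mult[OF L_q x]] L_mult[OF m L_mult[OF L_q x]]
      have tri: "\<bar>v\<bar> \<le> a' + b' + c' + d'"
        if "v = a + b - c - d" "\<bar>a\<bar> \<le> a'" "\<bar>b\<bar> \<le> b'" "\<bar>c\<bar> \<le> c'" "\<bar>d\<bar> \<le> d'" for v a b c d a' b' c' d' :: real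
        using that by linarith
      have "\<bar>W x\<bar> \<le> (C * (k * x)\<^sup>2) * B + C * (m * (q * x))\<^sup>2 + (C * (m * x)\<^sup>2) * B + C * (k * (q * x))\<^sup>2"
      proof -
        \<comment> \<open>the constant terms cancel, which leaves \<open>O(x\<^sup>2)\<close> at \<open>0\<close>\<close>
        have "W x = (?u x - 1) * ?v (q * x) + (?v (q * x) - 1) - (?v x - 1) * ?u (q * x) - (?u (q * x) - 1)"
          by (simp add: W_def algebra_simps)
        moreover have "\<bar>(?u x - 1) * ?v (q * x)\<bar> \<le> (C * (k * x)\<^sup>2) * B"
          unfolding abs_mult using B xm C by (intro mult_mono) auto
        moreover note C(2)[OF xm(4)]
        moreover have "\<bar>(?v x - 1) * ?u (q * x)\<bar> \<le> (C * (m * x)\<^sup>2) * B"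
          unfolding abs_mult using B xm C by (intro mult_mono) auto
        moreover note C(2)[OF xm(3)]
        ultimately show ?thesis by (rule tri)
      qed
      also have "\<dots> = ?M * x\<^sup>2"
        by (simp add: power_mult_distrib algebra_simps)
      finally have "x powr (2 * \<beta>) * \<bar>W x\<bar> \<le> x powr (2 * \<beta>) * (?M * x\<^sup>2)"
        by (intro mult_left_mono) auto
      then show "norm (E x) \<le> ?M * x powr - (- (2 * \<beta> + 2))"
        using L_pos[OF x] by (simp add: E_def abs_mult powr_add mult_ac)
      have "\<bar>W x\<bar> \<le> D * (k * x) powr - \<theta> * B + D * (m * x) powr - \<theta> * B"
      proof -
        have "\<bar>?u x * ?v (q * x)\<bar> \<le> D * (k * x) powr - \<theta> * B"
          unfolding abs_mult using B xm D by (intro mult_mono) (auto simp: less_imp_le)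
        moreover have "\<bar>?v x * ?u (q * x)\<bar> \<le> D * (m * x) powr - \<theta> * B"
          unfolding abs_mult using B xm D by (intro mult_mono) (auto simp: less_imp_le)
        ultimately show ?thesis unfolding W_def by linarith
      qed
      also have "\<dots> = ?M' * x powr - \<theta>"
        using L_pos[OF l] L_pos[OF m] L_pos[OF x] by (simp add: powr_mult less_imp_le algebra_simps)
      finally have "x powr (2 * \<beta>) * \<bar>W x\<bar> \<le> x powr (2 * \<beta>) * (?M' * x powr - \<theta>)"
        by (intro mult_left_mono) auto
      then show "norm (E x) \<le> ?M' * x powr - (\<theta> - 2 * \<beta>)"
        by (simp add: E_def abs_mult mult_ac powr_diff powr_minus divide_inverse)
    qed
    then have "(\<lambda>x. norm (E x)) summable_on L"
      unfolding mellin_def by (rule summable_on_cong[THEN iffD1, rotated]) (use L_pos in auto)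
    then show ?thesis by (rule abs_summable_summable)
  qed
  define S where "S = (\<lambda>x. ?u x * ?v x * x powr (2 * \<beta> + 2))"
  define K where "K = (1 - q)\<^sup>2 * (k\<^sup>2 - m\<^sup>2) * q powr - (2 * \<beta> + 2)"
  have step: "E (q * x) - E x = K * S (q * x)" if x: "x \<in> L" for x
  proof -
    have x0: "0 < x" using L_pos[OF x] .
    have sc: "m * (q * x) = q * (m * x)" "k * (q * x) = q * (k * x)"
      "m * (q * (q * x)) = q * (q * (m * x))" "k * (q * (q * x)) = q * (q * (k * x))" by auto
    note ru = qBessel_rec[OF b, of "k * x"] and rv = qBessel_rec[OF b, of "m * x"]
    define t u0 u1 u2 v0 v1 v2 where d: "t = q powr (2 * \<beta>)" "u0 = j \<beta> (k * x)" "u1 = j \<beta> (q * (k * x))"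
      "u2 = j \<beta> (q * (q * (k * x)))" "v0 = j \<beta> (m * x)" "v1 = j \<beta> (q * (m * x))" "v2 = j \<beta> (q * (q * (m * x)))"
    have "u0 = (1 + t) * u1 - t * u2 - (1 - q)\<^sup>2 * k\<^sup>2 * x\<^sup>2 * u1" using ru
      by (simp add: d[symmetric] power_mult_distrib)
    moreover have "v0 = (1 + t) * v1 - t * v2 - (1 - q)\<^sup>2 * m\<^sup>2 * x\<^sup>2 * v1" using rv
      by (simp add: d[symmetric] power_mult_distrib)
    ultimately have "t * (u1 * v2 - v1 * u2) - (u0 * v1 - v0 * u1) = (1 - q)\<^sup>2 * (k\<^sup>2 - m\<^sup>2) * x\<^sup>2 * (u1 * v1)"
      by (simp only:) (simp add: algebra_simps)
    then have "x powr (2 * \<beta>) * (t * W (q * x) - W x) = x powr (2 * \<beta>) * ((1 - q)\<^sup>2 * (k\<^sup>2 - m\<^sup>2) * x\<^sup>2 * (u1 * v1))"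
      by (simp add: W_def sc d)
    moreover have "(q * x) powr (2 * \<beta>) = t * x powr (2 * \<beta>)" using q_pos x0 by (simp add: powr_mult less_imp_le d)
    moreover have "(q * x) powr (2 * \<beta> + 2) * q powr - (2 * \<beta> + 2) = x powr (2 * \<beta>) * x\<^sup>2"
    proof -
      have "q powr (2 * \<beta> + 2) * q powr - (2 * \<beta> + 2) = 1" using q_pos by (subst powr_add[symmetric]) simp
      moreover have "x powr (2 * \<beta> + 2) = x powr (2 * \<beta>) * x\<^sup>2" using x0 by (simp add: powr_add)
      ultimately show ?thesis using q_pos x0 by (simp add: powr_mult less_imp_le)
    qed
    moreover have "K * S (q * x)
        = (1 - q)\<^sup>2 * (k\<^sup>2 - m\<^sup>2) * (u1 * v1) * ((q * x) powr (2 * \<beta> + 2) * q powr - (2 * \<beta> + 2))"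
      unfolding K_def S_def sc d by (simp only: mult_ac)
    ultimately show ?thesis by (simp add: E_def algebra_simps)
  qed
  \<comment> \<open>the sum of \<open>E\<close> is invariant under \<open>x \<mapsto> q x\<close>, so the telescoping differences add up to \<open>0\<close>\<close>
  have "0 = infsum (\<lambda>x. E (q * x)) L - infsum E L" using infsum_L_scale[OF L_q, of E] by simp
  also have "\<dots> = infsum (\<lambda>x. E (q * x) - E x) L"
    using infsum_add[of "\<lambda>x. E (q * x)" L "\<lambda>x. - E x"] E_summable summable_L_scale[OF L_q, of E]
    by (simp add: infsum_uminus summable_on_uminus)
  also have "\<dots> = infsum (\<lambda>x. K * S (q * x)) L" by (intro infsum_cong step)
  also have "\<dots> = K * infsum S L" by (simp add: infsum_cmult_right' infsum_L_scale[OF L_q])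
  finally have "K * infsum S L = 0" by simp
  moreover have "k\<^sup>2 \<noteq> m\<^sup>2" using ne L_pos[OF l] L_pos[OF m] by (simp add: power2_eq_iff)
  then have "K \<noteq> 0" using q_pos q_less_1 by (simp add: K_def)
  ultimately show ?thesis by (simp add: S_def)
qed

section \<open>A \<open>q\<close>-beta integral\<close>

text \<open>
  With \<open>A = q\<^bsup>2\<alpha>+1\<^esup>\<close> this is the weight of the Riemann-Liouville and Weyl transforms. Its numerator vanishes at
  the lattice points above \<open>1\<close>, so that integrals over the unit interval become sums over the whole lattice.
\<close>

definition weight :: "real \<Rightarrow> real \<Rightarrow> real" where
  "weight A s = poch2_inf (q\<^sup>2 * s\<^sup>2) / poch2_inf (A * s\<^sup>2)"

lemma weight_gt_1: "x \<in> L \<Longrightarrow> 1 < x \<Longrightarrow> weight A x = 0"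
proof -
  assume "x \<in> L" "1 < x"
  then obtain k where k: "x = 1 / q ^ Suc k" by (rule L_gt_1)
  have "q\<^sup>2 * x\<^sup>2 * (q\<^sup>2) ^ k = 1"
    using q_pos by (simp add: k power_divide power_mult_distrib power_mult[symmetric] mult.commute)
  then have "poch2_inf (q\<^sup>2 * x\<^sup>2) = 0" by (rule qpoch_inf_eq_0[OF qsq_pos qsq_less_1])
  then show ?thesis by (simp add: weight_def)
qed

lemma poch2_inf_0 [simp]: "poch2_inf 0 = 1"
  by (rule qpoch_inf_0[OF qsq_pos qsq_less_1])

lemma poch2_inf_mono_unit:
  assumes A: "0 \<le> A" "A < 1" and x: "x \<in> insert 0 L" "x \<le> 1"
  shows "poch2_inf A \<le> poch2_inf (A * x\<^sup>2)"
proof (cases "x = 0")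
  case True
  then show ?thesis using qpoch_inf_bounds[OF qsq_pos qsq_less_1, of A] A by simp
next
  case False
  then obtain n where n: "x = q ^ n" using x L_unit_range by auto
  have "x\<^sup>2 = (q\<^sup>2) ^ n" by (simp add: n power_mult[symmetric] mult.commute)
  then have s: "poch2_inf A = poch2 A n * poch2_inf (A * x\<^sup>2)"
    using qpoch_inf_split[OF qsq_pos qsq_less_1, of A n] by simp
  moreover have "0 < poch2_inf A" using poch2_inf_pos A by simp
  moreover have "0 < poch2 A n" "poch2 A n \<le> 1"
    using poch2_pos[OF A] qpoch_bounds[OF qsq_pos qsq_less_1, of A n] A by auto
  ultimately have "0 < poch2_inf (A * x\<^sup>2)" by (metis zero_less_mult_pos)
  then show ?thesis using s mult_right_mono[OF \<open>poch2 A n \<le> 1\<close>, of "poch2_inf (A * x\<^sup>2)"] by simp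
qed

lemma weight_bounded:
  assumes A: "0 \<le> A" "A < 1" and x: "x \<in> insert 0 L"
  shows "\<bar>weight A x\<bar> \<le> 1 / poch2_inf A"
proof (cases "x \<le> 1")
  case True
  have x0: "0 \<le> x" using x L_pos by force
  then have "0 \<le> q\<^sup>2 * x\<^sup>2" "q\<^sup>2 * x\<^sup>2 \<le> 1"
    using qsq_less_1 mult_le_one[of "q\<^sup>2" "x\<^sup>2"] power_le_one[OF x0 True, of 2] by (simp_all add: less_imp_le)
  then have "0 \<le> poch2_inf (q\<^sup>2 * x\<^sup>2)" "poch2_inf (q\<^sup>2 * x\<^sup>2) \<le> 1"
    using qpoch_inf_bounds[OF qsq_pos qsq_less_1] by auto
  then show ?thesis
    using poch2_inf_mono_unit[OF A x True] poch2_inf_pos[OF A] unfolding weight_def by (auto intro!: frac_le)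
next
  case False
  then show ?thesis using weight_gt_1[of x A] x poch2_inf_pos[OF A] by auto
qed

text \<open>
  The exponent \<open>\<theta>\<close> is kept flexible because the bound is to hold on the whole lattice: above \<open>1\<close>, where the
  left-hand side is \<open>1\<close>, any positive power does.
\<close>

lemma weight_near_0:
  assumes A: "0 \<le> A" "A < 1" and th: "0 < \<theta>" "\<theta> \<le> 2"
  shows "\<exists>C\<ge>0. \<forall>x\<in>L. \<bar>weight A x - 1\<bar> \<le> C * x powr \<theta>"
proof (intro exI conjI ballI)
  let ?C = "1 + 2 / (1 - q\<^sup>2) / poch2_inf A"
  have C: "0 \<le> 2 / (1 - q\<^sup>2) / poch2_inf A" using poch2_inf_pos[OF A] qsq_less_1 by simp
  then show "0 \<le> ?C" by simp
  fix x assume x: "x \<in> L"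
  show "\<bar>weight A x - 1\<bar> \<le> ?C * x powr \<theta>"
  proof (cases "x \<le> 1")
    case True
    have x0: "0 < x" using L_pos[OF x] .
    have x2: "x\<^sup>2 \<le> 1" using True x0 by (simp add: power_le_one)
    define N D where "N = poch2_inf (q\<^sup>2 * x\<^sup>2)" and "D = poch2_inf (A * x\<^sup>2)"
    have D: "poch2_inf A \<le> D" "0 < poch2_inf A" using poch2_inf_mono_unit[OF A _ True] x poch2_inf_pos[OF A]
      by (auto simp: D_def)
    have b: "\<bar>poch2_inf (a * x\<^sup>2) - 1\<bar> \<le> x\<^sup>2 / (1 - q\<^sup>2)" if "0 \<le> a" "a \<le> 1" for a
    proof -
      have "a * x\<^sup>2 \<le> 1 * x\<^sup>2" using that by (intro mult_right_mono) auto
      moreover from this have "a * x\<^sup>2 / (1 - q\<^sup>2) \<le> x\<^sup>2 / (1 - q\<^sup>2)" using qsq_less_1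
        by (intro divide_right_mono) auto
      ultimately show ?thesis using qpoch_inf_bounds[OF qsq_pos qsq_less_1, of "a * x\<^sup>2"] x2 that
        by (auto simp: abs_if)
    qed
    have "weight A x - 1 = (N - D) / D" using D
      by (simp add: weight_def N_def[symmetric] D_def[symmetric] diff_divide_distrib)
    then have "\<bar>weight A x - 1\<bar> = \<bar>N - D\<bar> / D" using D by simp
    also have "\<dots> \<le> (x\<^sup>2 / (1 - q\<^sup>2) + x\<^sup>2 / (1 - q\<^sup>2)) / poch2_inf A"
    proof (rule frac_le)
      show "\<bar>N - D\<bar> \<le> x\<^sup>2 / (1 - q\<^sup>2) + x\<^sup>2 / (1 - q\<^sup>2)"
        using b[of "q\<^sup>2"] b[of A] qsq_less_1 A unfolding N_def D_def by auto
    qed (use D qsq_less_1 in auto)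
    also have "\<dots> = 2 / (1 - q\<^sup>2) / poch2_inf A * x\<^sup>2" by (simp add: field_simps)
    also have "\<dots> \<le> ?C * x\<^sup>2" by (intro mult_right_mono) auto
    also have "\<dots> \<le> ?C * x powr \<theta>"
      using powr_mono'[of \<theta> 2 x] x0 True th C by (intro mult_left_mono) auto
    finally show ?thesis .
  next
    case False
    then have "1 \<le> x powr \<theta>" using th by (intro ge_one_powr_ge_zero) auto
    then have le: "?C * 1 \<le> ?C * x powr \<theta>" using C by (intro mult_left_mono) auto
    have "\<bar>weight A x - 1\<bar> = 1" using False weight_gt_1[OF x] by simp
    also have "1 \<le> ?C * 1" using C by simp
    also note le
    finally show ?thesis .
  qed
qed

lemma q_power_powr: "(q ^ n) powr s = (q powr s) ^ n"
  using q_pos by (simp add: powr_power powr_realpow[symmetric] powr_powr mult.commute)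

text \<open>
  A \<open>q\<close>-analogue of Sonine's first integral. At \<open>x = q\<^sup>n\<close> the weight is a constant times \<open>(A; q\<^sup>2)\<^sub>n / (q\<^sup>2; q\<^sup>2)\<^sub>n\<close>, so
  after exchanging the sums the coefficient of each power of \<open>y\<close> is a \<open>q\<close>-binomial series in \<open>w q\<^bsup>2m\<^esup>\<close> with
  \<open>w = q\<^bsup>2\<beta>+2\<^esup>\<close>. The effect is to replace the lower parameter \<open>w\<close> of the Hahn-Exton series by \<open>A w\<close>. The
  case \<open>A = 0\<close> leads to the norm of the Bessel functions, the case \<open>\<beta> = -1/2\<close> to the Riemann-Liouville transform
  of a kernel.
\<close>

lemma qBessel_weighted_integral:
  assumes b: "- 1 < \<beta>" and A: "0 \<le> A" "A < 1"
  shows "(\<Sum>\<^sub>\<infinity>x\<in>L. weight A x * (j \<beta> (y * x) * x powr (2 * \<beta> + 2)))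
    = poch2_inf (q\<^sup>2) * poch2_inf (A * q powr (2 * \<beta> + 2)) / (poch2_inf A * poch2_inf (q powr (2 * \<beta> + 2)))
      * hahn_exton (A * q powr (2 * \<beta> + 2)) (((1 - q) * y)\<^sup>2)"
proof -
  let ?w = "2 * \<beta> + 2"
  define p w z where "p = q\<^sup>2" and "w = q powr (?w)" and "z = ((1 - q) * y)\<^sup>2"
  have p: "0 < p" "p < 1" using qsq_pos qsq_less_1 by (auto simp: p_def)
  have w: "0 < w" "w < 1" using qBessel_parameter_bounds[OF b] by (auto simp: w_def)
  define P where "P = poch2_inf p"
  have P: "0 < P" "\<And>n. P \<le> poch2 p n" using poch2_inf_q_pos poch2_q_ge by (auto simp: P_def p_def)
  have A_pos: "0 < poch2_inf A" using poch2_inf_pos[OF A] .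
  define d where "d = (\<lambda>n. poch2 A n / poch2 p n)"
  have d: "0 \<le> d n" "d n \<le> 1 / P" for n
    using qpoch_bounds[OF p, of A n] A P(1) P(2)[of n] unfolding d_def p_def
      by (auto intro!: frac_le divide_nonneg_nonneg)
  define c where "c = (\<lambda>m. hahn_exton_coeff w m * z ^ m)"
  have cs: "summable (\<lambda>m. \<bar>c m\<bar>)" using hahn_exton_abs_summable[of w z] w by (simp add: c_def)
  have jq: "j \<beta> (y * q ^ n) = (\<Sum>m. c m * p ^ (n * m))" for n
  proof -
    have "((1 - q) * (y * q ^ n))\<^sup>2 = z * p ^ n"
      by (simp add: z_def p_def power_mult_distrib power_mult[symmetric] mult.commute mult.left_commute)
    then show ?thesis
      unfolding qBessel_eq_hahn_exton w_def[symmetric] hahn_exton_eq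
        by (simp add: c_def power_mult_distrib power_mult mult.assoc)
  qed
  have cp_le: "\<bar>c m * p ^ (n * m)\<bar> \<le> \<bar>c m\<bar>" for n m
    using p mult_left_mono[of "p ^ (n * m)" 1 "\<bar>c m\<bar>"] by (simp add: abs_mult power_le_one)
  have cps: "summable (\<lambda>m. \<bar>c m * p ^ (n * m)\<bar>)" for n
    by (rule summable_comparison_test'[OF cs]) (use cp_le in simp)
  have jq_le: "\<bar>j \<beta> (y * q ^ n)\<bar> \<le> (\<Sum>m. \<bar>c m\<bar>)" for n
    unfolding jq using summable_rabs[OF cps[of n]] suminf_le[OF cp_le cps cs, of n] by linarith
  have wtq: "weight A (q ^ n) = P / poch2_inf A * d n" for n
  proof -
    have "(q ^ n)\<^sup>2 = p ^ n" by (simp add: p_def power_mult[symmetric] mult.commute)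
    moreover have "poch2_inf A = poch2 A n * poch2_inf (A * p ^ n)" using qpoch_inf_split[OF p, of A n]
      by (simp add: p_def)
    moreover have "P = poch2 p n * poch2_inf (p * p ^ n)" using qpoch_inf_split[OF p, of p n]
      by (simp add: P_def p_def)
    moreover have "0 < poch2 p n" "0 < poch2 A n" using poch2_pos A p by auto
    ultimately show ?thesis by (simp add: weight_def d_def p_def[symmetric])
  qed
  have dw_le: "\<bar>d n * w ^ n * j \<beta> (y * q ^ n)\<bar> \<le> 1 / P * w ^ n * (\<Sum>m. \<bar>c m\<bar>)" for n
  proof -
    have n0: "0 \<le> d n * w ^ n" and n1: "0 \<le> 1 / P * w ^ n" using d[of n] w P(1) by auto
    have n2: "d n * w ^ n \<le> 1 / P * w ^ n" by (rule mult_right_mono[OF d(2)]) (use w in simp)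
    have "(d n * w ^ n) * \<bar>j \<beta> (y * q ^ n)\<bar> \<le> (1 / P * w ^ n) * (\<Sum>m. \<bar>c m\<bar>)"
      by (rule mult_mono[OF n2 jq_le n1 abs_ge_zero])
    then show ?thesis using n0 by (simp only: abs_mult[of "d n * w ^ n"] abs_of_nonneg)
  qed
  have "(\<Sum>\<^sub>\<infinity>x\<in>L. weight A x * (j \<beta> (y * x) * x powr (?w)))
      = (\<Sum>\<^sub>\<infinity>n. weight A (q ^ n) * (j \<beta> (y * q ^ n) * (q ^ n) powr (?w)))"
    by (rule infsum_L_unit) (simp add: weight_gt_1)
  also have "\<dots> = P / poch2_inf A * (\<Sum>\<^sub>\<infinity>n. d n * w ^ n * j \<beta> (y * q ^ n))"
    unfolding wtq q_power_powr w_def[symmetric] infsum_cmult_right'[symmetric] by (simp add: mult_ac)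
  also have "(\<Sum>\<^sub>\<infinity>n. d n * w ^ n * j \<beta> (y * q ^ n)) = (\<Sum>n. d n * w ^ n * j \<beta> (y * q ^ n))"
  proof (rule infsum_nat_eq_suminf, rule summable_comparison_test')
    show "summable (\<lambda>n. 1 / P * w ^ n * (\<Sum>m. \<bar>c m\<bar>))"
      using w by (intro summable_mult summable_mult2 summable_geometric) auto
    show "norm (norm (d n * w ^ n * j \<beta> (y * q ^ n))) \<le> 1 / P * w ^ n * (\<Sum>m. \<bar>c m\<bar>)" for n
      unfolding real_norm_def abs_idempotent by (rule dw_le)
  qed
  also have "(\<Sum>n. d n * w ^ n * j \<beta> (y * q ^ n)) = (\<Sum>n. \<Sum>m. d n * w ^ n * (c m * p ^ (n * m)))"
    unfolding jq by (intro suminf_cong suminf_mult[symmetric] summable_rabs_cancel[OF cps])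
  also have "\<dots> = (\<Sum>m. \<Sum>n. d n * w ^ n * (c m * p ^ (n * m)))"
  proof (rule suminf_swap_product_majorant)
    show "summable (\<lambda>n. 1 / P * w ^ n)" using w by (intro summable_mult summable_geometric) auto
    show "\<bar>d n * w ^ n * (c m * p ^ (n * m))\<bar> \<le> 1 / P * w ^ n * \<bar>c m\<bar>" for n m
    proof -
      have n0: "0 \<le> d n * w ^ n" and n1: "0 \<le> 1 / P * w ^ n" using d[of n] w P(1) by auto
      have n2: "d n * w ^ n \<le> 1 / P * w ^ n" by (rule mult_right_mono[OF d(2)]) (use w in simp)
      show ?thesis using mult_mono[OF n2 cp_le n1 abs_ge_zero] n0
        by (simp only: abs_mult[of "d n * w ^ n"] abs_of_nonneg)
    qed
  qed (use cs P w in auto)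
  also have "\<dots> = (\<Sum>m. poch2_inf (A * w) / poch2_inf w * (hahn_exton_coeff (A * w) m * z ^ m))"
  proof (rule suminf_cong)
    fix m
    have pm: "p ^ m \<le> 1" "0 < p ^ m" using p by (auto simp: power_le_one)
    have wp: "0 \<le> w * p ^ m" "w * p ^ m < 1"
      using w pm le_less_trans[OF mult_left_mono[OF pm(1) less_imp_le[OF w(1)]]] by auto
    have "(\<lambda>n. d n * (w * p ^ m) ^ n) sums (poch2_inf (A * (w * p ^ m)) / poch2_inf (w * p ^ m))"
      using q_binomial[OF p A(1) less_imp_le[OF A(2)] wp] by (simp add: d_def p_def)
    from sums_mult[OF this, of "c m"]
    have "(\<Sum>n. d n * w ^ n * (c m * p ^ (n * m))) = c m * (poch2_inf (A * (w * p ^ m)) / poch2_inf (w * p ^ m))"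
      by (subst sums_unique[of _ "c m * (poch2_inf (A * (w * p ^ m)) / poch2_inf (w * p ^ m))"])
         (auto simp: power_mult_distrib power_mult[symmetric] mult_ac)
    also have "\<dots> = poch2_inf (A * w) / poch2_inf w * (hahn_exton_coeff (A * w) m * z ^ m)"
    proof -
      have Aw: "0 \<le> A * w" "A * w < 1" using A w mult_strict_mono[of A 1 w 1] by auto
      have "poch2_inf w = poch2 w m * poch2_inf (w * p ^ m)" using qpoch_inf_split[OF p, of w m] by (simp add: p_def)
      moreover have "poch2_inf (A * w) = poch2 (A * w) m * poch2_inf (A * (w * p ^ m))"
        using qpoch_inf_split[OF p, of "A * w" m] by (simp add: p_def mult.assoc)
      moreover have "0 < poch2 w m" "0 < poch2 (A * w) m" "0 < poch2_inf (w * p ^ m)"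
        using poch2_pos Aw w poch2_inf_pos wp by auto
      ultimately show ?thesis by (simp add: c_def hahn_exton_coeff_def mult_ac)
    qed
    finally show "(\<Sum>n. d n * w ^ n * (c m * p ^ (n * m)))
        = poch2_inf (A * w) / poch2_inf w * (hahn_exton_coeff (A * w) m * z ^ m)" .
  qed
  also have "\<dots> = poch2_inf (A * w) / poch2_inf w * hahn_exton (A * w) z"
  proof -
    have "0 \<le> A * w" "A * w < 1" using A w mult_strict_mono[of A 1 w 1] by auto
    then show ?thesis unfolding hahn_exton_eq by (intro suminf_mult hahn_exton_summable)
  qed
  finally show ?thesis by (simp add: P_def p_def w_def z_def)
qed

lemma hahn_exton_0: "hahn_exton 0 z = poch2_inf z"
  unfolding hahn_exton_def using euler_sums[of z] by (simp add: qpoch_def sums_iff)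

text \<open>
  The \<open>q\<close>-Bessel Fourier transform without constant factors. The Jackson integral gives the point \<open>x\<close> the mass
  \<open>(1 - q) x\<close>, whence one more power of \<open>x\<close> than in the integrand.
\<close>

definition hankel :: "real \<Rightarrow> (real \<Rightarrow> complex) \<Rightarrow> real \<Rightarrow> complex" where
  "hankel \<beta> H y = (\<Sum>\<^sub>\<infinity>x\<in>L. H x * cx (j \<beta> (y * x) * x powr (2 * \<beta> + 2)))"

definition j_norm :: "real \<Rightarrow> real" where
  "j_norm \<beta> = (\<Sum>\<^sub>\<infinity>x\<in>L. j \<beta> x * j \<beta> x * x powr (2 * \<beta> + 2))"

lemma hankel_cong: "(\<And>x. x \<in> L \<Longrightarrow> F x = G x) \<Longrightarrow> hankel \<beta> F y = hankel \<beta> G y"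
  unfolding hankel_def by (intro infsum_cong) simp

lemma hankel_qBessel:
  assumes b: "- 1 < \<beta>" and k: "k \<in> L" and m: "m \<in> L"
  shows "hankel \<beta> (\<lambda>x. cx (j \<beta> (k * x))) m = (if k = m then cx (j_norm \<beta> * k powr - (2 * \<beta> + 2)) else 0)"
proof (cases "k = m")
  case False
  then show ?thesis
    using qBessel_orthogonal[OF b k m False] unfolding hankel_def
    by (simp add: infsum_complex_of_real mult.assoc flip: of_real_mult)
next
  case True
  have "(\<Sum>\<^sub>\<infinity>x\<in>L. j \<beta> (k * x) * j \<beta> (k * x) * x powr (2 * \<beta> + 2))
      = (\<Sum>\<^sub>\<infinity>x\<in>L. j \<beta> (k * x) * j \<beta> (k * x) * (k * x) powr (2 * \<beta> + 2) * k powr - (2 * \<beta> + 2))"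
  proof (rule infsum_cong)
    fix x assume "x \<in> L"
    then have "0 < x" "0 < k" using k L_pos by auto
    then have "(k * x) powr (2 * \<beta> + 2) * k powr - (2 * \<beta> + 2)
        = x powr (2 * \<beta> + 2) * (k powr (2 * \<beta> + 2) * k powr - (2 * \<beta> + 2))"
      by (simp add: powr_mult less_imp_le mult_ac)
    also have "k powr (2 * \<beta> + 2) * k powr - (2 * \<beta> + 2) = 1" using \<open>0 < k\<close> by (subst powr_add[symmetric]) simp
    finally show "j \<beta> (k * x) * j \<beta> (k * x) * x powr (2 * \<beta> + 2)
        = j \<beta> (k * x) * j \<beta> (k * x) * (k * x) powr (2 * \<beta> + 2) * k powr - (2 * \<beta> + 2)"
      by (simp add: mult.assoc)
  qed
  also have "\<dots> = j_norm \<beta> * k powr - (2 * \<beta> + 2)"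
    unfolding j_norm_def infsum_cmult_left'
      using infsum_L_scale[OF k, of "\<lambda>x. j \<beta> x * j \<beta> x * x powr (2 * \<beta> + 2)"] by simp
  finally show ?thesis using True unfolding hankel_def
    by (simp add: infsum_complex_of_real mult.assoc flip: of_real_mult)
qed

text \<open>
  The kernel is symmetric in its two arguments, so only the interchange of sums has to be justified. The decay of the
  kernel with \<open>\<theta> = 2\<beta> + 2 - s\<close> splits the double sum into the Mellin sums of \<open>f\<close> and \<open>Y\<close> at the exponent \<open>s\<close>.
\<close>

lemma hankel_parseval:
  assumes b: "- 1 < \<beta>" and s: "s \<le> 2 * \<beta> + 2" and f: "mellin s f" and Y: "mellin s Y"
  shows "(\<Sum>\<^sub>\<infinity>x\<in>L. f x * cnj (hankel \<beta> Y x) * cx (x powr (2 * \<beta> + 2)))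
    = (\<Sum>\<^sub>\<infinity>k\<in>L. hankel \<beta> f k * cnj (Y k) * cx (k powr (2 * \<beta> + 2)))"
proof -
  let ?w = "2 * \<beta> + 2"
  obtain C where C: "C > 0" "\<And>x. x \<in> L \<Longrightarrow> \<bar>j \<beta> x\<bar> \<le> C * x powr - (?w - s)"
    using qBessel_decay[OF b, of "?w - s"] s by auto
  let ?F = "\<lambda>x k. f x * cx (x powr ?w) * cnj (Y k) * cx (j \<beta> (x * k) * k powr ?w)"
  have sum: "(\<lambda>(x, k). ?F x k) summable_on L \<times> L"
  proof (rule summable_on_product_majorant)
    show "(\<lambda>x. C * (norm (f x) * x powr s)) summable_on L"
      using f unfolding mellin_def by (rule summable_on_cmult_right)
    show "(\<lambda>x. norm (Y x) * x powr s) summable_on L" using Y unfolding mellin_def .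
    fix x k assume kx: "x \<in> L" "k \<in> L"
    have "norm (?F x k) = \<bar>j \<beta> (x * k)\<bar> * (norm (f x) * x powr ?w * (norm (Y k) * k powr ?w))"
      by (simp add: norm_mult mult_ac)
    also have "\<dots> \<le> (C * (x * k) powr - (?w - s)) * (norm (f x) * x powr ?w * (norm (Y k) * k powr ?w))"
      by (intro mult_right_mono C(2) L_mult kx) auto
    also have "\<dots> = C * (norm (f x) * (x powr - (?w - s) * x powr ?w))
        * (norm (Y k) * (k powr - (?w - s) * k powr ?w))"
      using L_pos[OF kx(1)] L_pos[OF kx(2)] by (simp add: powr_mult less_imp_le mult_ac)
    also have "\<dots> = C * (norm (f x) * x powr s) * (norm (Y k) * k powr s)"
      by (simp add: powr_add[symmetric])
    finally show "norm (?F x k) \<le> C * (norm (f x) * x powr s) * (norm (Y k) * k powr s)" .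
  qed (use C in auto)
  have "(\<Sum>\<^sub>\<infinity>x\<in>L. f x * cnj (hankel \<beta> Y x) * cx (x powr ?w)) = (\<Sum>\<^sub>\<infinity>x\<in>L. \<Sum>\<^sub>\<infinity>k\<in>L. ?F x k)"
    unfolding hankel_def infsum_cnj[symmetric] infsum_cmult_right'[symmetric] infsum_cmult_left'[symmetric]
    by (intro infsum_cong) (simp add: mult_ac)
  also have "\<dots> = (\<Sum>\<^sub>\<infinity>k\<in>L. \<Sum>\<^sub>\<infinity>x\<in>L. ?F x k)" by (rule infsum_swap_banach[OF sum])
  also have "\<dots> = (\<Sum>\<^sub>\<infinity>k\<in>L. hankel \<beta> f k * cnj (Y k) * cx (k powr ?w))"
    unfolding hankel_def infsum_cmult_left'[symmetric]
    by (intro infsum_cong) (simp add: mult_ac)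
  finally show ?thesis .
qed

text \<open>
  The outer transform pairs the transform of \<open>H\<close> with a kernel. Moved to the kernel by Parseval's formula, the inner
  transform becomes a point mass at \<open>y\<close> by orthogonality.
\<close>

lemma hankel_hankel:
  assumes b: "- 1 < \<beta>" and H: "mellin s H" and s: "0 < s" "s \<le> 2 * \<beta> + 2" and y: "y \<in> L"
  shows "hankel \<beta> (hankel \<beta> H) y = cx (j_norm \<beta>) * H y"
proof -
  let ?w = "2 * \<beta> + 2" and ?Y = "\<lambda>k. cx (j \<beta> (y * k))"
  have Y: "mellin s ?Y" using mellin_qBessel[OF b y s(1)] unfolding mellin_def by simp
  have "hankel \<beta> (hankel \<beta> H) y = (\<Sum>\<^sub>\<infinity>k\<in>L. hankel \<beta> H k * cnj (?Y k) * cx (k powr ?w))"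
    by (subst hankel_def) (simp add: mult.assoc)
  also have "\<dots> = (\<Sum>\<^sub>\<infinity>x\<in>L. H x * cnj (hankel \<beta> ?Y x) * cx (x powr ?w))"
    by (rule hankel_parseval[OF b s(2) H Y, symmetric])
  also have "\<dots> = (\<Sum>\<^sub>\<infinity>x\<in>{y}. H x * cnj (hankel \<beta> ?Y x) * cx (x powr ?w))"
    by (rule infsum_cong_neutral) (use y hankel_qBessel[OF b y] in auto)
  also have "\<dots> = cx (j_norm \<beta>) * H y"
  proof -
    have "y powr - ?w * y powr ?w = 1" using L_pos[OF y] by (subst powr_add[symmetric]) simp
    then have "cx (j_norm \<beta> * y powr - ?w) * cx (y powr ?w) = cx (j_norm \<beta>)"
      unfolding of_real_mult[symmetric] by (simp add: mult.assoc)
    then show ?thesis using hankel_qBessel[OF b y y] by (simp add: mult_ac)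
  qed
  finally show ?thesis .
qed

text \<open>
  A test function for which transforms are explicit. On the lattice it is supported in \<open>(0, 1]\<close>, and it tends to
  \<open>1\<close> at \<open>0\<close>.
\<close>

definition cutoff :: "real \<Rightarrow> real" where "cutoff x = poch2_inf (q\<^sup>2 * x\<^sup>2)"

lemma cutoff_eq_weight: "cutoff x = weight 0 x" by (simp add: cutoff_def weight_def)

lemma mellin_cutoff: "0 < s \<Longrightarrow> mellin s (\<lambda>x. cx (cutoff x))"
proof (rule mellin_of_bounds[where a = 0 and b = "s + 1" and C = 1 and D = 1])
  fix x assume x: "x \<in> L"
  show b: "norm (cx (cutoff x)) \<le> 1 * x powr - 0"
    using weight_bounded[of 0 x] x L_pos[OF x] by (simp add: cutoff_eq_weight)
  assume "1 \<le> x"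
  then consider "x = 1" | "1 < x" by linarith
  then show "norm (cx (cutoff x)) \<le> 1 * x powr - (s + 1)"
  proof cases
    case 1 then show ?thesis using b by simp
  next
    case 2 then show ?thesis using weight_gt_1[OF x] by (simp add: cutoff_eq_weight)
  qed
qed auto

lemma hankel_cutoff:
  assumes b: "- 1 < \<beta>"
  shows "hankel \<beta> (\<lambda>x. cx (cutoff x)) y
      = cx (poch2_inf (q\<^sup>2) / poch2_inf (q powr (2 * \<beta> + 2)) * poch2_inf (((1 - q) * y)\<^sup>2))"
  using qBessel_weighted_integral[OF b, of 0 y]
  by (simp add: hankel_def cutoff_eq_weight infsum_complex_of_real hahn_exton_0 flip: of_real_mult)

text \<open>
  The transform of \<open>(q\<^sup>2 x\<^sup>2; q\<^sup>2)\<^sub>\<infinity>\<close> is the same function, dilated by \<open>(1 - q) / q\<close> and multiplied by a constant.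
  Transforming twice therefore returns a known multiple of it, and by inversion this multiple is the norm.
\<close>

lemma j_norm_eq:
  assumes b: "- 1 < \<beta>"
  shows "j_norm \<beta> = (q / (1 - q)) powr (2 * \<beta> + 2) * (poch2_inf (q\<^sup>2) / poch2_inf (q powr (2 * \<beta> + 2)))\<^sup>2"
proof -
  define D where "D = poch2_inf (q\<^sup>2) / poch2_inf (q powr (2 * \<beta> + 2))"
  \<comment> \<open>the substitution by \<open>c\<close> turns \<open>(1 - q) x\<close> into \<open>q x\<close>, the argument of the cutoff function\<close>
  define c where "c = q / (1 - q)"
  have c: "c \<in> L" by (simp add: c_def L_divide L_q lattice)
  have c1: "(1 - q) * c = q" using q_less_1 by (simp add: c_def)
  let ?cutoff = "\<lambda>x. cx (cutoff x)"
  have "cx (j_norm \<beta>) * ?cutoff 1 = hankel \<beta> (hankel \<beta> ?cutoff) 1"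
    by (rule hankel_hankel[symmetric, OF b mellin_cutoff, of "2 * \<beta> + 2"]) (use b L_one in auto)
  also have "\<dots> = (\<Sum>\<^sub>\<infinity>x\<in>L. hankel \<beta> ?cutoff x * cx (j \<beta> (1 * x) * x powr (2 * \<beta> + 2)))"
    by (simp only: hankel_def)
  also have "\<dots> = (\<Sum>\<^sub>\<infinity>x\<in>L. hankel \<beta> ?cutoff (c * x) * cx (j \<beta> (1 * (c * x)) * (c * x) powr (2 * \<beta> + 2)))"
    by (rule infsum_L_scale[OF c, symmetric])
  also have "\<dots> = (\<Sum>\<^sub>\<infinity>x\<in>L. cx (D * c powr (2 * \<beta> + 2)) * (?cutoff x * cx (j \<beta> (c * x) * x powr (2 * \<beta> + 2))))"
  proof (rule infsum_cong)
    fix x assume "x \<in> L"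
    then have pw: "(c * x) powr (2 * \<beta> + 2) = c powr (2 * \<beta> + 2) * x powr (2 * \<beta> + 2)"
      using L_pos c by (simp add: powr_mult less_imp_le)
    have "((1 - q) * (c * x))\<^sup>2 = q\<^sup>2 * x\<^sup>2" using c1 by (simp add: mult.assoc[symmetric] power_mult_distrib)
    then have "hankel \<beta> ?cutoff (c * x) = cx (D * cutoff x)"
      using hankel_cutoff[OF b, of "c * x"] by (simp only: D_def cutoff_def)
    then show "hankel \<beta> ?cutoff (c * x) * cx (j \<beta> (1 * (c * x)) * (c * x) powr (2 * \<beta> + 2))
        = cx (D * c powr (2 * \<beta> + 2)) * (?cutoff x * cx (j \<beta> (c * x) * x powr (2 * \<beta> + 2)))"
      by (simp only: pw of_real_mult mult_1) (simp only: mult_ac)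
  qed
  also have "\<dots> = cx (D * c powr (2 * \<beta> + 2)) * hankel \<beta> ?cutoff c"
    unfolding hankel_def by (rule infsum_cmult_right')
  also have "\<dots> = cx (D * c powr (2 * \<beta> + 2) * (D * poch2_inf (q\<^sup>2)))"
    using c1 by (simp add: hankel_cutoff[OF b] D_def[symmetric])
  finally have "j_norm \<beta> * poch2_inf (q\<^sup>2) = D * c powr (2 * \<beta> + 2) * (D * poch2_inf (q\<^sup>2))"
    unfolding cutoff_def by (simp flip: of_real_mult)
  then have "j_norm \<beta> * poch2_inf (q\<^sup>2) = (c powr (2 * \<beta> + 2) * D\<^sup>2) * poch2_inf (q\<^sup>2)"
    by (simp only: power2_eq_square mult_ac)
  then have "j_norm \<beta> = c powr (2 * \<beta> + 2) * D\<^sup>2" using poch2_inf_q_pos by simp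
  then show ?thesis by (simp only: D_def c_def)
qed

section \<open>The \<open>q\<close>-Bessel Fourier transform and its inversion\<close>

lemma powi_bij: "bij_betw (\<lambda>n::int. q powi n) UNIV L"
proof (rule bij_betwI')
  fix m n :: int
  have "q powi m = q powi n \<longleftrightarrow> q powr real_of_int m = q powr real_of_int n"
    using q_pos by (simp add: powr_real_of_int')
  also have "\<dots> \<longleftrightarrow> m = n" using q_pos q_less_1 by (simp add: powr_inj)
  finally show "q powi m = q powi n \<longleftrightarrow> m = n" .
qed (auto simp: L_iff)

lemma jackson_eq: "jackson q f = (1 - q) *\<^sub>R (\<Sum>\<^sub>\<infinity>x\<in>L. x *\<^sub>R f x)"
  unfolding jackson_def using infsum_reindex_bij_betw[OF powi_bij, of "\<lambda>x. x *\<^sub>R f x"] by simp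

abbreviation "qF_factor \<beta> \<equiv> qF_const q \<beta> * (1 - q)"

lemma L_powr_Suc: "x \<in> L \<Longrightarrow> x * x powr (2 * \<beta> + 1) = x powr (2 * \<beta> + 2)"
  using L_pos[of x] by (simp add: powr_add power2_eq_square)

lemma qF_eq: "qF q \<beta> f y = cx (qF_factor \<beta>) * hankel \<beta> f y"
proof -
  have "(\<Sum>\<^sub>\<infinity>x\<in>L. x *\<^sub>R (f x * cx (j \<beta> (y * x) * x powr (2 * \<beta> + 1)))) = hankel \<beta> f y"
    unfolding hankel_def
  proof (rule infsum_cong)
    fix x assume x: "x \<in> L"
    have "x *\<^sub>R (f x * cx (j \<beta> (y * x) * x powr (2 * \<beta> + 1))) = f x * cx (j \<beta> (y * x) * (x * x powr (2 * \<beta> + 1)))"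
      by (simp add: scaleR_conv_of_real)
    then show "x *\<^sub>R (f x * cx (j \<beta> (y * x) * x powr (2 * \<beta> + 1))) = f x * cx (j \<beta> (y * x) * x powr (2 * \<beta> + 2))"
      unfolding L_powr_Suc[OF x] .
  qed
  then show ?thesis unfolding qF_def jackson_eq by (simp add: scaleR_conv_of_real)
qed

lemma qF_cong: "(\<And>x. x \<in> L \<Longrightarrow> f x = g x) \<Longrightarrow> qF q \<beta> f y = qF q \<beta> g y"
  unfolding qF_eq using hankel_cong[of f g] by simp

lemma hankel_cmult: "hankel \<beta> (\<lambda>x. c * f x) y = c * hankel \<beta> f y"
  unfolding hankel_def infsum_cmult_right'[symmetric] by (simp add: mult.assoc)

lemma qF_cmult: "qF q \<beta> (\<lambda>x. c * f x) y = c * qF q \<beta> f y"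
  unfolding qF_eq hankel_cmult by simp

lemma qF_inv_cmult: "qF_inv q \<beta> (\<lambda>x. c * f x) y = c * qF_inv q \<beta> f y"
  unfolding qF_inv_def qF_cmult by simp

lemma qF_inv_cong: "(\<And>x. x \<in> L \<Longrightarrow> f x = g x) \<Longrightarrow> qF_inv q \<beta> f y = qF_inv q \<beta> g y"
  unfolding qF_inv_def using qF_cong[of f g] by simp

lemma qGamma_eq: "qGamma (q\<^sup>2) x = poch2_inf (q\<^sup>2) / poch2_inf (q powr (2 * x)) * (1 - q\<^sup>2) powr (1 - x)"
proof -
  have "(q\<^sup>2) powr x = q powr (2 * x)" using q_pos by (simp add: powr_powr flip: powr_numeral)
  then show ?thesis by (simp add: qGamma_def)
qed

lemma one_minus_qsq: "1 - q\<^sup>2 = (1 - q) * (1 + q)" by (simp add: power2_eq_square algebra_simps)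

lemma qF_const_eq:
  "qF_const q \<beta> = q powr \<beta> * (1 - q) powr \<beta> * poch2_inf (q powr (2 * \<beta> + 2)) / poch2_inf (q\<^sup>2)"
proof -
  have "1 + inverse q = (1 + q) / q" using q_pos by (simp add: field_simps)
  then have 1: "(1 + inverse q) powr (- \<beta>) = q powr \<beta> * (1 + q) powr - \<beta>"
    using q_pos by (simp only: powr_divide) (simp add: powr_minus divide_inverse mult.commute)
  have 2: "(1 - q\<^sup>2) powr (1 - (\<beta> + 1)) = inverse ((1 - q) powr \<beta>) * (1 + q) powr - \<beta>"
    unfolding one_minus_qsq using q_pos q_less_1 by (simp add: powr_mult powr_minus)
  have 3: "2 * (\<beta> + 1) = 2 * \<beta> + 2" by simp
  have 4: "Q * A / (P / W * (inverse B * A)) = Q * B * W / P" if "A > 0" for A Q P W B :: real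
    using that by (simp add: divide_inverse)
  show ?thesis
    unfolding qF_const_def qGamma_eq 1 2 3 by (rule 4) (use q_pos in simp)
qed

lemma qF_const_pos: "- 1 < \<beta> \<Longrightarrow> 0 < qF_const q \<beta>"
  unfolding qF_const_eq using q_pos q_less_1 poch2_inf_pos qBessel_parameter_bounds[of \<beta>] poch2_inf_q_pos by simp

lemma qF_factor_pos: "- 1 < \<beta> \<Longrightarrow> 0 < qF_factor \<beta>"
  using qF_const_pos q_less_1 by simp

text \<open>
  The normalising constant of the transform is chosen so that the square of the transform has this simple factor.
\<close>

lemma qF_factor_sq:
  assumes b: "- 1 < \<beta>" shows "(qF_factor \<beta>)\<^sup>2 * j_norm \<beta> = q powr (4 * \<beta> + 2)"
proof -
  define D where "D = poch2_inf (q\<^sup>2) / poch2_inf (q powr (2 * \<beta> + 2))"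
  have D: "D > 0" using poch2_inf_pos[of "q powr (2 * \<beta>
      + 2)"] qBessel_parameter_bounds[OF b] poch2_inf_q_pos by (simp add: D_def)
  have q1: "0 < 1 - q" using q_less_1 by simp
  have c: "qF_factor \<beta> = q powr \<beta> * (1 - q) powr (\<beta> + 1) / D"
    using q1 by (simp add: qF_const_eq D_def powr_add)
  have "(q / (1 - q)) powr (2 * \<beta> + 2) = (q powr (\<beta> + 1))\<^sup>2 / ((1 - q) powr (\<beta> + 1))\<^sup>2"
    using q_pos q1 by (simp add: powr_divide power2_eq_square powr_add[symmetric] algebra_simps)
  then have "(qF_factor \<beta>)\<^sup>2 * j_norm \<beta> = (q powr \<beta>)\<^sup>2 * (q powr (\<beta> + 1))\<^sup>2"
    unfolding j_norm_eq[OF b] D_def[symmetric] c using D q1 by (simp add: power_mult_distrib power_divide)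
  also have "\<dots> = q powr (4 * \<beta> + 2)"
    using q_pos by (simp add: power2_eq_square powr_add[symmetric] algebra_simps)
  finally show ?thesis .
qed

lemma qF_qF:
  assumes "- 1 < \<beta>" "mellin s H" "0 < s" "s \<le> 2 * \<beta> + 2" "y \<in> L"
  shows "qF q \<beta> (qF q \<beta> H) y = cx (q powr (4 * \<beta> + 2)) * H y"
proof -
  have "qF q \<beta> (qF q \<beta> H) y = cx ((qF_factor \<beta>)\<^sup>2) * hankel \<beta> (hankel \<beta> H) y"
    unfolding qF_eq[of _ H, abs_def] qF_cmult unfolding qF_eq by (simp add: power2_eq_square)
  also have "\<dots> = cx ((qF_factor \<beta>)\<^sup>2 * j_norm \<beta>) * H y"
    using hankel_hankel[OF assms] by simp
  finally show ?thesis using qF_factor_sq[OF assms(1)] by simp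
qed

lemma qF_qF_inv:
  assumes "- 1 < \<beta>" "mellin s H" "0 < s" "s \<le> 2 * \<beta> + 2" "y \<in> L"
  shows "qF q \<beta> (qF_inv q \<beta> H) y = H y" "qF_inv q \<beta> (qF q \<beta> H) y = H y"
proof -
  have "q powr (- 4 * \<beta> - 2) * q powr (4 * \<beta> + 2) = 1" using q_pos by (simp add: powr_add[symmetric])
  then have *: "cx (q powr (- 4 * \<beta> - 2)) * (cx (q powr (4 * \<beta> + 2)) * H y) = H y"
    by (simp add: mult.assoc[symmetric] flip: of_real_mult)
  show "qF_inv q \<beta> (qF q \<beta> H) y = H y" unfolding qF_inv_def qF_qF[OF assms] by (rule *)
  have "qF q \<beta> (qF_inv q \<beta> H) y = cx (q powr (- 4 * \<beta> - 2)) * qF q \<beta> (qF q \<beta> H) y"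
    unfolding qF_inv_def[abs_def] qF_cmult ..
  then show "qF q \<beta> (qF_inv q \<beta> H) y = H y" unfolding qF_qF[OF assms] * .
qed

text \<open>
  For each \<open>x\<close> the substitution \<open>y \<mapsto> y \<sigma>(x)\<close> leaves the lattice invariant and reduces the sum over \<open>y\<close> to
  the Mellin sum of \<open>G\<close>. The cases \<open>\<sigma> x = x\<close> and \<open>\<sigma> x = 1 / x\<close> cover Hankel transforms and Mellin
  convolutions.
\<close>

lemma summable_mellin_convolution:
  fixes G :: "real \<Rightarrow> 'a::real_normed_vector"
  assumes G: "mellin t G" and \<sigma>: "\<And>x. x \<in> L \<Longrightarrow> \<sigma> x \<in> L" and H0: "\<And>x. x \<in> L \<Longrightarrow> 0 \<le> H x"
    and H: "(\<lambda>x. H x * \<sigma> x powr - t) summable_on L"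
  shows "(\<lambda>(x, y). H x * (norm (G (y * \<sigma> x)) * y powr t)) summable_on L \<times> L"
proof (rule summable_on_SigmaI)
  let ?S = "\<Sum>\<^sub>\<infinity>z\<in>L. norm (G z) * z powr t"
  fix x assume x: "x \<in> L"
  have "((\<lambda>z. norm (G z) * z powr t) has_sum ?S) L" using G unfolding mellin_def by simp
  then have "((\<lambda>y. norm (G (\<sigma> x * y)) * (\<sigma> x * y) powr t) has_sum ?S) L"
    by (subst has_sum_reindex_bij_betw[OF L_scale_bij[OF \<sigma>[OF x]], of "\<lambda>z. norm (G z) * z powr t"])
  from has_sum_cmult_right[OF this, of "H x * \<sigma> x powr - t"]
  show "((\<lambda>y. case (x, y) of (x, y) \<Rightarrow> H x * (norm (G (y * \<sigma> x)) * y powr t)) has_sum H x * \<sigma> x powr - t * ?S) L"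
  proof (rule has_sum_cong[THEN iffD1, rotated])
    fix y assume y: "y \<in> L"
    have "(\<sigma> x * y) powr t = \<sigma> x powr t * y powr t" using L_pos \<sigma>[OF x] y by (simp add: powr_mult less_imp_le)
    moreover have "\<sigma> x powr - t * \<sigma> x powr t = 1" using L_pos[OF \<sigma>[OF x]] by (simp add: powr_add[symmetric])
    ultimately show "H x * \<sigma> x powr - t * (norm (G (\<sigma> x * y)) * (\<sigma> x * y) powr t)
        = (case (x, y) of (x, y) \<Rightarrow> H x * (norm (G (y * \<sigma> x)) * y powr t))"
      by (simp add: mult_ac)
  qed
qed (auto intro!: summable_on_cmult_left H mult_nonneg_nonneg H0)

lemma mellin_convolution:
  fixes G :: "real \<Rightarrow> 'a::real_normed_vector" and F :: "real \<Rightarrow> real \<Rightarrow> complex"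
  assumes G: "mellin t G" and \<sigma>: "\<And>x. x \<in> L \<Longrightarrow> \<sigma> x \<in> L" and H0: "\<And>x. x \<in> L \<Longrightarrow> 0 \<le> H x"
    and H: "(\<lambda>x. H x * \<sigma> x powr - t) summable_on L"
    and le: "\<And>x y. x \<in> L \<Longrightarrow> y \<in> L \<Longrightarrow> norm (F x y) \<le> H x * norm (G (y * \<sigma> x))"
  shows "mellin t (\<lambda>y. \<Sum>\<^sub>\<infinity>x\<in>L. F x y)"
proof -
  have "(\<lambda>z. norm (case z of (x, y) \<Rightarrow> F x y * cx (y powr t))) summable_on L \<times> L"
  proof (rule Infinite_Sum.abs_summable_on_comparison_test'[OF summable_mellin_convolution[OF G \<sigma> H0 H]])
    fix z assume "z \<in> L \<times> L"
    then obtain x y where z: "z = (x, y)" and "x \<in> L" "y \<in> L" by auto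
    then show "norm (case z of (x, y) \<Rightarrow> F x y * cx (y powr t))
        \<le> (case z of (x, y) \<Rightarrow> H x * (norm (G (y * \<sigma> x)) * y powr t))"
      using mult_right_mono[OF le[of x y], of "y powr t"] by (simp add: norm_mult mult_ac)
  qed
  then have "(\<lambda>z. norm (case z of (y, x) \<Rightarrow> F x y * cx (y powr t))) summable_on L \<times> L"
    by (subst summable_on_swap) (simp add: case_prod_unfold)
  then have 1: "\<And>y. y \<in> L \<Longrightarrow> (\<lambda>x. norm (F x y * cx (y powr t))) summable_on L"
    and 2: "(\<lambda>y. norm (\<Sum>\<^sub>\<infinity>x\<in>L. norm (F x y * cx (y powr t)))) summable_on L"
    using Infinite_Sum.abs_summable_on_Sigma_iff[where f = "\<lambda>(y, x). F x y * cx (y powr t)" and A = L and B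
        = "\<lambda>_. L"] by simp_all
  show ?thesis unfolding mellin_def
  proof (rule summable_on_comparison_test[OF 2])
    fix y assume y: "y \<in> L"
    have "norm (\<Sum>\<^sub>\<infinity>x\<in>L. F x y) * y powr t = norm (\<Sum>\<^sub>\<infinity>x\<in>L. F x y * cx (y powr t))"
      unfolding infsum_cmult_left' by (simp add: norm_mult)
    also have "\<dots> \<le> (\<Sum>\<^sub>\<infinity>x\<in>L. norm (F x y * cx (y powr t)))"
      by (rule norm_infsum_bound[OF 1[OF y]])
    finally show "norm (\<Sum>\<^sub>\<infinity>x\<in>L. F x y) * y powr t \<le> norm (\<Sum>\<^sub>\<infinity>x\<in>L. norm (F x y * cx (y powr t)))" by simp
  qed auto
qed

text \<open>
  The Mellin transform turns a Hankel transform into a product in which \<open>H\<close> appears at the reflected exponent.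
\<close>

lemma mellin_hankel:
  assumes b: "- 1 < \<beta>" and t: "0 < t" and H: "mellin (2 * \<beta> + 2 - t) H"
  shows "mellin t (hankel \<beta> H)"
  unfolding hankel_def[abs_def]
proof (rule mellin_convolution[where G = "j \<beta>" and \<sigma> = "\<lambda>x. x" and H = "\<lambda>x. norm (H x) * x powr (2 * \<beta> + 2)"])
  show "mellin t (j \<beta>)" using mellin_qBessel[OF b L_one t] by simp
  show "(\<lambda>x. norm (H x) * x powr (2 * \<beta> + 2) * x powr - t) summable_on L"
    using H unfolding mellin_def by (simp add: mult.assoc powr_add[symmetric])
qed (auto simp: norm_mult)

lemma hankel_term_bound:
  assumes b: "- 1 < \<beta>"
  shows "\<exists>B\<ge>0. \<forall>y\<in>insert 0 L. \<forall>x\<in>L. norm (H x * cx (j \<beta> (y * x) * x powr (2 * \<beta> + 2)))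
    \<le> B * (norm (H x) * x powr (2 * \<beta> + 2))"
proof -
  obtain B where B: "B \<ge> 1" "\<And>x. x \<in> insert 0 L \<Longrightarrow> \<bar>j \<beta> x\<bar> \<le> B" using qBessel_bounded[OF b] by blast
  have "norm (H x * cx (j \<beta> (y * x) * x powr (2 * \<beta> + 2))) \<le> B * (norm (H x) * x powr (2 * \<beta> + 2))"
    if "y \<in> insert 0 L" "x \<in> L" for x y
  proof -
    have "y * x \<in> insert 0 L" using that L_mult by auto
    from mult_right_mono[OF B(2)[OF this], of "norm (H x) * x powr (2 * \<beta> + 2)"] show ?thesis
      by (simp add: norm_mult mult_ac)
  qed
  moreover have "0 \<le> B" using B(1) by simp
  ultimately show ?thesis by blast
qed

lemma hankel_summable:
  assumes b: "- 1 < \<beta>" and H: "mellin (2 * \<beta> + 2) H" and y: "y \<in> insert 0 L"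
  shows "(\<lambda>x. norm (H x * cx (j \<beta> (y * x) * x powr (2 * \<beta> + 2)))) summable_on L"
proof -
  obtain B where B: "\<And>x. x \<in> L \<Longrightarrow> norm (H x * cx (j \<beta> (y * x) * x powr (2 * \<beta> + 2)))
      \<le> B * (norm (H x) * x powr (2 * \<beta> + 2))"
    using hankel_term_bound[OF b, of H] y by blast
  show ?thesis
    by (rule Infinite_Sum.abs_summable_on_comparison_test'[OF summable_on_cmult_right[OF H[unfolded mellin_def]] B])
qed

lemma hankel_bounded:
  assumes b: "- 1 < \<beta>" and H: "mellin (2 * \<beta> + 2) H"
  shows "\<exists>C\<ge>0. \<forall>y\<in>insert 0 L. norm (hankel \<beta> H y) \<le> C"
proof -
  obtain B where B: "B \<ge> 0" "\<And>x y. y \<in> insert 0 L \<Longrightarrow> x \<in> L \<Longrightarrow>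
      norm (H x * cx (j \<beta> (y * x) * x powr (2 * \<beta> + 2))) \<le> B * (norm (H x) * x powr (2 * \<beta> + 2))"
    using hankel_term_bound[OF b, of H] by blast
  let ?C = "\<Sum>\<^sub>\<infinity>x\<in>L. B * (norm (H x) * x powr (2 * \<beta> + 2))"
  have "norm (hankel \<beta> H y) \<le> ?C" if y: "y \<in> insert 0 L" for y
    unfolding hankel_def
    by (rule order_trans[OF norm_infsum_bound[OF hankel_summable[OF b H y]]
          infsum_mono[OF hankel_summable[OF b H y] summable_on_cmult_right[OF H[unfolded mellin_def]] B(2)[OF y]]])
  moreover have "0 \<le> ?C" using B(1) by (intro infsum_nonneg) auto
  ultimately show ?thesis by blast
qed

section \<open>Schwartz functions\<close>

lemma Schwartz_decay:
  assumes "f \<in> Schwartz q"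
  shows "\<exists>C. \<forall>x\<in>L. norm (f x) * (1 + x\<^sup>2) ^ m \<le> C"
proof -
  obtain F where F: "schwartz_seminorm q 0 m F < \<infinity>" "\<And>x. x \<in> Rq q \<Longrightarrow> f x = F x"
    using assms unfolding Schwartz_def by blast
  obtain C where C: "0 \<le> C" "schwartz_seminorm q 0 m F = ennreal C"
    using F(1) by (cases "schwartz_seminorm q 0 m F") auto
  have "norm (f x) * (1 + x\<^sup>2) ^ m \<le> C" if x: "x \<in> L" for x
  proof -
    have "ennreal ((1 + x\<^sup>2) ^ m * cmod ((qderiv q ^^ 0) F x)) \<le> schwartz_seminorm q 0 m F"
      unfolding schwartz_seminorm_def by (rule SUP_upper2[of "(x, 0)"]) auto
    then have "(1 + x\<^sup>2) ^ m * cmod (F x) \<le> C" unfolding C(2) using C(1) by (simp add: ennreal_le_iff)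
    moreover have "f x = F x" using F(2) x by (simp add: Rq_def)
    ultimately show ?thesis by (simp add: mult.commute)
  qed
  then show ?thesis by blast
qed

lemma Schwartz_bounds:
  assumes "f \<in> Schwartz q" and N: "0 \<le> N"
  shows "\<exists>C\<ge>0. \<forall>x\<in>L. norm (f x) \<le> C \<and> (1 \<le> x \<longrightarrow> norm (f x) \<le> C * x powr - N)"
proof -
  define m where "m = nat \<lceil>N\<rceil>"
  obtain C where C: "\<And>x. x \<in> L \<Longrightarrow> norm (f x) * (1 + x\<^sup>2) ^ m \<le> C" using Schwartz_decay[OF assms(1)] by blast
  have C0: "0 \<le> C" using C[OF L_one] order_trans[OF _ C[OF L_one]] by simp
  have "norm (f x) \<le> C \<and> (1 \<le> x \<longrightarrow> norm (f x) \<le> C * x powr - N)" if x: "x \<in> L" for x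
  proof (intro conjI impI)
    have "norm (f x) * 1 \<le> norm (f x) * (1 + x\<^sup>2) ^ m" by (intro mult_left_mono one_le_power) auto
    then show "norm (f x) \<le> C" using C[OF x] by simp
    assume x1: "1 \<le> x"
    have "x powr N \<le> x powr real m" using x1 by (intro powr_mono) (simp_all add: m_def real_nat_ceiling_ge)
    also have "\<dots> = x ^ m" using x1 by (simp add: powr_realpow)
    also have "\<dots> \<le> (1 + x\<^sup>2) ^ m"
    proof (intro power_mono)
      have "x * 1 \<le> x * x" using x1 by (intro mult_left_mono) auto
      then show "x \<le> 1 + x\<^sup>2" by (simp add: power2_eq_square)
    qed (use x1 in simp)
    finally have "norm (f x) * x powr N \<le> C"
      using C[OF x] mult_left_mono[of "x powr N" "(1 + x\<^sup>2) ^ m" "norm (f x)"] by simp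
    then show "norm (f x) \<le> C * x powr - N" using x1 by (simp add: powr_minus field_simps)
  qed
  then show ?thesis using C0 by blast
qed

lemma mellin_Schwartz: assumes "f \<in> Schwartz q" "0 < s" shows "mellin s f"
proof -
  obtain C where C: "C \<ge> 0" "\<And>x. x \<in> L \<Longrightarrow> norm (f x) \<le> C" "\<And>x. x \<in> L \<Longrightarrow> 1 \<le> x \<Longrightarrow> norm (f x) \<le> C * x powr - (s + 1)"
    using Schwartz_bounds[OF assms(1), of "s + 1"] assms(2) by auto
  show ?thesis
    by (rule mellin_of_bounds[where a = 0 and b = "s + 1" and C = C and D = C]) (use C assms(2) L_pos in auto)
qed

text \<open>
  Near \<open>0\<close> the linear bound comes from differentiability, and elsewhere from boundedness.
\<close>

lemma Schwartz_near_0: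
  assumes "f \<in> Schwartz q"
  shows "\<exists>v C. \<forall>x\<in>L. x \<le> 1 \<longrightarrow> norm (f x - v) \<le> C * x"
proof -
  obtain F where F: "infinitely_q_differentiable q F" "\<And>x. x \<in> Rq q \<Longrightarrow> f x = F x"
    using assms unfolding Schwartz_def by blast
  have "(qderiv q ^^ 0) F differentiable at 0" using F(1) unfolding infinitely_q_differentiable_def by blast
  then obtain D where "(F has_derivative D) (at 0)" by (auto simp: differentiable_def)
  then have bl: "bounded_linear D" and "\<forall>e>0. \<exists>d>0. \<forall>y. norm (y - 0) < d \<longrightarrow> norm (F y - F 0 - D (y - 0))
      \<le> e * norm (y - 0)"
    unfolding has_derivative_at_alt by auto
  then obtain d where d: "d > 0" "\<And>y. norm y < d \<Longrightarrow> norm (F y - F 0 - D y) \<le> 1 * norm y"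
    by (metis diff_0_right zero_less_one)
  obtain K where K: "\<And>y. norm (D y) \<le> norm y * K" using bounded_linear.bounded[OF bl] by blast
  obtain B where B: "B \<ge> 0" "\<And>x. x \<in> L \<Longrightarrow> norm (f x) \<le> B" using Schwartz_bounds[OF assms, of 0] by auto
  define C where "C = max (1 + K) ((B + norm (F 0)) / d)"
  have "norm (f x - F 0) \<le> C * x" if x: "x \<in> L" for x
  proof (cases "x < d")
    case True
    have x0: "0 < x" using L_pos[OF x] .
    have "f x = F x" using F(2) x by (simp add: Rq_def)
    then have "norm (f x - F 0) \<le> norm (F x - F 0 - D x) + norm (D x)"
      using norm_triangle_sub[of "F x - F 0" "D x"] by (simp add: add.commute)
    also have "\<dots> \<le> 1 * norm x + norm x * K" using d(2)[of x] K[of x] True x0 by (intro add_mono) auto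
    also have "\<dots> = (1 + K) * x" using x0 by (simp add: algebra_simps)
    also have "\<dots> \<le> C * x" using x0 by (intro mult_right_mono) (auto simp: C_def)
    finally show ?thesis .
  next
    case False
    have "norm (f x - F 0) \<le> B + norm (F 0)" using B(2)[OF x] norm_triangle_ineq4[of "f x" "F 0"] by linarith
    also have "\<dots> = (B + norm (F 0)) / d * d" using d(1) by simp
    also have "\<dots> \<le> (B + norm (F 0)) / d * x" using False d(1) B(1) by (intro mult_left_mono) auto
    also have "\<dots> \<le> C * x" using L_pos[OF x] by (intro mult_right_mono) (auto simp: C_def)
    finally show ?thesis .
  qed
  then show ?thesis by blast
qed

lemma cutoff_near_0: "\<exists>C\<ge>0. \<forall>x\<in>L. \<bar>cutoff x - 1\<bar> \<le> C * x"
  using weight_near_0[of 0 1] L_pos unfolding cutoff_eq_weight by fastforce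

text \<open>
  Below \<open>2\<beta> + 2\<close> this follows from the reflection of exponents, since a Schwartz function is bounded at \<open>0\<close>. To reach
  \<open>2\<beta> + 3\<close>, subtract the multiple of the cutoff function that has the same value at \<open>0\<close>: what remains is
  \<open>O(x)\<close> by differentiability, and the transform of the cutoff function is again a cutoff function.
\<close>

lemma mellin_hankel_Schwartz:
  assumes b: "- 1 < \<beta>" and f: "f \<in> Schwartz q" and t: "0 < t" "t < 2 * \<beta> + 3"
  shows "mellin t (hankel \<beta> f)"
proof -
  let ?T = "hankel \<beta> (\<lambda>x. cx (cutoff x))"
  obtain v C where C: "\<And>x. x \<in> L \<Longrightarrow> x \<le> 1 \<Longrightarrow> norm (f x - v) \<le> C * x" using Schwartz_near_0[OF f] by blast
  obtain C' where C': "C' \<ge> 0" "\<And>x. x \<in> L \<Longrightarrow> \<bar>cutoff x - 1\<bar> \<le> C' * x" using cutoff_near_0 by blast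
  define g where "g = (\<lambda>x. f x - v * cx (cutoff x))"
  have mellin_g: "mellin s g" if s: "- 1 < s" for s
  proof -
    \<comment> \<open>a decay rate at infinity that exceeds the exponent \<open>s\<close>\<close>
    define N where "N = \<bar>s\<bar> + 1"
    obtain B where B: "B \<ge> 0" "\<And>x. x \<in> L \<Longrightarrow> norm (f x) \<le> B" "\<And>x. x \<in> L \<Longrightarrow> 1 \<le> x \<Longrightarrow> norm (f x) \<le> B * x powr - N"
      using Schwartz_bounds[OF f, of N] by (auto simp: N_def)
    show ?thesis
    proof (rule mellin_of_bounds[where a = "- 1" and b = N])
      fix x assume x: "x \<in> L"
      { assume "x \<le> 1"
        have "norm (g x) \<le> norm (f x - v) + norm (v * cx (1 - cutoff x))"
          using norm_triangle_ineq[of "f x - v" "v * cx (1 - cutoff x)"] by (simp add: g_def algebra_simps)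
        also have "\<dots> \<le> C * x + norm v * (C' * x)"
          using C[OF x \<open>x \<le> 1\<close>] mult_left_mono[OF C'(2)[OF x], of "norm v"]
          by (intro add_mono) (simp_all only: norm_mult norm_of_real abs_minus_commute[of 1] norm_ge_zero)
        finally show "norm (g x) \<le> (C + norm v * C') * x powr - (- 1)" using L_pos[OF x]
          by (simp add: algebra_simps) }
      assume x1: "1 \<le> x"
      show "norm (g x) \<le> (B + norm v) * x powr - N"
      proof (cases "x = 1")
        case True
        have "norm (g x) \<le> norm (f x) + norm v * \<bar>cutoff x\<bar>" unfolding g_def
          using norm_triangle_ineq4[of "f x" "v * cx (cutoff x)"] by (simp add: norm_mult)
        also have "\<dots> \<le> B + norm v * 1" using weight_bounded[of 0 x] x B(2)[OF x]
          by (intro add_mono mult_left_mono) (auto simp: cutoff_eq_weight)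
        finally show ?thesis using True by simp
      next
        case False
        then have "cutoff x = 0" using x1 x weight_gt_1 by (simp add: cutoff_eq_weight)
        then have "norm (g x) \<le> B * x powr - N" using B(3)[OF x x1] by (simp add: g_def)
        also have "\<dots> \<le> (B + norm v) * x powr - N" by (intro mult_right_mono) auto
        finally show ?thesis .
      qed
    qed (use s in \<open>auto simp: N_def\<close>)
  qed
  have mc: "mellin s (\<lambda>x. cx (cutoff x))" if "0 < s" for s by (rule mellin_cutoff[OF that])
  have "mellin t (hankel \<beta> g)" using t by (intro mellin_hankel b mellin_g) auto
  moreover have "mellin t (\<lambda>y. v * ?T y)"
  proof (rule mellin_le)
    let ?c = "(1 - q) / q"
    have c: "?c \<in> L" by (intro L_divide lattice L_q)
    show "mellin t (\<lambda>x. cx (cutoff (?c * x)))" by (rule mellin_scale[OF c mc[OF t(1)]])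
    fix y
    define D where "D = poch2_inf (q\<^sup>2) / poch2_inf (q powr (2 * \<beta> + 2))"
    have "q\<^sup>2 * (?c * y)\<^sup>2 = ((1 - q) * y)\<^sup>2" using q_pos by (simp add: power_mult_distrib power_divide)
    then have "?T y = cx (D * cutoff (?c * y))"
      by (simp only: hankel_cutoff[OF b] D_def cutoff_def[of "?c * y"])
    then show "norm (v * ?T y) \<le> (norm v * \<bar>poch2_inf (q\<^sup>2) / poch2_inf (q powr (2 * \<beta> + 2))\<bar>)
        * norm (cx (cutoff (?c * y)))"
      unfolding D_def[symmetric] by (simp only: norm_mult norm_of_real of_real_mult mult.assoc)
  qed
  ultimately have "mellin t (\<lambda>y. hankel \<beta> g y + v * ?T y)" by (rule mellin_add)
  moreover have "hankel \<beta> f y = hankel \<beta> g y + v * ?T y" if y: "y \<in> L" for y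
  proof -
    have w: "- 1 < 2 * \<beta> + 2" "0 < 2 * \<beta> + 2" using b by auto
    have y': "y \<in> insert 0 L" using y by simp
    note 1 = abs_summable_summable[OF hankel_summable[OF b mellin_g[OF w(1)] y']]
    note 2 = abs_summable_summable[OF hankel_summable[OF b mc[OF w(2)] y']]
    from infsum_add[OF 1 summable_on_cmult_right[OF 2, of v]]
    show ?thesis unfolding hankel_def infsum_cmult_right'[symmetric]
      by (simp add: g_def algebra_simps)
  qed
  ultimately show ?thesis
    using mellin_cong[of "hankel \<beta> f" "\<lambda>y. hankel \<beta> g y + v * ?T y" t] by simp
qed

section \<open>Riemann-Liouville and Weyl transforms\<close>

lemma infsum_L_unit_suminf:
  fixes h :: "real \<Rightarrow> complex"
  assumes z: "\<And>x. x \<in> L \<Longrightarrow> 1 < x \<Longrightarrow> h x = 0" and s: "(\<lambda>x. norm (h x)) summable_on L"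
  shows "infsum h L = (\<Sum>n. h (q ^ n))"
proof -
  have "(\<lambda>x. norm (h x)) summable_on {x \<in> L. x \<le> 1}" by (rule summable_on_subset[OF s]) auto
  then have "(\<lambda>n. norm (h (q ^ n))) summable_on UNIV"
    unfolding L_unit_range by (subst (asm) summable_on_reindex[OF q_power_inj]) (simp add: o_def)
  then have "summable (\<lambda>n. norm (h (q ^ n)))" by (rule summable_on_imp_summable)
  then show ?thesis using infsum_L_unit[of h, OF z] infsum_nat_eq_suminf by metis
qed

abbreviation "Aq \<alpha> \<equiv> q powr (2 * \<alpha> + 1)"

lemma Aq_bounds: "- 1 / 2 < \<alpha> \<Longrightarrow> 0 \<le> Aq \<alpha> \<and> Aq \<alpha> < 1"
  using q_pos q_less_1 by (simp add: powr01_less_one)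

lemma Aq_q: "Aq \<alpha> * q = q powr (2 * \<alpha> + 2)"
  using q_pos by (simp add: powr_add power2_eq_square)

lemma two_half_plus_two: "2 * (- 1 / 2) + 2 = (1::real)" by simp

lemma hankel_half: "hankel (- 1 / 2) H y = (\<Sum>\<^sub>\<infinity>x\<in>L. H x * cx (j (- 1 / 2) (y * x) * x))"
  unfolding hankel_def two_half_plus_two by (intro infsum_cong) (simp add: L_pos less_imp_le)

lemma minus_half_gt: "- 1 < (- 1 / 2 :: real)" by simp

text \<open>
  The Riemann-Liouville and Weyl transforms without their constants. Both are multiplicative convolutions with the
  same weight, whose support makes the range of summation the whole lattice.
\<close>

definition RL_sum :: "real \<Rightarrow> (real \<Rightarrow> complex) \<Rightarrow> real \<Rightarrow> complex" where
  "RL_sum \<alpha> f x = (\<Sum>\<^sub>\<infinity>t\<in>L. cx (weight (Aq \<alpha>) t * t) * f (x * t))"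

definition Weyl_sum :: "real \<Rightarrow> (real \<Rightarrow> complex) \<Rightarrow> real \<Rightarrow> complex" where
  "Weyl_sum \<alpha> f x = (\<Sum>\<^sub>\<infinity>t\<in>L. cx (weight (Aq \<alpha>) (x / t) * t powr (2 * \<alpha> + 1)) * f t)"

definition beta_const :: "real \<Rightarrow> real" where
  "beta_const \<alpha> = poch2_inf (q\<^sup>2) * poch2_inf (q powr (2 * \<alpha> + 2)) / (poch2_inf (Aq \<alpha>) * poch2_inf q)"

lemma RL_qBessel:
  assumes a: "- 1 / 2 < \<alpha>"
  shows "(\<Sum>\<^sub>\<infinity>s\<in>L. weight (Aq \<alpha>) s * (j (- 1 / 2) (y * s) * s)) = beta_const \<alpha> * j \<alpha> y"
proof -
  have A: "0 \<le> Aq \<alpha>" "Aq \<alpha> < 1" using Aq_bounds[OF a] by auto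
  have "(\<Sum>\<^sub>\<infinity>s\<in>L. weight (Aq \<alpha>) s * (j (- 1 / 2) (y * s) * s))
      = (\<Sum>\<^sub>\<infinity>x\<in>L. weight (Aq \<alpha>) x * (j (- 1 / 2) (y * x) * x powr (2 * (- 1 / 2) + 2)))"
    unfolding two_half_plus_two by (intro infsum_cong) (simp add: L_pos less_imp_le)
  also have "\<dots> = beta_const \<alpha> * hahn_exton (Aq \<alpha> * q powr (2 * (- 1 / 2) + 2)) (((1 - q) * y)\<^sup>2)"
    using qBessel_weighted_integral[of "- 1 / 2" "Aq \<alpha>" y] A unfolding two_half_plus_two beta_const_def
      using q_pos by (simp add: Aq_q)
  also have "\<dots> = beta_const \<alpha> * j \<alpha> y"
    unfolding two_half_plus_two qBessel_eq_hahn_exton using q_pos by (simp add: Aq_q)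
  finally show ?thesis .
qed

definition RL_const :: "real \<Rightarrow> real" where
  "RL_const \<alpha> = (1 + q) * qGamma (q\<^sup>2) (\<alpha> + 1) / (qGamma (q\<^sup>2) (1/2) * qGamma (q\<^sup>2) (\<alpha> + 1/2))"

definition Weyl_const :: "real \<Rightarrow> real" where
  "Weyl_const \<alpha> = q * (1 + inverse q) powr (- \<alpha> + 1/2) / qGamma (q\<^sup>2) (\<alpha> + 1/2)"

text \<open>
  The constant of the Riemann-Liouville transform is the reciprocal of the \<open>q\<close>-beta integral.
\<close>

lemma RL_const_beta:
  assumes a: "- 1 / 2 < \<alpha>" shows "RL_const \<alpha> * (1 - q) * beta_const \<alpha> = 1"
proof -
  have g1: "qGamma (q\<^sup>2) (\<alpha> + 1) = poch2_inf (q\<^sup>2) / poch2_inf (q powr (2 * \<alpha> + 2)) * (1 - q\<^sup>2) powr (- \<alpha>)"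
    unfolding qGamma_eq by (simp add: algebra_simps)
  have g2: "qGamma (q\<^sup>2) (1/2) = poch2_inf (q\<^sup>2) / poch2_inf q * (1 - q\<^sup>2) powr (1/2)"
    unfolding qGamma_eq using q_pos by simp
  have g3: "qGamma (q\<^sup>2) (\<alpha> + 1/2) = poch2_inf (q\<^sup>2) / poch2_inf (Aq \<alpha>) * (1 - q\<^sup>2) powr (1/2 - \<alpha>)"
    unfolding qGamma_eq by (simp add: algebra_simps)
  have "(1 - q\<^sup>2) powr (1/2) * (1 - q\<^sup>2) powr (1/2 - \<alpha>) = (1 - q\<^sup>2) * (1 - q\<^sup>2) powr (- \<alpha>)"
  proof -
    have "(1 - q\<^sup>2) powr (1/2) * (1 - q\<^sup>2) powr (1/2 - \<alpha>) = (1 - q\<^sup>2) powr (1 + - \<alpha>)"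
      by (simp add: powr_add[symmetric])
    also have "\<dots> = (1 - q\<^sup>2) powr 1 * (1 - q\<^sup>2) powr (- \<alpha>)" by (rule powr_add)
    finally show ?thesis using qsq_less_1 by simp
  qed
  moreover have "0 < poch2_inf (q\<^sup>2)" "0 < poch2_inf (q powr (2 * \<alpha> + 2))" "0 < poch2_inf q" "0 < poch2_inf (Aq \<alpha>)"
    using poch2_inf_pos poch2_inf_q_pos qBessel_parameter_bounds[of \<alpha>] Aq_bounds[OF a] q_pos q_less_1 a by auto
  moreover have alg: "(1 + q) * (P / B * X) / ((P / Q * Y) * (P / A * Z)) * (1 - q) * (P * B / (A * Q)) = 1"
    if "Y * Z = (1 - q\<^sup>2) * X" "P > 0" "B > 0" "Q > 0" "A > 0" "X > 0" for P B Q A X Y Z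
  proof -
    have nz: "1 - q\<^sup>2 > 0" using qsq_less_1 by simp
    have "Y \<noteq> 0" "Z \<noteq> 0" using that nz by auto
    have "u * (P / B * X) / ((P / Q * Y) * (P / A * Z)) * v * (P * B / (A * Q)) = (u * v * X) / (Y * Z)" for u v
      using that(2-5) \<open>Y \<noteq> 0\<close> \<open>Z \<noteq> 0\<close> by (simp add: field_simps)
    from this[of "1 + q" "1 - q"] have "(1 + q) * (P / B * X) / ((P / Q * Y) * (P / A * Z)) * (1 - q)
        * (P * B / (A * Q)) = ((1 - q\<^sup>2) * X) / ((1 - q\<^sup>2) * X)"
      unfolding that(1) one_minus_qsq by (simp only: mult.commute)
    also have "\<dots> = 1" using that(6) nz by simp
    finally show ?thesis .
  qed
  moreover have "0 < (1 - q\<^sup>2) powr (- \<alpha>)" using qsq_less_1 by simp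
  ultimately show ?thesis unfolding RL_const_def g1 g2 g3 beta_const_def by (intro alg)
qed

text \<open>
  This relation of the constants gives \<open>F\<^bsub>-1/2\<^esub> W = F\<^sub>\<alpha>\<close> without a factor.
\<close>

lemma Weyl_const_beta:
  assumes a: "- 1 / 2 < \<alpha>" shows "qF_factor (- 1 / 2) * (Weyl_const \<alpha> * (1 - q)) * beta_const \<alpha> = qF_factor \<alpha>"
proof -
  have q1: "0 < 1 - q" using q_less_1 by simp
  have g3: "qGamma (q\<^sup>2) (\<alpha> + 1/2) = poch2_inf (q\<^sup>2) / poch2_inf (Aq \<alpha>) * (1 - q\<^sup>2) powr (1/2 - \<alpha>)"
    unfolding qGamma_eq by (simp add: algebra_simps)
  have "1 + inverse q = (1 + q) / q" using q_pos by (simp add: field_simps)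
  then have 1: "(1 + inverse q) powr (- \<alpha> + 1/2) = (1 + q) powr (1/2 - \<alpha>) * q powr (\<alpha> - 1/2)"
  proof -
    have "(1 + inverse q) powr (- \<alpha> + 1/2) = (1 + q) powr (- \<alpha> + 1/2) * inverse (q powr (- \<alpha> + 1/2))"
      by (simp only: \<open>1 + inverse q = (1 + q) / q\<close> powr_divide) (simp only: divide_inverse[of "_ powr _"])
    also have "inverse (q powr (- \<alpha> + 1/2)) = q powr - (- \<alpha> + 1/2)" by (rule powr_minus[symmetric])
    finally show ?thesis by simp
  qed
  have 2: "(1 - q\<^sup>2) powr (1/2 - \<alpha>) = inverse ((1 - q) powr (\<alpha> - 1/2)) * (1 + q) powr (1/2 - \<alpha>)"
  proof -
    have "(1 - q\<^sup>2) powr (1/2 - \<alpha>) = (1 - q) powr (1/2 - \<alpha>) * (1 + q) powr (1/2 - \<alpha>)"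
      unfolding one_minus_qsq using q_pos q1 by (simp add: powr_mult)
    also have "(1 - q) powr (1/2 - \<alpha>) = inverse ((1 - q) powr (\<alpha> - 1/2))" by (subst powr_minus[symmetric]) simp
    finally show ?thesis .
  qed
  have 3: "q * (A * Q) / (P / W * (inverse B * A)) = q * Q * B * W / P" if "A > 0" for A Q P W B :: real
    using that by (simp add: divide_inverse)
  have "Weyl_const \<alpha> = q * q powr (\<alpha> - 1/2) * (1 - q) powr (\<alpha> - 1/2) * poch2_inf (Aq \<alpha>) / poch2_inf (q\<^sup>2)"
    unfolding Weyl_const_def g3 1 2 by (rule 3) (use q_pos in simp)
  then have Weyl_const: "Weyl_const \<alpha>
      = q powr (\<alpha> + 1/2) * (1 - q) powr (\<alpha> - 1/2) * poch2_inf (Aq \<alpha>) / poch2_inf (q\<^sup>2)"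
    using powr_add[of q 1 "\<alpha> - 1/2"] q_pos by (simp add: add.commute)
  have c: "qF_const q (- 1 / 2) = q powr (- 1/2) * (1 - q) powr (- 1/2) * poch2_inf q / poch2_inf (q\<^sup>2)"
    unfolding qF_const_eq two_half_plus_two using q_pos by simp
  have p1: "q powr (- 1/2) * q powr (\<alpha> + 1/2) = q powr \<alpha>" by (simp add: powr_add[symmetric])
  have p2: "(1 - q) powr (- 1/2) * (1 - q) powr (\<alpha> - 1/2) * (1 - q) = (1 - q) powr \<alpha>"
  proof -
    have "(1 - q) powr (- 1/2) * (1 - q) powr (\<alpha> - 1/2) * (1 - q) powr 1 = (1 - q) powr \<alpha>"
      by (simp only: powr_add[symmetric]) simp
    then show ?thesis using q1 by simp
  qed
  have pos: "0 < poch2_inf (q\<^sup>2)" "0 < poch2_inf q" "0 < poch2_inf (Aq \<alpha>)"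
    using poch2_inf_pos poch2_inf_q_pos Aq_bounds[OF a] q_pos q_less_1 by auto
  have alg: "(a * b * F / P * u) * ((c * d * G / P) * u) * (P * H / (G * F)) = (a * c) * (b * d * u) * H / P * u"
    if "P > 0" "F > 0" "G > 0" for a b c d F G H P u :: real
    using that by (simp add: divide_simps)
  show ?thesis
    unfolding c Weyl_const beta_const_def alg[OF pos] p1 p2 qF_const_eq[of \<alpha>] ..
qed

text \<open>
  The constant \<open>\<kappa>\<close> of \<open>K\<^sub>1\<close> and \<open>K\<^sub>2\<close> compensates the ratio of the two transform constants and the factor
  \<open>q\<^bsup>-4\<alpha>-2\<^esup>\<close> of the inverse transform.
\<close>

lemma qkappa_eq:
  assumes a: "- 1 / 2 < \<alpha>"
  shows "qkappa q \<alpha> * (qF_factor (- 1 / 2) / qF_factor \<alpha>) = q powr (- 4 * \<alpha> - 2)"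
proof -
  define G1 G2 where "G1 = qGamma (q\<^sup>2) (1/2)" and "G2 = qGamma (q\<^sup>2) (\<alpha> + 1)"
  have c1: "qF_const q (- 1 / 2) = (1 + inverse q) powr (1/2) / G1" by (simp add: qF_const_def G1_def)
  have c2: "qF_const q \<alpha> = (1 + inverse q) powr (- \<alpha>) / G2" by (simp add: qF_const_def G2_def)
  have G: "G1 \<noteq> 0" "G2 \<noteq> 0"
    using qF_const_pos[of "- 1 / 2"] qF_const_pos[of \<alpha>] a unfolding c1 c2 by auto
  have e: "1 + inverse q = (1 + q) / q" using q_pos by (simp add: field_simps)
  have q1: "1 - q > 0" using q_less_1 by simp
  have ratio: "qF_factor (- 1 / 2) / qF_factor \<alpha> = (1 + inverse q) powr (1/2 + \<alpha>) * (G2 / G1)"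
  proof -
    have "qF_factor (- 1 / 2) / qF_factor \<alpha> = ((1 + inverse q) powr (1/2) / (1 + inverse q) powr (- \<alpha>)) * (G2 / G1)"
    proof -
      have "(x / G1 * u) / (y / G2 * u) = (x / y) * (G2 / G1)" if "u > 0" for x y u :: real
        using that G by simp
      from this[OF q1] show ?thesis unfolding c1 c2 .
    qed
    also have "(1 + inverse q) powr (1/2) / (1 + inverse q) powr (- \<alpha>) = (1 + inverse q) powr (1/2 + \<alpha>)"
      using q_pos by (simp add: powr_diff[symmetric])
    finally show ?thesis .
  qed
  have "(1 + inverse q) powr (1/2 + \<alpha>) = (1 + q) powr (\<alpha> + 1/2) / q powr (\<alpha> + 1/2)"
    unfolding e using q_pos by (simp add: powr_divide add.commute)
  then have "qkappa q \<alpha> * (qF_factor (- 1 / 2) / qF_factor \<alpha>) = 1 / (q powr (3 * \<alpha> + 3/2) * q powr (\<alpha> + 1/2))"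
    unfolding ratio qkappa_def G1_def[symmetric] G2_def[symmetric] using G q_pos by (simp add: field_simps)
  also have "\<dots> = q powr (- 4 * \<alpha> - 2)"
  proof -
    have "q powr (3 * \<alpha> + 3/2) * q powr (\<alpha> + 1/2) = q powr - (- 4 * \<alpha> - 2)"
      by (simp add: powr_add[symmetric] algebra_simps)
    then show ?thesis by (simp only: powr_minus divide_inverse inverse_inverse_eq mult_1)
  qed
  finally show ?thesis .
qed

lemma weight_0: "weight A 0 = 1" by (simp add: weight_def)

lemma qRL_eq:
  assumes s: "(\<lambda>t. norm (cx (weight (Aq \<alpha>) t * t) * f (x * t))) summable_on L"
  shows "qRL q \<alpha> f x = cx (RL_const \<alpha> * (1 - q)) * RL_sum \<alpha> f x"
proof -
  have "RL_sum \<alpha> f x = (\<Sum>n. cx (weight (Aq \<alpha>) (q ^ n) * q ^ n) * f (x * q ^ n))"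
    unfolding RL_sum_def by (rule infsum_L_unit_suminf[OF _ s]) (simp add: weight_gt_1)
  then show ?thesis
    unfolding qRL_def jackson_upto_def RL_const_def weight_def
    by (simp add: scaleR_conv_of_real mult_ac)
qed

text \<open>
  The Jackson integral from \<open>0\<close> to \<open>q x\<close> that is subtracted consists of zeros: there the weight is evaluated at
  lattice points above \<open>1\<close>. At \<open>x = 0\<close> it vanishes because of its length.
\<close>

lemma qWeyl_eq:
  assumes x: "x \<in> insert 0 L"
  shows "qWeyl q \<alpha> f x = cx (Weyl_const \<alpha> * (1 - q)) * Weyl_sum \<alpha> f x"
proof -
  define h where "h = (\<lambda>t. cx (qpoch_inf (q\<^sup>2 * x\<^sup>2 / t\<^sup>2) (q\<^sup>2)
       / qpoch_inf (Aq \<alpha> * x\<^sup>2 / t\<^sup>2) (q\<^sup>2)) * f t * cx (t powr (2 * \<alpha>)))"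
  have h: "h t = cx (weight (Aq \<alpha>) (x / t)) * f t * cx (t powr (2 * \<alpha>))" for t
    by (simp add: h_def weight_def power_divide)
  have "jackson_upto q (q * \<bar>x\<bar>) h = 0"
  proof (cases "x = 0")
    case True
    then show ?thesis by (simp add: jackson_upto_def)
  next
    case False
    then have xL: "x \<in> L" "0 < x" using x L_pos by auto
    have "h (q * \<bar>x\<bar> * q ^ n) = 0" for n
    proof -
      have "x / (q * \<bar>x\<bar> * q ^ n) = 1 / q ^ Suc n" using xL by simp
      moreover have "1 < 1 / q ^ Suc n" using q_pos q_less_1 power_Suc_less_one[of q n] by simp
      moreover have "1 / q ^ Suc n \<in> L" by (intro L_divide L_one L_power L_q)
      ultimately show ?thesis unfolding h by (simp only: weight_gt_1) simp
    qed
    then show ?thesis by (simp add: jackson_upto_def)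
  qed
  moreover have "jackson q h = cx (1 - q) * Weyl_sum \<alpha> f x"
  proof -
    have "(\<Sum>\<^sub>\<infinity>t\<in>L. t *\<^sub>R h t) = Weyl_sum \<alpha> f x"
      unfolding Weyl_sum_def
    proof (rule infsum_cong)
      fix t assume t: "t \<in> L"
      then have "t * t powr (2 * \<alpha>) = t powr (2 * \<alpha> + 1)" using L_pos[OF t] by (simp add: powr_add)
      then have "cx t * cx (t powr (2 * \<alpha>)) = cx (t powr (2 * \<alpha> + 1))"
        by (simp flip: of_real_mult)
      then show "t *\<^sub>R h t = cx (weight (Aq \<alpha>) (x / t) * t powr (2 * \<alpha> + 1)) * f t"
        unfolding h by (simp add: scaleR_conv_of_real mult_ac)
    qed
    then show ?thesis unfolding jackson_eq by (simp add: scaleR_conv_of_real)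
  qed
  ultimately show ?thesis
    unfolding qWeyl_def jackson_from_def h_def[symmetric] Weyl_const_def by simp
qed

lemma mellin_weight:
  assumes a: "- 1 / 2 < \<alpha>" and s: "0 < s" shows "mellin s (weight (Aq \<alpha>))"
proof (rule mellin_of_bounds[where a = 0 and b = "s + 1" and C = "1 / poch2_inf (Aq \<alpha>)" and D
    = "1 / poch2_inf (Aq \<alpha>)"])
  have A: "0 \<le> Aq \<alpha>" "Aq \<alpha> < 1" using Aq_bounds[OF a] by auto
  fix x assume x: "x \<in> L"
  show b: "norm (weight (Aq \<alpha>) x) \<le> 1 / poch2_inf (Aq \<alpha>) * x powr - 0"
    using weight_bounded[OF A, of x] x L_pos[OF x] by simp
  assume "1 \<le> x"
  then consider "x = 1" | "1 < x" by linarith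
  then show "norm (weight (Aq \<alpha>) x) \<le> 1 / poch2_inf (Aq \<alpha>) * x powr - (s + 1)"
  proof cases
    case 1 then show ?thesis using b by simp
  next
    case 2 then show ?thesis using weight_gt_1[OF x] poch2_inf_pos[OF A] by simp
  qed
qed (use s in auto)

lemma mellin_Weyl_sum:
  assumes a: "- 1 / 2 < \<alpha>" and s: "0 < s" and f: "mellin (s + (2 * \<alpha> + 1)) f"
  shows "mellin s (Weyl_sum \<alpha> f)"
  unfolding Weyl_sum_def[abs_def]
proof (rule mellin_convolution[where G = "weight (Aq \<alpha>)" and \<sigma> = inverse and H
    = "\<lambda>t. norm (f t) * t powr (2 * \<alpha> + 1)"])
  show "mellin s (weight (Aq \<alpha>))" by (rule mellin_weight[OF a s])
  have eq: "norm (f t) * t powr (2 * \<alpha> + 1) * inverse t powr - s = norm (f t) * t powr (s + (2 * \<alpha> + 1))"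
    if "t \<in> L" for t
  proof -
    have "inverse t powr - s = t powr s" using L_pos[OF that] by (simp add: inverse_powr powr_minus)
    then show ?thesis by (simp add: powr_add mult_ac)
  qed
  show "(\<lambda>t. norm (f t) * t powr (2 * \<alpha> + 1) * inverse t powr - s) summable_on L"
    using f[unfolded mellin_def] by (rule summable_on_cong[THEN iffD1, rotated]) (rule eq[symmetric])
qed (auto simp: L_inverse norm_mult divide_inverse mult_ac)

text \<open>
  Interchange the sums and substitute \<open>x = t s\<close>: the inner sum becomes the Riemann-Liouville transform of a
  kernel.
\<close>

lemma hankel_Weyl:
  assumes a: "- 1 / 2 < \<alpha>" and f: "mellin (2 * \<alpha> + 2) f" and y: "y \<in> insert 0 L"
  shows "hankel (- 1 / 2) (Weyl_sum \<alpha> f) y = cx (beta_const \<alpha>) * hankel \<alpha> f y"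
proof -
  let ?A = "Aq \<alpha>"
  obtain B where B: "B \<ge> 1" "\<And>x. x \<in> insert 0 L \<Longrightarrow> \<bar>j (- 1 / 2) x\<bar> \<le> B"
    using qBessel_bounded[OF minus_half_gt] by blast
  let ?F = "\<lambda>t x. cx (weight ?A (x / t) * t powr (2 * \<alpha> + 1)) * f t * cx (j (- 1 / 2) (y * x) * x)"
  have sum: "(\<lambda>(t, x). ?F t x) summable_on L \<times> L"
  proof (rule abs_summable_summable, rule Infinite_Sum.abs_summable_on_comparison_test')
    show "(\<lambda>(t, x). (B * (norm (f t) * t powr (2 * \<alpha> + 1))) * (norm (weight ?A (x * inverse t))
        * x powr 1)) summable_on L \<times> L"
    proof (rule summable_mellin_convolution)
      show "mellin 1 (weight ?A)" by (rule mellin_weight[OF a]) simp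
      have eq: "B * (norm (f t) * t powr (2 * \<alpha> + 1)) * inverse t powr - 1
          = B * (norm (f t) * t powr (2 * \<alpha> + 2))" if "t \<in> L" for t
        using L_pos[OF that] by (simp add: powr_add powr_minus power2_eq_square)
      have "(\<lambda>t. B * (norm (f t) * t powr (2 * \<alpha> + 2))) summable_on L"
        using f unfolding mellin_def by (rule summable_on_cmult_right)
      then show "(\<lambda>t. B * (norm (f t) * t powr (2 * \<alpha> + 1)) * inverse t powr - 1) summable_on L"
        by (rule summable_on_cong[THEN iffD1, rotated]) (rule eq[symmetric])
    qed (use B in \<open>auto simp: L_inverse\<close>)
    fix z assume "z \<in> L \<times> L"
    then obtain t x where z: "z = (t, x)" and tx: "t \<in> L" "x \<in> L" by auto
    have yx: "y * x \<in> insert 0 L" using y tx L_mult by auto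
    have x0: "0 < x" using L_pos[OF tx(2)] .
    have "norm (?F t x) = \<bar>j (- 1 / 2) (y * x)\<bar> * (\<bar>weight ?A (x / t)\<bar> * t powr (2 * \<alpha> + 1) * norm (f t) * x)"
      using x0 by (simp add: norm_mult abs_mult mult_ac)
    also have "\<dots> \<le> B * (\<bar>weight ?A (x / t)\<bar> * t powr (2 * \<alpha> + 1) * norm (f t) * x)"
      by (intro mult_right_mono B(2)[OF yx]) (use x0 in simp)
    also have "\<dots> = (B * (norm (f t) * t powr (2 * \<alpha> + 1))) * (norm (weight ?A (x * inverse t)) * x powr 1)"
    proof -
      have "x powr 1 = x" "x / t = x * inverse t" using x0 by (auto simp: divide_inverse)
      then show ?thesis by (simp only: real_norm_def mult_ac)
    qed
    finally show "norm (case z of (t, x) \<Rightarrow> ?F t x)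
        \<le> (case z of (t, x) \<Rightarrow> (B * (norm (f t) * t powr (2 * \<alpha> + 1))) * (norm (weight ?A (x * inverse t))
        * x powr 1))"
      by (simp only: z prod.case)
  qed
  have "hankel (- 1 / 2) (Weyl_sum \<alpha> f) y = (\<Sum>\<^sub>\<infinity>x\<in>L. \<Sum>\<^sub>\<infinity>t\<in>L. ?F t x)"
    unfolding hankel_half Weyl_sum_def infsum_cmult_left' ..
  also have "\<dots> = (\<Sum>\<^sub>\<infinity>t\<in>L. \<Sum>\<^sub>\<infinity>x\<in>L. ?F t x)" by (rule infsum_swap_banach[OF sum, symmetric])
  also have "\<dots> = (\<Sum>\<^sub>\<infinity>t\<in>L. cx (beta_const \<alpha>) * (f t * cx (j \<alpha> (y * t) * t powr (2 * \<alpha> + 2))))"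
  proof (rule infsum_cong)
    fix t assume t: "t \<in> L"
    have t0: "0 < t" using L_pos[OF t] .
    have "(\<Sum>\<^sub>\<infinity>x\<in>L. ?F t x)
        = (\<Sum>\<^sub>\<infinity>x\<in>L. (cx (t powr (2 * \<alpha> + 1)) * f t) * cx (weight ?A (x / t) * (j (- 1 / 2) (y * x) * x)))"
      by (intro infsum_cong) (simp add: mult_ac)
    also have "\<dots> = (cx (t powr (2 * \<alpha> + 1)) * f t) * cx (\<Sum>\<^sub>\<infinity>x\<in>L. weight ?A (x / t) * (j (- 1 / 2) (y * x) * x))"
      unfolding infsum_cmult_right' infsum_complex_of_real ..
    also have "(\<Sum>\<^sub>\<infinity>x\<in>L. weight ?A (x / t) * (j (- 1 / 2) (y * x) * x))
        = (\<Sum>\<^sub>\<infinity>s\<in>L. weight ?A (t * s / t) * (j (- 1 / 2) (y * (t * s)) * (t * s)))"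
      by (rule infsum_L_scale[OF t, symmetric])
    also have "\<dots> = (\<Sum>\<^sub>\<infinity>s\<in>L. t * (weight ?A s * (j (- 1 / 2) ((y * t) * s) * s)))"
      using t0 by (intro infsum_cong) (simp add: mult_ac)
    also have "\<dots> = t * (beta_const \<alpha> * j \<alpha> (y * t))"
      unfolding infsum_cmult_right' RL_qBessel[OF a] ..
    finally show "(\<Sum>\<^sub>\<infinity>x\<in>L. ?F t x) = cx (beta_const \<alpha>) * (f t * cx (j \<alpha> (y * t) * t powr (2 * \<alpha> + 2)))"
    proof -
      assume eq: "(\<Sum>\<^sub>\<infinity>x\<in>L. ?F t x) = cx (t powr (2 * \<alpha> + 1)) * f t * cx (t * (beta_const \<alpha> * j \<alpha> (y * t)))"
      have "cx (t powr (2 * \<alpha> + 2)) = cx (t powr (2 * \<alpha> + 1)) * cx t"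
        using t0 by (simp add: powr_add power2_eq_square flip: of_real_mult)
      then show ?thesis unfolding eq by (simp add: mult_ac)
    qed
  qed
  also have "\<dots> = cx (beta_const \<alpha>) * hankel \<alpha> f y"
    unfolding infsum_cmult_right' hankel_def ..
  finally show ?thesis .
qed

lemma Weyl_summable:
  assumes a: "- 1 / 2 < \<alpha>" and f: "mellin (2 * \<alpha> + 1) f" and x: "x \<in> insert 0 L"
  shows "(\<lambda>t. cx (weight (Aq \<alpha>) (x / t) * t powr (2 * \<alpha> + 1)) * f t) summable_on L"
proof (rule abs_summable_summable, rule Infinite_Sum.abs_summable_on_comparison_test')
  have A: "0 \<le> Aq \<alpha>" "Aq \<alpha> < 1" using Aq_bounds[OF a] by auto
  show "(\<lambda>t. 1 / poch2_inf (Aq \<alpha>) * (norm (f t) * t powr (2 * \<alpha> + 1))) summable_on L"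
    using f unfolding mellin_def by (rule summable_on_cmult_right)
  fix t assume t: "t \<in> L"
  have "x / t \<in> insert 0 L" using x t L_divide by auto
  from mult_right_mono[OF weight_bounded[OF A this], of "norm (f t) * t powr (2 * \<alpha> + 1)"]
  show "norm (cx (weight (Aq \<alpha>) (x / t) * t powr (2 * \<alpha> + 1)) * f t)
      \<le> 1 / poch2_inf (Aq \<alpha>) * (norm (f t) * t powr (2 * \<alpha> + 1))"
    by (simp add: norm_mult abs_mult mult_ac)
qed

lemma q_powers_tendsto_0: "(\<lambda>n. q ^ n) \<longlonglongrightarrow> 0"
  using q_pos q_less_1 by (intro LIMSEQ_power_zero) auto

text \<open>
  Continuity at \<open>0\<close> along the lattice. The distance of the weight \<open>weight A (x / t)\<close> from its limit \<open>1\<close> is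
  \<open>O((x / t)\<^bsup>\<theta>\<^esup>)\<close>, which separates into a null sequence in \<open>x\<close> and a convergent sum over \<open>t\<close>.
\<close>

lemma Weyl_tendsto_0:
  assumes a: "- 1 / 2 < \<alpha>" and th: "0 < \<theta>" "\<theta> \<le> 2" and f: "mellin (2 * \<alpha> + 1) f" "mellin (2 * \<alpha> + 1 - \<theta>) f"
  shows "(\<lambda>n. Weyl_sum \<alpha> f (q ^ n)) \<longlonglongrightarrow> Weyl_sum \<alpha> f 0"
proof -
  have A: "0 \<le> Aq \<alpha>" "Aq \<alpha> < 1" using Aq_bounds[OF a] by auto
  obtain C where C: "C \<ge> 0" "\<And>x. x \<in> L \<Longrightarrow> \<bar>weight (Aq \<alpha>) x - 1\<bar> \<le> C * x powr \<theta>" using weight_near_0[OF A th] by blast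
  let ?S = "\<Sum>\<^sub>\<infinity>t\<in>L. norm (f t) * t powr (2 * \<alpha> + 1 - \<theta>)"
  have bound: "norm (Weyl_sum \<alpha> f x - Weyl_sum \<alpha> f 0) \<le> C * x powr \<theta> * ?S" if x: "x \<in> L" for x
  proof -
    let ?d = "\<lambda>t. cx ((weight (Aq \<alpha>) (x / t) - 1) * t powr (2 * \<alpha> + 1)) * f t"
    have x': "x \<in> insert 0 L" "0 \<in> insert 0 L" using x by auto
    have "Weyl_sum \<alpha> f x - Weyl_sum \<alpha> f 0 = infsum ?d L"
      unfolding Weyl_sum_def
        using infsum_add[OF Weyl_summable[OF a f(1) x'(1)] summable_on_uminus[THEN iffD2, OF Weyl_summable[OF a f(1) x'(2)]]]
      by (simp add: infsum_uminus weight_0 algebra_simps)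
    have d_le: "norm (?d t) \<le> C * x powr \<theta> * (norm (f t) * t powr (2 * \<alpha> + 1 - \<theta>))" if t: "t \<in> L" for t
    proof -
      have "norm (?d t) = \<bar>weight (Aq \<alpha>) (x / t) - 1\<bar> * (t powr (2 * \<alpha> + 1) * norm (f t))"
        by (simp only: norm_mult norm_of_real abs_mult) (simp add: mult_ac)
      also have "\<dots> \<le> (C * (x / t) powr \<theta>) * (t powr (2 * \<alpha> + 1) * norm (f t))"
        by (intro mult_right_mono C(2) L_divide x t) auto
      also have "\<dots> = C * x powr \<theta> * (norm (f t) * (t powr (2 * \<alpha> + 1) / t powr \<theta>))"
        using L_pos[OF x] L_pos[OF t] by (simp add: powr_divide mult_ac)
      finally show ?thesis by (simp add: powr_diff)
    qed
    have sm: "(\<lambda>t. C * x powr \<theta> * (norm (f t) * t powr (2 * \<alpha> + 1 - \<theta>))) summable_on L"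
      using f(2) unfolding mellin_def by (rule summable_on_cmult_right)
    have sd: "(\<lambda>t. norm (?d t)) summable_on L"
      by (rule Infinite_Sum.abs_summable_on_comparison_test'[OF sm d_le])
    have "norm (infsum ?d L) \<le> (\<Sum>\<^sub>\<infinity>t\<in>L. norm (?d t))" by (rule norm_infsum_bound[OF sd])
    also have "\<dots> \<le> (\<Sum>\<^sub>\<infinity>t\<in>L. C * x powr \<theta> * (norm (f t) * t powr (2 * \<alpha> + 1 - \<theta>)))"
      by (rule infsum_mono[OF sd sm d_le])
    also have "\<dots> = C * x powr \<theta> * ?S" by (rule infsum_cmult_right')
    finally show ?thesis using \<open>Weyl_sum \<alpha> f x - Weyl_sum \<alpha> f 0 = infsum ?d L\<close> by simp
  qed
  have "(\<lambda>n. (q ^ n) powr \<theta>) \<longlonglongrightarrow> 0"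
    unfolding q_power_powr using q_pos q_less_1 th by (intro LIMSEQ_power_zero) (simp add: powr01_less_one)
  then have "(\<lambda>n. C * (q ^ n) powr \<theta> * ?S) \<longlonglongrightarrow> C * 0 * ?S" by (intro tendsto_intros)
  then have "(\<lambda>n. C * (q ^ n) powr \<theta> * ?S) \<longlonglongrightarrow> 0" by simp
  then have "(\<lambda>n. Weyl_sum \<alpha> f (q ^ n) - Weyl_sum \<alpha> f 0) \<longlonglongrightarrow> 0"
    by (rule Lim_null_comparison[rotated]) (simp add: bound L_power L_q)
  then show ?thesis by (simp add: LIM_zero_iff)
qed

text \<open>
  The \<open>F\<^bsub>-1/2\<^esub>\<close>-transform of the left-hand side is the \<open>F\<^sub>\<alpha>\<close>-transform of a kernel, which by orthogonality is
  supported at the single point \<open>k\<close>. Inverting it leaves a multiple of the kernel for the index \<open>-1/2\<close>.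
\<close>

lemma Weyl_qBessel:
  assumes a: "- 1 / 2 < \<alpha>" and k: "k \<in> L" and x: "x \<in> insert 0 L"
  shows "Weyl_sum \<alpha> (\<lambda>t. cx (j \<alpha> (k * t))) x
    = cx (beta_const \<alpha> * j_norm \<alpha> / j_norm (- 1 / 2) * k powr - (2 * \<alpha> + 1) * j (- 1 / 2) (k * x))"
proof -
  let ?u = "\<lambda>t. cx (j \<alpha> (k * t))"
  have b: "- 1 < \<alpha>" "- 1 < (- 1 / 2 :: real)" using a by auto
  have mu: "mellin s ?u" if "0 < s" for s
    using mellin_qBessel[OF b(1) k that] unfolding mellin_def by simp
  have N: "j_norm (- 1 / 2) \<noteq> 0" using qF_factor_sq[OF b(2)] q_pos by auto
  have k0: "0 < k" using L_pos[OF k] .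
  have pos: "Weyl_sum \<alpha> ?u x
      = cx (beta_const \<alpha> * j_norm \<alpha> / j_norm (- 1 / 2) * k powr - (2 * \<alpha> + 1) * j (- 1 / 2) (k * x))"
    if x: "x \<in> L" for x
  proof -
    have "mellin 1 (Weyl_sum \<alpha> ?u)" by (rule mellin_Weyl_sum[OF a _ mu]) (use a in auto)
    then have "cx (j_norm (- 1 / 2)) * Weyl_sum \<alpha> ?u x = hankel (- 1 / 2) (hankel (- 1 / 2) (Weyl_sum \<alpha> ?u)) x"
      using hankel_hankel[OF b(2), of 1 "Weyl_sum \<alpha> ?u" x] x by simp
    also have "\<dots> = (\<Sum>\<^sub>\<infinity>m\<in>L. cx (beta_const \<alpha>) * hankel \<alpha> ?u m * cx (j (- 1 / 2) (x * m) * m))"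
      unfolding hankel_half[of "hankel (- 1 / 2) (Weyl_sum \<alpha> ?u)"]
      by (rule infsum_cong) (subst hankel_Weyl[OF a mu], use a in auto)
    also have "\<dots> = (\<Sum>\<^sub>\<infinity>m\<in>{k}. cx (beta_const \<alpha>) * hankel \<alpha> ?u m * cx (j (- 1 / 2) (x * m) * m))"
      by (rule infsum_cong_neutral) (use k hankel_qBessel[OF b(1) k] in auto)
    also have "\<dots> = cx (beta_const \<alpha> * j_norm \<alpha> * (k powr - (2 * \<alpha> + 2) * k) * j (- 1 / 2) (k * x))"
      using hankel_qBessel[OF b(1) k k] by (simp add: mult_ac)
    also have "k powr - (2 * \<alpha> + 2) * k = k powr - (2 * \<alpha> + 1)"
    proof -
      have "k powr - (2 * \<alpha> + 2) * k powr 1 = k powr - (2 * \<alpha> + 1)"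
        by (simp only: powr_add[symmetric]) (simp add: algebra_simps)
      then show ?thesis using k0 by simp
    qed
    finally show ?thesis using N by (simp add: field_simps)
  qed
  show ?thesis
  proof (cases "x = 0")
    case False
    then show ?thesis using pos x by blast
  next
    case True
    \<comment> \<open>the value at \<open>0\<close> is the limit along the lattice; \<open>\<theta>\<close> has to stay below \<open>2 \<alpha> + 1\<close>\<close>
    define \<theta> where "\<theta> = min 1 ((2 * \<alpha> + 1) / 2)"
    have th: "0 < \<theta>" "\<theta> \<le> 2" "0 < 2 * \<alpha> + 1" "0 < 2 * \<alpha> + 1 - \<theta>" using a by (auto simp: \<theta>_def min_def)
    let ?K = "beta_const \<alpha> * j_norm \<alpha> / j_norm (- 1 / 2) * k powr - (2 * \<alpha> + 1)"
    obtain C where C: "C \<ge> 0" "\<And>x. x \<in> L \<Longrightarrow> \<bar>j (- 1 / 2) x - 1\<bar> \<le> C * x\<^sup>2" using qBessel_near_0[OF b(2)] by blast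
    have "(\<lambda>n. C * (k * q ^ n)\<^sup>2) \<longlonglongrightarrow> C * (k * 0)\<^sup>2" by (intro tendsto_intros q_powers_tendsto_0)
    then have "(\<lambda>n. C * (k * q ^ n)\<^sup>2) \<longlonglongrightarrow> 0" by simp
    then have "(\<lambda>n. j (- 1 / 2) (k * q ^ n) - 1) \<longlonglongrightarrow> 0"
      by (rule Lim_null_comparison[rotated])
         (intro always_eventually allI, unfold real_norm_def, rule C(2), intro L_mult k L_power L_q)
    then have "(\<lambda>n. j (- 1 / 2) (k * q ^ n)) \<longlonglongrightarrow> 1" by (simp add: LIM_zero_iff)
    then have "(\<lambda>n. cx (?K * j (- 1 / 2) (k * q ^ n))) \<longlonglongrightarrow> cx (?K * 1)"
      by (intro tendsto_intros)
    moreover have "Weyl_sum \<alpha> ?u (q ^ n) = cx (?K * j (- 1 / 2) (k * q ^ n))" for n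
      by (rule pos) (simp add: L_power L_q)
    ultimately have "(\<lambda>n. Weyl_sum \<alpha> ?u (q ^ n)) \<longlonglongrightarrow> cx (?K * 1)" by simp
    then have "Weyl_sum \<alpha> ?u 0 = cx (?K * 1)"
      using LIMSEQ_unique Weyl_tendsto_0[OF a th(1,2) mu[OF th(3)] mu[OF th(4)]] by blast
    then show ?thesis using True by simp
  qed
qed

text \<open>
  A Hankel transform superposes kernels, and the Weyl transform of each kernel is known.
\<close>

lemma Weyl_hankel:
  assumes a: "- 1 / 2 < \<alpha>" and G: "mellin 1 G" and x: "x \<in> insert 0 L"
  shows "Weyl_sum \<alpha> (hankel \<alpha> G) x = cx (beta_const \<alpha> * j_norm \<alpha> / j_norm (- 1 / 2)) * hankel (- 1 / 2) G x"
proof -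
  let ?c = "cx (beta_const \<alpha> * j_norm \<alpha> / j_norm (- 1 / 2))"
  let ?A = "Aq \<alpha>" and ?w = "2 * \<alpha> + 2"
  have A: "0 \<le> Aq \<alpha>" "Aq \<alpha> < 1" using Aq_bounds[OF a] by auto
  have b: "- 1 < \<alpha>" using a by auto
  define M where "M = 1 / poch2_inf ?A"
  have M: "0 \<le> M" using poch2_inf_pos[OF A] by (simp add: M_def)
  let ?F = "\<lambda>k t. cx (weight ?A (x / t) * t powr (2 * \<alpha> + 1)) * (G k * cx (j \<alpha> (t * k) * k powr ?w))"
  have sum: "(\<lambda>(k, t). ?F k t) summable_on L \<times> L"
  proof (rule abs_summable_summable, rule Infinite_Sum.abs_summable_on_comparison_test')
    show "(\<lambda>(k, t). (M * (norm (G k) * k powr ?w)) * (norm (j \<alpha> (t * k)) * t powr (2 * \<alpha> + 1))) summable_on L \<times> L"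
    proof (rule summable_mellin_convolution)
      \<comment> \<open>summing the kernel over \<open>t\<close> at this exponent leaves the Mellin sum of \<open>G\<close> at \<open>1\<close>\<close>
      show "mellin (2 * \<alpha> + 1) (j \<alpha>)" using mellin_qBessel[OF b L_one] a by simp
      have "(\<lambda>k. M * (norm (G k) * k powr 1)) summable_on L"
        using G unfolding mellin_def by (rule summable_on_cmult_right)
      then show "(\<lambda>k. M * (norm (G k) * k powr ?w) * k powr - (2 * \<alpha> + 1)) summable_on L"
        by (simp only: mult.assoc powr_add[symmetric]) simp
    qed (use M in auto)
    fix z assume "z \<in> L \<times> L"
    then obtain k t where z: "z = (k, t)" and kt: "k \<in> L" "t \<in> L" by auto
    have "x / t \<in> insert 0 L" using x kt L_divide by auto
    from mult_right_mono[OF weight_bounded[OF A this], of "t powr (2 * \<alpha> + 1)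
        * (norm (G k) * (\<bar>j \<alpha> (t * k)\<bar> * k powr ?w))"]
    show "norm (case z of (k, t) \<Rightarrow> ?F k t)
        \<le> (case z of (k, t) \<Rightarrow> (M * (norm (G k) * k powr ?w)) * (norm (j \<alpha> (t * k)) * t powr (2 * \<alpha> + 1)))"
      by (simp add: z M_def norm_mult abs_mult mult_ac)
  qed
  have "Weyl_sum \<alpha> (hankel \<alpha> G) x = (\<Sum>\<^sub>\<infinity>t\<in>L. \<Sum>\<^sub>\<infinity>k\<in>L. ?F k t)"
    unfolding Weyl_sum_def hankel_def infsum_cmult_right' ..
  also have "\<dots> = (\<Sum>\<^sub>\<infinity>k\<in>L. \<Sum>\<^sub>\<infinity>t\<in>L. ?F k t)" by (rule infsum_swap_banach[OF sum, symmetric])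
  also have "\<dots> = (\<Sum>\<^sub>\<infinity>k\<in>L. ?c * (G k * cx (j (- 1 / 2) (x * k) * k)))"
  proof (rule infsum_cong)
    fix k assume k: "k \<in> L"
    have "(\<Sum>\<^sub>\<infinity>t\<in>L. ?F k t)
        = (\<Sum>\<^sub>\<infinity>t\<in>L. (G k * cx (k powr ?w)) * (cx (weight ?A (x / t) * t powr (2 * \<alpha> + 1)) * cx (j \<alpha> (k * t))))"
      by (intro infsum_cong) (simp add: mult_ac)
    also have "\<dots> = (G k * cx (k powr ?w)) * Weyl_sum \<alpha> (\<lambda>t. cx (j \<alpha> (k * t))) x"
      unfolding infsum_cmult_right' Weyl_sum_def ..
    also have "\<dots> = (G k * cx (k powr ?w)) * cx (beta_const \<alpha> * j_norm \<alpha> / j_norm (- 1 / 2) * k powr - (2 * \<alpha>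
        + 1) * j (- 1 / 2) (k * x))"
      unfolding Weyl_qBessel[OF a k x] ..
    also have "\<dots> = ?c * (G k * cx (j (- 1 / 2) (x * k) * (k powr ?w * k powr - (2 * \<alpha> + 1))))"
      by (simp only: of_real_mult mult_ac)
    also have "k powr ?w * k powr - (2 * \<alpha> + 1) = k"
      using L_pos[OF k] by (simp only: powr_add[symmetric]) simp
    finally show "(\<Sum>\<^sub>\<infinity>t\<in>L. ?F k t) = ?c * (G k * cx (j (- 1 / 2) (x * k) * k))" .
  qed
  also have "\<dots> = ?c * hankel (- 1 / 2) G x"
    unfolding infsum_cmult_right' hankel_half ..
  finally show ?thesis .
qed

lemma RL_hankel:
  assumes a: "- 1 / 2 < \<alpha>" and P: "mellin 1 P" and x: "x \<in> insert 0 L"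
  shows "RL_sum \<alpha> (hankel (- 1 / 2) P) x = cx (beta_const \<alpha>) * hankel \<alpha> (\<lambda>k. cx (k powr - (2 * \<alpha> + 1)) * P k) x"
proof -
  let ?A = "Aq \<alpha>"
  obtain B where B: "B \<ge> 1" "\<And>x. x \<in> insert 0 L \<Longrightarrow> \<bar>j (- 1 / 2) x\<bar> \<le> B"
    using qBessel_bounded[OF minus_half_gt] by blast
  let ?F = "\<lambda>t k. cx (weight ?A t * t) * (P k * cx (j (- 1 / 2) (x * t * k) * k))"
  have sum: "(\<lambda>(t, k). ?F t k) summable_on L \<times> L"
  proof (rule summable_on_product_majorant)
    show "(\<lambda>t. norm (weight ?A t) * t powr 1) summable_on L" using mellin_weight[OF a, of 1]
      unfolding mellin_def by simp
    show "(\<lambda>k. B * (norm (P k) * k powr 1)) summable_on L" using P unfolding mellin_def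
      by (rule summable_on_cmult_right)
    fix t k assume tk: "t \<in> L" "k \<in> L"
    have "x * t * k \<in> insert 0 L" using x tk L_mult by auto
    from mult_left_mono[OF B(2)[OF this], of "norm (weight ?A t) * t * (norm (P k) * k)"]
    show "norm (?F t k) \<le> norm (weight ?A t) * t powr 1 * (B * (norm (P k) * k powr 1))"
      using L_pos[OF tk(1)] L_pos[OF tk(2)] by (simp add: norm_mult abs_mult mult_ac)
  qed (use B in auto)
  have "RL_sum \<alpha> (hankel (- 1 / 2) P) x = (\<Sum>\<^sub>\<infinity>t\<in>L. \<Sum>\<^sub>\<infinity>k\<in>L. ?F t k)"
    unfolding RL_sum_def hankel_half infsum_cmult_right' ..
  also have "\<dots> = (\<Sum>\<^sub>\<infinity>k\<in>L. \<Sum>\<^sub>\<infinity>t\<in>L. ?F t k)" by (rule infsum_swap_banach[OF sum])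
  also have "\<dots> = (\<Sum>\<^sub>\<infinity>k\<in>L. cx (beta_const \<alpha>) * ((cx (k powr - (2 * \<alpha> + 1)) * P k)
      * cx (j \<alpha> (x * k) * k powr (2 * \<alpha> + 2))))"
  proof (rule infsum_cong)
    fix k assume k: "k \<in> L"
    have kk: "k = k powr - (2 * \<alpha> + 1) * k powr (2 * \<alpha> + 2)"
      using L_pos[OF k] by (simp only: powr_add[symmetric]) simp
    have "(\<Sum>\<^sub>\<infinity>t\<in>L. ?F t k) = (\<Sum>\<^sub>\<infinity>t\<in>L. (P k * cx k) * cx (weight ?A t * (j (- 1 / 2) ((x * k) * t) * t)))"
      by (intro infsum_cong) (simp add: mult_ac)
    also have "\<dots> = (P k * cx k) * cx (beta_const \<alpha> * j \<alpha> (x * k))"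
      unfolding infsum_cmult_right' infsum_complex_of_real RL_qBessel[OF a] ..
    also have "cx k = cx (k powr - (2 * \<alpha> + 1)) * cx (k powr (2 * \<alpha> + 2))"
      unfolding of_real_mult[symmetric] kk[symmetric] ..
    finally show "(\<Sum>\<^sub>\<infinity>t\<in>L. ?F t k)
        = cx (beta_const \<alpha>) * ((cx (k powr - (2 * \<alpha> + 1)) * P k) * cx (j \<alpha> (x * k) * k powr (2 * \<alpha> + 2)))"
      by (simp only: of_real_mult mult_ac)
  qed
  also have "\<dots> = cx (beta_const \<alpha>) * hankel \<alpha> (\<lambda>k. cx (k powr - (2 * \<alpha> + 1)) * P k) x"
    unfolding infsum_cmult_right' hankel_def ..
  finally show ?thesis .
qed

section \<open>Wavelet transforms on the transform side\<close>

lemma qRL_cong: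
  assumes "\<And>y. y \<in> insert 0 L \<Longrightarrow> f y = g y" and x: "x \<in> insert 0 L"
  shows "qRL q \<alpha> f x = qRL q \<alpha> g x"
proof -
  have "f (x * q ^ n) = g (x * q ^ n)" for n
    using x by (intro assms(1)) (auto intro!: L_mult L_power L_q)
  then show ?thesis unfolding qRL_def jackson_upto_def by simp
qed

lemma qWeyl_cong:
  assumes "\<And>y. y \<in> L \<Longrightarrow> f y = g y" and x: "x \<in> insert 0 L"
  shows "qWeyl q \<alpha> f x = qWeyl q \<alpha> g x"
  unfolding qWeyl_eq[OF x] Weyl_sum_def using infsum_cong[of L] assms(1) by (metis (no_types, lifting))

lemma mellin_qF: "mellin s (hankel \<beta> f) \<Longrightarrow> mellin s (qF q \<beta> f)"
  by (rule mellin_le[where G = "hankel \<beta> f" and C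
      = "\<bar>qF_factor \<beta>\<bar>"]) (simp_all only: qF_eq norm_mult norm_of_real order_refl)

lemma qF_bounded:
  assumes "- 1 < \<beta>" "mellin (2 * \<beta> + 2) f"
  shows "\<exists>C\<ge>0. \<forall>y\<in>insert 0 L. norm (qF q \<beta> f y) \<le> C"
proof -
  obtain C where C: "C \<ge> 0" "\<And>y. y \<in> insert 0 L \<Longrightarrow> norm (hankel \<beta> f y) \<le> C" using hankel_bounded[OF assms] by blast
  have "norm (qF q \<beta> f y) \<le> \<bar>qF_factor \<beta>\<bar> * C" if "y \<in> insert 0 L" for y
    using mult_left_mono[OF C(2)[OF that], of "\<bar>qF_factor \<beta>\<bar>"] by (simp only: qF_eq norm_mult norm_of_real)
  then show ?thesis using C(1) by (intro exI[of _ "\<bar>qF_factor \<beta>\<bar> * C"]) auto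
qed

lemma qF_qWeyl:
  assumes a: "- 1 / 2 < \<alpha>" and f: "mellin (2 * \<alpha> + 2) f" and y: "y \<in> insert 0 L"
  shows "qF q (- 1 / 2) (qWeyl q \<alpha> f) y = qF q \<alpha> f y"
proof -
  have "qF q (- 1 / 2) (qWeyl q \<alpha> f) y = qF q (- 1 / 2) (\<lambda>x. cx (Weyl_const \<alpha> * (1 - q)) * Weyl_sum \<alpha> f x) y"
    by (rule qF_cong) (simp add: qWeyl_eq)
  also have "\<dots> = cx (qF_factor (- 1 / 2) * (Weyl_const \<alpha> * (1 - q)) * beta_const \<alpha>) * hankel \<alpha> f y"
    unfolding qF_cmult qF_eq hankel_Weyl[OF a f y] by (simp only: of_real_mult mult_ac)
  finally show ?thesis unfolding Weyl_const_beta[OF a] qF_eq[of \<alpha>] .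
qed

lemma mellin_qWeyl:
  assumes a: "- 1 / 2 < \<alpha>" and s: "0 < s" and f: "mellin (s + (2 * \<alpha> + 1)) f"
  shows "mellin s (qWeyl q \<alpha> f)"
  by (rule mellin_le[where C = "\<bar>Weyl_const \<alpha> * (1 - q)\<bar>", OF mellin_Weyl_sum[OF a s f]])
     (simp only: qWeyl_eq insertI2 norm_mult norm_of_real order_refl)

text \<open>
  The constants match since \<open>F\<^sub>\<beta>\<close> applied twice is \<open>q\<^bsup>4\<beta>+2\<^esup>\<close>, which is \<open>1\<close> for \<open>\<beta> = -1/2\<close>.
\<close>

lemma qWeyl_qF_inv:
  assumes a: "- 1 / 2 < \<alpha>" and G: "mellin 1 G" and x: "x \<in> insert 0 L"
  shows "qWeyl q \<alpha> (qF_inv q \<alpha> G) x = qF_inv q (- 1 / 2) G x"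
proof -
  have b: "- 1 < \<alpha>" using a by simp
  define E where "E = q powr (- 4 * \<alpha> - 2)"
  have "qWeyl q \<alpha> (qF_inv q \<alpha> G) x
      = cx (Weyl_const \<alpha> * (1 - q)) * Weyl_sum \<alpha> (\<lambda>t. cx (E * qF_factor \<alpha>) * hankel \<alpha> G t) x"
    unfolding qWeyl_eq[OF x] qF_inv_def E_def qF_eq by (simp add: mult.assoc)
  also have "\<dots> = cx (Weyl_const \<alpha> * (1 - q) * (E * qF_factor \<alpha>)) * Weyl_sum \<alpha> (hankel \<alpha> G) x"
    unfolding Weyl_sum_def mult.left_commute[of _ "cx (E * qF_factor \<alpha>)"] infsum_cmult_right'
      by (simp only: of_real_mult mult_ac)
  also have "\<dots> = cx (Weyl_const \<alpha> * (1 - q) * (E * qF_factor \<alpha>)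
      * (beta_const \<alpha> * j_norm \<alpha> / j_norm (- 1 / 2))) * hankel (- 1 / 2) G x"
    unfolding Weyl_hankel[OF a G x] by (simp only: of_real_mult mult_ac)
  also have "Weyl_const \<alpha> * (1 - q) * (E * qF_factor \<alpha>) * (beta_const \<alpha> * j_norm \<alpha> / j_norm (- 1 / 2))
      = qF_factor (- 1 / 2)"
  proof -
    define u v c where "u = qF_factor (- 1 / 2)" and "v = qF_factor \<alpha>" and "c = Weyl_const \<alpha> * (1 - q)"
    have u: "0 < u" using qF_factor_pos[OF minus_half_gt] by (simp only: u_def)
    have 1: "u * c * beta_const \<alpha> = v" using Weyl_const_beta[OF a] by (simp only: u_def v_def c_def)
    have 2: "E * (v\<^sup>2 * j_norm \<alpha>) = 1"
    proof -
      have "E * q powr (4 * \<alpha> + 2) = 1" using q_pos by (simp add: E_def powr_add[symmetric])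
      then show ?thesis using qF_factor_sq[OF b] by (simp only: v_def)
    qed
    have "u\<^sup>2 * j_norm (- 1 / 2) = q powr (4 * (- 1 / 2) + 2)" using qF_factor_sq[OF minus_half_gt]
      by (simp only: u_def)
    then have 3: "u\<^sup>2 * j_norm (- 1 / 2) = 1" using q_pos by simp
    have "u * (c * (E * v) * (beta_const \<alpha> * j_norm \<alpha> / j_norm (- 1 / 2)))
        = (u * c * beta_const \<alpha>) * (E * v) * j_norm \<alpha> / j_norm (- 1 / 2)" by simp
    also have "\<dots> = (E * (v\<^sup>2 * j_norm \<alpha>)) / j_norm (- 1 / 2)" unfolding 1 by (simp add: power2_eq_square)
    also have "\<dots> = (u\<^sup>2 * j_norm (- 1 / 2)) / j_norm (- 1 / 2)" unfolding 2 3 ..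
    also have "\<dots> = u * u"
    proof -
      have "j_norm (- 1 / 2) \<noteq> 0" using 3 by (metis mult_zero_right zero_neq_one)
      then show ?thesis by (simp only: nonzero_mult_div_cancel_right power2_eq_square not_False_eq_True)
    qed
    finally have "c * (E * v) * (beta_const \<alpha> * j_norm \<alpha> / j_norm (- 1 / 2)) = u"
      using u mult_cancel_left[of u _ u] by blast
    then show ?thesis by (simp only: u_def v_def c_def)
  qed
  also have "cx (qF_factor (- 1 / 2)) * hankel (- 1 / 2) G x = qF_inv q (- 1 / 2) G x"
    unfolding qF_inv_def qF_eq using q_pos by simp
  finally show ?thesis .
qed

lemma qRL_qF_inv:
  assumes a: "- 1 / 2 < \<alpha>" and P: "mellin 1 P" and x: "x \<in> insert 0 L"
  shows "qRL q \<alpha> (qF_inv q (- 1 / 2) P) x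
    = cx (qF_factor (- 1 / 2) / qF_factor \<alpha>) * qF q \<alpha> (\<lambda>k. cx (k powr - (2 * \<alpha> + 1)) * P k) x"
proof -
  let ?Q = "\<lambda>k. cx (k powr - (2 * \<alpha> + 1)) * P k"
  have b: "- 1 < \<alpha>" using a by simp
  define u where "u = qF_factor (- 1 / 2)"
  have inv: "qF_inv q (- 1 / 2) P = (\<lambda>y. cx u * hankel (- 1 / 2) P y)"
    unfolding qF_inv_def[abs_def] qF_eq u_def using q_pos by simp
  obtain C where C: "C \<ge> 0" "\<And>y. y \<in> insert 0 L \<Longrightarrow> norm (hankel (- 1 / 2) P y) \<le> C"
    using hankel_bounded[OF minus_half_gt] P unfolding two_half_plus_two by blast
  have "qRL q \<alpha> (qF_inv q (- 1 / 2) P) x = cx (RL_const \<alpha> * (1 - q)) * RL_sum \<alpha> (\<lambda>y. cx u * hankel (- 1 / 2) P y) x"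
    unfolding inv
  proof (rule qRL_eq, rule Infinite_Sum.abs_summable_on_comparison_test')
    show "(\<lambda>t. norm (weight (Aq \<alpha>) t) * t powr 1 * (\<bar>u\<bar> * C)) summable_on L"
      using mellin_weight[OF a, of 1] unfolding mellin_def by (intro summable_on_cmult_left) simp
    fix t assume t: "t \<in> L"
    have "x * t \<in> insert 0 L" using x t L_mult by auto
    from mult_left_mono[OF C(2)[OF this], of "norm (weight (Aq \<alpha>) t) * t * \<bar>u\<bar>"]
    show "norm (cx (weight (Aq \<alpha>) t * t) * (cx u * hankel (- 1 / 2) P (x * t)))
        \<le> norm (weight (Aq \<alpha>) t) * t powr 1 * (\<bar>u\<bar> * C)"
      using L_pos[OF t] by (simp add: norm_mult abs_mult mult_ac)
  qed
  also have "\<dots> = cx (RL_const \<alpha> * (1 - q) * u) * RL_sum \<alpha> (hankel (- 1 / 2) P) x"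
    unfolding RL_sum_def mult.left_commute[of _ "cx u"] infsum_cmult_right' by (simp only: of_real_mult mult_ac)
  also have "\<dots> = cx (RL_const \<alpha> * (1 - q) * beta_const \<alpha> * u) * hankel \<alpha> (?Q) x"
    unfolding RL_hankel[OF a P x] by (simp only: of_real_mult mult_ac)
  also have "\<dots> = cx (u / qF_factor \<alpha>) * qF q \<alpha> (?Q) x"
  proof -
    have "cx (1 * u) * h = cx (u / v) * (cx v * h)" if "0 < v" for v h
      using that by simp
    from this[OF qF_factor_pos[OF b]] show ?thesis unfolding RL_const_beta[OF a] qF_eq .
  qed
  finally show ?thesis unfolding u_def .
qed

lemma jackson_cmult: "jackson q (\<lambda>x. c * h x) = (c::complex) * jackson q h"
  unfolding jackson_eq by (simp add: mult_scaleR_right[symmetric] infsum_cmult_right' del: mult_scaleR_right)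

lemma jackson_cong: "(\<And>x. x \<in> L \<Longrightarrow> f x = g x) \<Longrightarrow> jackson q f = jackson q g"
  unfolding jackson_eq using infsum_cong[of L "\<lambda>x. x *\<^sub>R f x" "\<lambda>x. x *\<^sub>R g x"] by simp

text \<open>
  The translate of \<open>G\<close> is the inverse transform of \<open>k \<mapsto> j\<^sub>\<beta> (k x\<^sub>0) F\<^sub>\<beta> G k\<close>. Parseval's formula moves the
  inverse transform to \<open>f\<close>, and the factor \<open>j\<^sub>\<beta> (k x\<^sub>0)\<close> is the kernel of the transform on the right.
\<close>

lemma translate_inner_product:
  assumes b: "- 1 < \<beta>" and s: "s \<le> 2 * \<beta> + 2" and f: "mellin s f"
    and Y: "mellin s (\<lambda>k. cx (j \<beta> (k * x0)) * qF q \<beta> G k)"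
  shows "cx (qF_const q \<beta>) * jackson q (\<lambda>x. f x * cnj (qtrans q \<beta> x0 G x) * cx (x powr (2 * \<beta> + 1)))
    = qF_inv q \<beta> (\<lambda>k. qF q \<beta> f k * cnj (qF q \<beta> G k)) x0"
proof -
  let ?Y = "\<lambda>k. cx (j \<beta> (k * x0)) * qF q \<beta> G k" and ?w = "2 * \<beta> + 2"
  let ?J = "jackson q (\<lambda>x. f x * cnj (qtrans q \<beta> x0 G x) * cx (x powr (2 * \<beta> + 1)))"
  let ?P = "\<lambda>k. qF q \<beta> f k * cnj (qF q \<beta> G k)"
  let ?I = "\<lambda>x. f x * cnj (hankel \<beta> ?Y x) * cx (x powr ?w)"
  let ?K = "\<lambda>k. hankel \<beta> f k * cnj (?Y k) * cx (k powr ?w)"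
  define E where "E = q powr (- 4 * \<beta> - 2)"
  have tr: "qtrans q \<beta> x0 G x = cx (E * qF_factor \<beta>) * hankel \<beta> ?Y x" for x
    unfolding qtrans_def qF_inv_def qF_eq[of \<beta> ?Y] E_def by simp
  have "?J
      = cx (1 - q) * (\<Sum>\<^sub>\<infinity>x\<in>L. cx (E * qF_factor \<beta>) * ?I x)"
  proof -
    have "(\<Sum>\<^sub>\<infinity>x\<in>L. x *\<^sub>R (f x * cnj (qtrans q \<beta> x0 G x) * cx (x powr (2 * \<beta> + 1))))
      = (\<Sum>\<^sub>\<infinity>x\<in>L. cx (E * qF_factor \<beta>) * ?I x)"
    proof (rule infsum_cong)
      fix x assume "x \<in> L"
      from L_powr_Suc[OF this, of \<beta>] have "cx (x powr ?w) = cx x * cx (x powr (2 * \<beta> + 1))"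
        by (simp flip: of_real_mult)
      then show "x *\<^sub>R (f x * cnj (qtrans q \<beta> x0 G x) * cx (x powr (2 * \<beta> + 1))) = cx (E * qF_factor \<beta>) * ?I x"
        unfolding tr complex_cnj_mult complex_cnj_complex_of_real scaleR_conv_of_real by (simp only: mult_ac)
    qed
    then show ?thesis unfolding jackson_eq by (simp add: scaleR_conv_of_real)
  qed
  also have "\<dots> = cx (1 - q) * (cx (E * qF_factor \<beta>) * (\<Sum>\<^sub>\<infinity>k\<in>L. ?K k))"
    unfolding infsum_cmult_right' hankel_parseval[OF b s f Y] ..
  finally have lhs: "cx (qF_const q \<beta>) * ?J
    = cx (E * qF_factor \<beta> * qF_factor \<beta>) * (\<Sum>\<^sub>\<infinity>k\<in>L. ?K k)"
    by (simp only: of_real_mult mult_ac)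
  have "qF_inv q \<beta> ?P x0
    = cx (E * qF_factor \<beta>) * (\<Sum>\<^sub>\<infinity>k\<in>L. cx (qF_factor \<beta>) * ?K k)"
  proof -
    have "hankel \<beta> ?P x0 = (\<Sum>\<^sub>\<infinity>k\<in>L. cx (qF_factor \<beta>) * ?K k)"
      unfolding hankel_def[of \<beta> ?P] unfolding qF_eq[of \<beta> f]
      by (intro infsum_cong) (simp add: mult_ac)
    then show ?thesis unfolding qF_inv_def qF_eq[of \<beta> ?P] E_def by simp
  qed
  then show ?thesis unfolding lhs infsum_cmult_right' by (simp only: of_real_mult mult_ac)
qed

lemma qF_dilate:
  assumes a: "a \<in> L"
  shows "qF q \<beta> (\<lambda>x. c * g (x / a)) k = c * cx (a powr (2 * \<beta> + 2)) * qF q \<beta> g (a * k)"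
proof -
  have "hankel \<beta> (\<lambda>x. g (x / a)) k = (\<Sum>\<^sub>\<infinity>x\<in>L. g (a * x / a) * cx (j \<beta> (k * (a * x)) * (a * x) powr (2 * \<beta> + 2)))"
    unfolding hankel_def by (rule infsum_L_scale[OF a, symmetric])
  also have "\<dots> = (\<Sum>\<^sub>\<infinity>x\<in>L. cx (a powr (2 * \<beta> + 2)) * (g x * cx (j \<beta> (a * k * x) * x powr (2 * \<beta> + 2))))"
  proof (rule infsum_cong)
    fix x assume "x \<in> L"
    then have "(a * x) powr (2 * \<beta> + 2) = a powr (2 * \<beta> + 2) * x powr (2 * \<beta> + 2)" "a * x / a
        = x" "k * (a * x) = a * k * x"
      using L_pos a L_nz[OF a] by (auto simp: powr_mult less_imp_le)
    then show "g (a * x / a) * cx (j \<beta> (k * (a * x)) * (a * x) powr (2 * \<beta> + 2))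
        = cx (a powr (2 * \<beta> + 2)) * (g x * cx (j \<beta> (a * k * x) * x powr (2 * \<beta> + 2)))"
      by (simp only: of_real_mult) (simp only: mult_ac)
  qed
  also have "\<dots> = cx (a powr (2 * \<beta> + 2)) * hankel \<beta> g (a * k)"
    unfolding infsum_cmult_right' hankel_def ..
  finally show ?thesis unfolding qF_cmult qF_eq by simp
qed

lemma qBessel_wavelet_transform_eq:
  assumes b: "- 1 < \<alpha>" and a: "a \<in> L" and s: "s \<le> 2 * \<alpha> + 2" and f: "mellin s f"
    and Y: "mellin s (\<lambda>k. cx (j \<alpha> (k * y)) * qF q \<alpha> g (a * k))"
  shows "qBessel_wavelet_transform q \<alpha> g f a y
    = qF_inv q \<alpha> (\<lambda>k. cx (sqrt a) * (qF q \<alpha> f k * cnj (qF q \<alpha> g (a * k)))) y"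
proof -
  let ?G = "\<lambda>y. cx (a powr (- 2 * \<alpha> - 2)) * g (y / a)"
  have "a powr (- 2 * \<alpha> - 2) * a powr (2 * \<alpha> + 2) = 1" using L_pos[OF a] by (simp add: powr_add[symmetric])
  then have G: "qF q \<alpha> ?G k = qF q \<alpha> g (a * k)" for k
    unfolding qF_dilate[OF a] of_real_mult[symmetric] by simp
  have "qBessel_wavelet_transform q \<alpha> g f a y = cx (qF_const q \<alpha>) *
     jackson q (\<lambda>x. cx (sqrt a) * (f x * cnj (qtrans q \<alpha> y ?G x) * cx (x powr (2 * \<alpha> + 1))))"
    unfolding qBessel_wavelet_transform_def qBessel_atom_def by (simp add: mult_ac)
  also have "\<dots> = cx (sqrt a) * (cx (qF_const q \<alpha>) *
     jackson q (\<lambda>x. f x * cnj (qtrans q \<alpha> y ?G x) * cx (x powr (2 * \<alpha> + 1))))"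
    unfolding jackson_cmult by (rule mult.left_commute)
  also have "\<dots> = cx (sqrt a) * qF_inv q \<alpha> (\<lambda>k. qF q \<alpha> f k * cnj (qF q \<alpha> ?G k)) y"
    by (subst translate_inner_product[OF b s f]) (simp_all only: G Y)
  finally show ?thesis unfolding G qF_inv_cmult .
qed

lemma q_wavelet_transform_eq:
  assumes a: "a \<in> L" and s: "s \<le> 1" and f: "mellin s f"
    and Y: "mellin s (\<lambda>k. cx (j (- 1 / 2) (k * y)) * qF q (- 1 / 2) h (a * k))"
  shows "q_wavelet_transform q h f a y
    = qF_inv q (- 1 / 2) (\<lambda>k. cx (sqrt a) * (qF q (- 1 / 2) f k * cnj (qF q (- 1 / 2) h (a * k)))) y"
proof -
  let ?F = "qF q (- 1 / 2)"
  let ?G = "\<lambda>y. cx (1 / sqrt a) * h (y / a)"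
  have a0: "0 < a" using L_pos[OF a] .
  have G: "?F ?G k = cx (sqrt a) * ?F h (a * k)" for k
  proof -
    have "1 / sqrt a * a powr (2 * (- 1 / 2) + 2) = sqrt a"
      unfolding two_half_plus_two using a0 by (simp add: real_div_sqrt)
    then show ?thesis unfolding qF_dilate[OF a] of_real_mult[symmetric] by (simp only:)
  qed
  have Y': "mellin s (\<lambda>k. cx (j (- 1 / 2) (k * y)) * ?F ?G k)"
    by (rule mellin_le[OF Y, of _ "sqrt a"]) (simp only: G norm_mult norm_of_real, use a0 in \<open>simp add: mult_ac\<close>)
  have "jackson q (\<lambda>x. f x * cnj (q_atom q h a y x))
      = jackson q (\<lambda>x. f x * cnj (qtrans q (- 1 / 2) y ?G x) * cx (x powr (2 * (- 1 / 2) + 1)))"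
    unfolding q_atom_def by (rule jackson_cong) (simp add: L_nz)
  then have "q_wavelet_transform q h f a y
      = cx (qF_const q (- 1 / 2)) * jackson q (\<lambda>x. f x * cnj (qtrans q (- 1 / 2) y ?G x)
      * cx (x powr (2 * (- 1 / 2) + 1)))"
    unfolding q_wavelet_transform_def by (simp only:)
  also have "\<dots> = qF_inv q (- 1 / 2) (\<lambda>k. ?F f k * cnj (?F ?G k)) y"
    by (rule translate_inner_product[OF minus_half_gt _ f Y']) (use s in simp)
  also have "\<dots> = qF_inv q (- 1 / 2) (\<lambda>k. cx (sqrt a) * (?F f k * cnj (?F h (a * k)))) y"
    unfolding G complex_cnj_mult complex_cnj_complex_of_real by (simp only: mult.left_commute)
  finally show ?thesis .
qed

lemma mellin_qBessel_mult:
  assumes b: "- 1 < \<beta>" and y: "y \<in> insert 0 L" and H: "mellin s H"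
  shows "mellin s (\<lambda>k. cx (j \<beta> (k * y)) * H k)"
proof -
  obtain B where B: "B \<ge> 1" "\<And>x. x \<in> insert 0 L \<Longrightarrow> \<bar>j \<beta> x\<bar> \<le> B" using qBessel_bounded[OF b] by blast
  show ?thesis
  proof (rule mellin_le[OF H])
    fix k assume "k \<in> L"
    then have "k * y \<in> insert 0 L" using y L_mult by auto
    from mult_right_mono[OF B(2)[OF this], of "norm (H k)"]
    show "norm (cx (j \<beta> (k * y)) * H k) \<le> B * norm (H k)" by (simp add: norm_mult)
  qed
qed

context
  fixes \<alpha> a b :: real and g :: "real \<Rightarrow> complex"
  assumes alpha_gt: "- 1 / 2 < \<alpha>" and g: "g \<in> Schwartz q" and a: "a \<in> L" and b: "b \<in> insert 0 L"
begin

lemma alpha_gt_minus_1: "- 1 < \<alpha>" using alpha_gt by simp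

lemma mellin_qF_g: "0 < t \<Longrightarrow> t < 2 * \<alpha> + 3 \<Longrightarrow> mellin t (qF q \<alpha> g)"
  by (rule mellin_qF[OF mellin_hankel_Schwartz[OF alpha_gt_minus_1 g]])

text \<open>
  Up to the constant \<open>\<kappa>\<close>, this is the common transform of \<open>K\<^sub>1 (W g)\<close> for \<open>F\<^bsub>-1/2\<^esub>\<close> and of
  \<open>K\<^sub>2 g\<close> for \<open>F\<^sub>\<alpha>\<close>.
\<close>

definition twisted :: "real \<Rightarrow> complex" where
  "twisted k = cx (k powr (2 * \<alpha> + 1)) * qF q \<alpha> g k"

lemma mellin_twisted: "- (2 * \<alpha> + 1) < t \<Longrightarrow> t < 2 \<Longrightarrow> mellin t twisted"
  using mellin_powr_shift[of t "qF q \<alpha> g" "2 * \<alpha> + 1"] mellin_qF_g[of "t + (2 * \<alpha> + 1)"]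
  unfolding twisted_def[abs_def] by (simp add: mult.commute)

lemma twisted_scale: "k \<in> L \<Longrightarrow> twisted (a * k) = cx (a powr (2 * \<alpha> + 1) * k powr (2 * \<alpha> + 1)) * qF q \<alpha> g (a * k)"
  using L_pos[of k] L_pos[OF a] by (simp add: twisted_def powr_mult less_imp_le)

lemma qWeyl_g_transform: "y \<in> insert 0 L \<Longrightarrow> qF q (- 1 / 2) (qWeyl q \<alpha> g) y = qF q \<alpha> g y"
  by (rule qF_qWeyl[OF alpha_gt mellin_Schwartz[OF g]]) (use alpha_gt in auto)

lemma qF_qK1:
  assumes k: "k \<in> L"
  shows "qF q (- 1 / 2) ((qK1 q \<alpha> \<circ> qWeyl q \<alpha>) g) k = cx (qkappa q \<alpha>) * twisted k"
proof -
  have "(qK1 q \<alpha> \<circ> qWeyl q \<alpha>) g x = cx (qkappa q \<alpha>) * qF_inv q (- 1 / 2) twisted x" for x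
    unfolding o_def qK1_def
    by (rule arg_cong[where f = "\<lambda>u. cx (qkappa q \<alpha>) * u"], rule qF_inv_cong)
       (simp only: twisted_def qWeyl_g_transform insertI2 abs_of_pos[OF L_pos])
  then have "qF q (- 1 / 2) ((qK1 q \<alpha> \<circ> qWeyl q \<alpha>) g) k
      = cx (qkappa q \<alpha>) * qF q (- 1 / 2) (qF_inv q (- 1 / 2) twisted) k"
    unfolding qF_cmult[symmetric] by (intro qF_cong)
  also have "qF q (- 1 / 2) (qF_inv q (- 1 / 2) twisted) k = twisted k"
    by (rule qF_qF_inv(1)[OF minus_half_gt mellin_twisted _ _ k, of 1]) (use alpha_gt in auto)
  finally show ?thesis .
qed

lemma qF_qK2:
  assumes k: "k \<in> L"
  shows "qF q \<alpha> (qK2 q \<alpha> g) k = cx (qkappa q \<alpha>) * twisted k"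
proof -
  have "qK2 q \<alpha> g x = cx (qkappa q \<alpha>) * qF_inv q \<alpha> twisted x" for x
    unfolding qK2_def
    by (rule arg_cong[where f = "\<lambda>u. cx (qkappa q \<alpha>) * u"], rule qF_inv_cong)
       (simp only: twisted_def abs_of_pos[OF L_pos])
  then have "qF q \<alpha> (qK2 q \<alpha> g) k = cx (qkappa q \<alpha>) * qF q \<alpha> (qF_inv q \<alpha> twisted) k"
    unfolding qF_cmult[symmetric] by (intro qF_cong)
  also have "qF q \<alpha> (qF_inv q \<alpha> twisted) k = twisted k"
    by (rule qF_qF_inv(1)[OF alpha_gt_minus_1 mellin_twisted _ _ k, of 1]) (use alpha_gt in auto)
  finally show ?thesis .
qed

lemma qkappa_ratio: "cx (qF_factor (- 1 / 2) / qF_factor \<alpha>) * cx (qkappa q \<alpha>) = cx (q powr (- 4 * \<alpha> - 2))"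
  unfolding of_real_mult[symmetric] using qkappa_eq[OF alpha_gt] by (simp only: mult.commute)

lemma qF_g_bounded: "\<exists>C\<ge>0. \<forall>y\<in>insert 0 L. norm (qF q \<alpha> g y) \<le> C"
  by (rule qF_bounded[OF alpha_gt_minus_1 mellin_Schwartz[OF g]]) (use alpha_gt in auto)

lemma mellin_cnj_qF_g_mult:
  assumes "mellin s H" shows "mellin s (\<lambda>k. H k * cnj (qF q \<alpha> g (a * k)))"
proof -
  obtain C where C: "C \<ge> 0" "\<And>y. y \<in> insert 0 L \<Longrightarrow> norm (qF q \<alpha> g y) \<le> C" using qF_g_bounded by blast
  show ?thesis
  proof (rule mellin_le[OF assms])
    fix k assume "k \<in> L"
    then have "a * k \<in> insert 0 L" using a L_mult by auto
    from mult_right_mono[OF C(2)[OF this], of "norm (H k)"]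
    show "norm (H k * cnj (qF q \<alpha> g (a * k))) \<le> C * norm (H k)" by (simp add: norm_mult mult.commute)
  qed
qed

text \<open>
  On the transform side the \<open>q\<close>-wavelet transform is a multiple of \<open>k\<^bsup>2\<alpha>+1\<^esup> F\<^sub>\<alpha> f k * cnj (F\<^sub>\<alpha> g (a k))\<close>, and
  the Riemann-Liouville transform removes the power of \<open>k\<close>.
\<close>

lemma wavelet_identity_RL:
  assumes f: "f \<in> Schwartz q"
  shows "qBessel_wavelet_transform q \<alpha> g f a b =
            cx (1 / a powr (2 * \<alpha> + 1)) *
            qRL q \<alpha> (\<lambda>y. q_wavelet_transform q ((qK1 q \<alpha> \<circ> qWeyl q \<alpha>) g) (qWeyl q \<alpha> f) a y) b"
proof -
  let ?F = "qF q (- 1 / 2)" and ?G = "qF q \<alpha>"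
  let ?h = "(qK1 q \<alpha> \<circ> qWeyl q \<alpha>) g" and ?\<kappa> = "qkappa q \<alpha>" and ?w = "2 * \<alpha> + 1"
  have mf: "mellin s f" if "0 < s" for s by (rule mellin_Schwartz[OF f that])
  have mFf: "mellin (2 * \<alpha> + 2) (?G f)"
    by (rule mellin_qF[OF mellin_hankel_Schwartz[OF alpha_gt_minus_1 f]]) (use alpha_gt in auto)
  define S where "S = (\<lambda>k. ?G f k * cnj (?G g (a * k)))"
  define P where "P = (\<lambda>k. cx (k powr ?w) * (cx (sqrt a * ?\<kappa> * a powr ?w) * S k))"
  have P: "mellin 1 P"
  proof (rule mellin_powr_mult[where H = S and r = ?w and C = "\<bar>sqrt a * ?\<kappa> * a powr ?w\<bar>"])
    have "mellin (2 * \<alpha> + 2) S" unfolding S_def by (rule mellin_cnj_qF_g_mult[OF mFf])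
    then show "mellin (1 + ?w) S" by (simp add: add.commute)
  qed (simp add: P_def norm_mult abs_mult mult_ac)
  have \<Phi>: "q_wavelet_transform q ?h (qWeyl q \<alpha> f) a y = qF_inv q (- 1 / 2) P y" if y: "y \<in> insert 0 L" for y
  proof -
    have "q_wavelet_transform q ?h (qWeyl q \<alpha> f) a y =
      qF_inv q (- 1 / 2) (\<lambda>k. cx (sqrt a) * (?F (qWeyl q \<alpha> f) k * cnj (?F ?h (a * k)))) y"
    proof (rule q_wavelet_transform_eq[OF a order_refl])
      show "mellin 1 (qWeyl q \<alpha> f)" by (rule mellin_qWeyl[OF alpha_gt _ mf]) (use alpha_gt in auto)
      have "mellin 1 twisted" by (rule mellin_twisted) (use alpha_gt in auto)
      from mellin_scale[OF a this]
      have "mellin 1 (\<lambda>k. ?F ?h (a * k))"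
        by (rule mellin_le[of _ _ _ "\<bar>?\<kappa>\<bar>"]) (simp only: qF_qK1 L_mult a norm_mult norm_of_real order_refl)
      then show "mellin 1 (\<lambda>k. cx (j (- 1 / 2) (k * y)) * ?F ?h (a * k))"
        by (rule mellin_qBessel_mult[OF minus_half_gt y])
    qed
    also have "\<dots> = qF_inv q (- 1 / 2) P y"
    proof (rule qF_inv_cong)
      fix k assume k: "k \<in> L"
      have 1: "?F (qWeyl q \<alpha> f) k = ?G f k" by (rule qF_qWeyl[OF alpha_gt mf]) (use alpha_gt k in auto)
      show "cx (sqrt a) * (?F (qWeyl q \<alpha> f) k * cnj (?F ?h (a * k))) = P k"
        unfolding 1 qF_qK1[OF L_mult[OF a k]] twisted_scale[OF k] P_def S_def complex_cnj_mult complex_cnj_complex_of_real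
        by (simp only: of_real_mult mult_ac)
    qed
    finally show ?thesis .
  qed
  \<comment> \<open>the point \<open>b = 0\<close> is included: there \<open>R\<close> reads the wavelet transform at \<open>0\<close>\<close>
  have "qRL q \<alpha> (\<lambda>y. q_wavelet_transform q ?h (qWeyl q \<alpha> f) a y) b = qRL q \<alpha> (qF_inv q (- 1 / 2) P) b"
    by (rule qRL_cong[OF \<Phi> b])
  also have "\<dots> = cx (qF_factor (- 1 / 2) / qF_factor \<alpha>) * ?G (\<lambda>k. cx (k powr - ?w) * P k) b"
    by (rule qRL_qF_inv[OF alpha_gt P b])
  also have "?G (\<lambda>k. cx (k powr - ?w) * P k) b = ?G (\<lambda>k. cx (sqrt a * ?\<kappa> * a powr ?w) * S k) b"
  proof (rule qF_cong)
    fix k assume k: "k \<in> L"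
    have "k powr - ?w * k powr ?w = 1" using L_pos[OF k] by (simp add: powr_add[symmetric])
    then have "cx (k powr - ?w) * cx (k powr ?w) = 1" by (simp only: of_real_mult[symmetric] of_real_1)
    then show "cx (k powr - ?w) * P k = cx (sqrt a * ?\<kappa> * a powr ?w) * S k"
      unfolding P_def mult.assoc[symmetric] by (simp only: mult_1)
  qed
  also have "cx (qF_factor (- 1 / 2) / qF_factor \<alpha>) * ?G (\<lambda>k. cx (sqrt a * ?\<kappa> * a powr ?w) * S k) b
    = cx (a powr ?w) * (cx (sqrt a) * ((cx (qF_factor (- 1 / 2) / qF_factor \<alpha>) * cx ?\<kappa>) * ?G S b))"
    unfolding qF_cmult of_real_mult by (simp only: mult_ac)
  also have "\<dots> = cx (a powr ?w) * qF_inv q \<alpha> (\<lambda>k. cx (sqrt a) * S k) b"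
    unfolding qkappa_ratio qF_inv_cmult unfolding qF_inv_def by (simp only: mult_ac)
  also have "qF_inv q \<alpha> (\<lambda>k. cx (sqrt a) * S k) b = qBessel_wavelet_transform q \<alpha> g f a b"
    unfolding S_def
  proof (rule qBessel_wavelet_transform_eq[OF alpha_gt_minus_1 a order_refl, symmetric])
    show "mellin (2 * \<alpha> + 2) f" by (rule mf) (use alpha_gt in auto)
    have "mellin (2 * \<alpha> + 2) (\<lambda>k. ?G g (a * k))" by (rule mellin_scale[OF a mellin_qF_g]) (use alpha_gt in auto)
    then show "mellin (2 * \<alpha> + 2) (\<lambda>k. cx (j \<alpha> (k * b)) * ?G g (a * k))"
      by (rule mellin_qBessel_mult[OF alpha_gt_minus_1 b])
  qed
  finally show ?thesis using L_pos[OF a] by simp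
qed

text \<open>
  Since \<open>f\<close> is the inverse transform of \<open>F\<^bsub>-1/2\<^esub> f\<close>, its Riemann-Liouville transform has the \<open>F\<^sub>\<alpha>\<close>-transform
  \<open>\<kappa>\<^bsup>-1\<^esup> k\<^bsup>-2\<alpha>-1\<^esup> F\<^bsub>-1/2\<^esub> f k\<close>. The factor \<open>\<kappa> (a k)\<^bsup>2\<alpha>+1\<^esup>\<close> that \<open>K\<^sub>2\<close>
  contributes cancels both \<open>\<kappa>\<close> and the power of \<open>k\<close>.
\<close>

lemma wavelet_identity_Weyl:
  assumes f: "f \<in> Schwartz q"
  shows "q_wavelet_transform q (qWeyl q \<alpha> g) f a b =
            cx (1 / a powr (2 * \<alpha> + 1)) *
            qWeyl q \<alpha> (\<lambda>y. qBessel_wavelet_transform q \<alpha> (qK2 q \<alpha> g) (qRL q \<alpha> f) a y) b"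
proof -
  let ?Psi = "qBessel_wavelet_transform q \<alpha> (qK2 q \<alpha> g) (qRL q \<alpha> f) a" and ?F = "qF q (- 1 / 2)" and ?G = "qF q \<alpha>"
  let ?\<kappa> = "qkappa q \<alpha>" and ?w = "2 * \<alpha> + 1"
  let ?c = "cx (qF_factor (- 1 / 2) / qF_factor \<alpha>)"
  have mf: "mellin s f" if "0 < s" for s by (rule mellin_Schwartz[OF f that])
  have mFf: "mellin t (?F f)" if "0 < t" "t < 2" for t
    by (rule mellin_qF[OF mellin_hankel_Schwartz[OF minus_half_gt f]]) (use that in auto)
  define V where "V = (\<lambda>k. cx (k powr - ?w) * ?F f k)"
  have mV: "mellin (t + ?w) V" if "0 < t" "t < 2" for t
    by (rule mellin_powr_mult[where H = "?F f" and r = "- ?w" and C = 1])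
       (use mFf[OF that] in \<open>simp_all add: V_def norm_mult mult_ac\<close>)
  \<comment> \<open>at a lattice point \<open>R f\<close> reads \<open>f\<close> only on the lattice, where the inversion formula represents it\<close>
  have RL: "qRL q \<alpha> f x = ?c * ?G V x" if x: "x \<in> L" for x
  proof -
    have "qRL q \<alpha> f x = qRL q \<alpha> (qF_inv q (- 1 / 2) (?F f)) x"
    proof -
      have "f (x * q ^ n) = qF_inv q (- 1 / 2) (?F f) (x * q ^ n)" for n
        by (rule qF_qF_inv(2)[OF minus_half_gt mf, of 1, symmetric]) (auto intro!: L_mult L_power L_q x)
      then show ?thesis unfolding qRL_def jackson_upto_def by simp
    qed
    also have "\<dots> = ?c * ?G V x" unfolding V_def by (rule qRL_qF_inv[OF alpha_gt mFf]) (use x in auto)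
    finally show ?thesis .
  qed
  \<comment> \<open>in general \<open>R f\<close> decays only like \<open>1 / x\<close>, so its exponents are those in \<open>(0, 1)\<close>\<close>
  have mRL: "mellin (1 / 2) (qRL q \<alpha> f)"
  proof -
    have "mellin (1 / 2) (hankel \<alpha> V)"
    proof (rule mellin_hankel[OF alpha_gt_minus_1])
      have "2 * \<alpha> + 2 - 1 / 2 = 1 / 2 + ?w" by simp
      then show "mellin (2 * \<alpha> + 2 - 1 / 2) V" using mV[of "1 / 2"] by (simp only:)
    qed simp
    from mellin_qF[OF this] show ?thesis
      by (rule mellin_le[of _ _ _ "norm ?c"]) (simp only: RL norm_mult order_refl)
  qed
  have FRL: "?G (qRL q \<alpha> f) k * cx ?\<kappa> = V k" if k: "k \<in> L" for k
  proof -
    have "?G (qRL q \<alpha> f) k = ?G (\<lambda>x. ?c * ?G V x) k" by (rule qF_cong) (rule RL)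
    also have "\<dots> = ?c * ?G (?G V) k" by (rule qF_cmult)
    also have "?G (?G V) k = cx (q powr (4 * \<alpha> + 2)) * V k"
    proof (rule qF_qF[OF alpha_gt_minus_1 _ _ _ k])
      have "2 * \<alpha> + 2 = 1 + ?w" by simp
      then show "mellin (2 * \<alpha> + 2) V" using mV[of 1] by (simp only:)
    qed (use alpha_gt in auto)
    finally have "?G (qRL q \<alpha> f) k * cx ?\<kappa> = (?c * cx ?\<kappa>) * cx (q powr (4 * \<alpha> + 2)) * V k"
      by (simp only: mult_ac)
    also have "(?c * cx ?\<kappa>) * cx (q powr (4 * \<alpha> + 2)) = 1"
    proof -
      have "q powr (- 4 * \<alpha> - 2) * q powr (4 * \<alpha> + 2) = 1" using q_pos by (simp add: powr_add[symmetric])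
      then show ?thesis unfolding qkappa_ratio by (simp only: of_real_mult[symmetric] of_real_1)
    qed
    finally show ?thesis by simp
  qed
  define S where "S = (\<lambda>k. cx (sqrt a) * (?F f k * cnj (?G g (a * k))))"
  define Q where "Q = (\<lambda>k. cx (a powr ?w) * S k)"
  have Q: "mellin 1 Q"
  proof (rule mellin_le[where C = "\<bar>a powr ?w * sqrt a\<bar>"])
    show "mellin 1 (\<lambda>k. ?F f k * cnj (?G g (a * k)))" by (rule mellin_cnj_qF_g_mult[OF mFf]) auto
  qed (simp add: Q_def S_def norm_mult abs_mult mult_ac)
  have \<Psi>: "?Psi y = qF_inv q \<alpha> Q y" if y: "y \<in> L" for y
  proof -
    have "?Psi y
      = qF_inv q \<alpha> (\<lambda>k. cx (sqrt a) * (?G (qRL q \<alpha> f) k * cnj (?G (qK2 q \<alpha> g) (a * k)))) y"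
    proof (rule qBessel_wavelet_transform_eq[OF alpha_gt_minus_1 a _ mRL])
      have "mellin (1 / 2) twisted" by (rule mellin_twisted) (use alpha_gt in auto)
      from mellin_scale[OF a this]
      have "mellin (1 / 2) (\<lambda>k. ?G (qK2 q \<alpha> g) (a * k))"
        by (rule mellin_le[of _ _ _ "\<bar>?\<kappa>\<bar>"]) (simp only: qF_qK2 L_mult a norm_mult norm_of_real order_refl)
      then show "mellin (1 / 2) (\<lambda>k. cx (j \<alpha> (k * y)) * ?G (qK2 q \<alpha> g) (a * k))"
        by (rule mellin_qBessel_mult[OF alpha_gt_minus_1 insertI2[OF y]])
    qed (use alpha_gt in auto)
    also have "\<dots> = qF_inv q \<alpha> Q y"
    proof (rule qF_inv_cong)
      fix k assume k: "k \<in> L"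
      have "k powr - ?w * k powr ?w = 1" using L_pos[OF k] by (simp add: powr_add[symmetric])
      then have kk: "cx (k powr - ?w) * cx (k powr ?w) = 1" by (simp only: of_real_mult[symmetric] of_real_1)
      have "cx (sqrt a) * (?G (qRL q \<alpha> f) k * cnj (?G (qK2 q \<alpha> g) (a * k)))
        = cx (sqrt a) * ((?G (qRL q \<alpha> f) k * cx ?\<kappa>) * (cx (a powr ?w) * cx (k powr ?w) * cnj (?G g (a * k))))"
        unfolding qF_qK2[OF L_mult[OF a k]] twisted_scale[OF k] complex_cnj_mult complex_cnj_complex_of_real
        by (simp only: of_real_mult mult_ac)
      also have "\<dots> = (cx (k powr - ?w) * cx (k powr ?w)) * Q k"
        unfolding FRL[OF k] V_def Q_def S_def by (simp only: mult_ac)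
      finally show "cx (sqrt a) * (?G (qRL q \<alpha> f) k * cnj (?G (qK2 q \<alpha> g) (a * k))) = Q k"
        unfolding kk by simp
    qed
    finally show ?thesis .
  qed
  have "qWeyl q \<alpha> (\<lambda>y. ?Psi y) b = qWeyl q \<alpha> (qF_inv q \<alpha> Q) b"
    by (rule qWeyl_cong[OF \<Psi> b])
  also have "\<dots> = qF_inv q (- 1 / 2) Q b" by (rule qWeyl_qF_inv[OF alpha_gt Q b])
  also have "\<dots> = cx (a powr ?w) * qF_inv q (- 1 / 2) S b" unfolding Q_def by (rule qF_inv_cmult)
  also have "qF_inv q (- 1 / 2) S b = q_wavelet_transform q (qWeyl q \<alpha> g) f a b"
  proof -
    have "q_wavelet_transform q (qWeyl q \<alpha> g) f a b
      = qF_inv q (- 1 / 2) (\<lambda>k. cx (sqrt a) * (?F f k * cnj (?F (qWeyl q \<alpha> g) (a * k)))) b"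
    proof (rule q_wavelet_transform_eq[OF a order_refl])
      show "mellin 1 f" by (rule mf) simp
      have "mellin 1 (?G g)" by (rule mellin_qF_g) (use alpha_gt in auto)
      from mellin_scale[OF a this]
      have "mellin 1 (\<lambda>k. ?F (qWeyl q \<alpha> g) (a * k))"
        by (rule mellin_le[of _ _ _ 1]) (simp only: qWeyl_g_transform insertI2 L_mult a mult_1 order_refl)
      then show "mellin 1 (\<lambda>k. cx (j (- 1 / 2) (k * b)) * ?F (qWeyl q \<alpha> g) (a * k))"
        by (rule mellin_qBessel_mult[OF minus_half_gt b])
    qed
    also have "\<dots> = qF_inv q (- 1 / 2) S b"
      unfolding S_def by (rule qF_inv_cong) (simp only: qWeyl_g_transform insertI2 L_mult a)
    finally show ?thesis ..
  qed
  finally show ?thesis using L_pos[OF a] by simp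
qed

end

end

lemma one_minus_q_in_lattice:
  assumes "0 < q" "q < 1" "ln (1 - q) / ln q \<in> \<int>" shows "1 - q \<in> Rq_pos q"
proof -
  obtain n :: int where n: "ln (1 - q) / ln q = of_int n" using assms(3) by (auto elim: Ints_cases)
  have "ln q \<noteq> 0" using assms by simp
  then have "ln (1 - q) = of_int n * ln q" using n by (simp add: field_simps)
  then have "exp (ln (1 - q)) = q powr of_int n" using assms(1) by (simp add: powr_def)
  then have "1 - q = q powr of_int n" using assms(2) by simp
  then have "1 - q = q powi n" using assms by (simp add: powr_real_of_int')
  then show ?thesis unfolding Rq_pos_def by blast
qed

theorem theorem14:
  fixes q \<alpha> a b :: real and g :: "real \<Rightarrow> complex"
  assumes "0 < q" and "q < 1" and "ln (1 - q) / ln q \<in> \<int>" and "\<alpha> > - 1/2"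
    and "qBessel_wavelet q \<alpha> g" and "g \<in> Schwartz0 q \<alpha>"
    and "a \<in> Rq_pos q" and "b \<in> Rq_nonneg q"
  shows "(\<forall>f \<in> Schwartz0 q \<alpha>.
            qBessel_wavelet_transform q \<alpha> g f a b =
            complex_of_real (1 / a powr (2 * \<alpha> + 1)) *
            qRL q \<alpha> (\<lambda>y. q_wavelet_transform q ((qK1 q \<alpha> \<circ> qWeyl q \<alpha>) g) (qWeyl q \<alpha> f) a y) b)
       \<and> (\<forall>f \<in> Schwartz0 q (- 1/2).
            q_wavelet_transform q (qWeyl q \<alpha> g) f a b =
            complex_of_real (1 / a powr (2 * \<alpha> + 1)) *
            qWeyl q \<alpha> (\<lambda>y. qBessel_wavelet_transform q \<alpha> (qK2 q \<alpha> g) (qRL q \<alpha> f) a y) b)"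
proof -
  interpret q_lattice q
    by unfold_locales (use assms(1-3) one_minus_q_in_lattice in auto)
  have g: "g \<in> Schwartz q" and b: "b \<in> insert 0 (Rq_pos q)"
    using assms(6,8) by (auto simp: Schwartz0_def Rq_nonneg_def)
  show ?thesis
  proof (intro conjI ballI)
    fix f assume "f \<in> Schwartz0 q \<alpha>"
    then have "f \<in> Schwartz q" by (simp add: Schwartz0_def)
    then show "qBessel_wavelet_transform q \<alpha> g f a b =
            complex_of_real (1 / a powr (2 * \<alpha> + 1)) *
            qRL q \<alpha> (\<lambda>y. q_wavelet_transform q ((qK1 q \<alpha> \<circ> qWeyl q \<alpha>) g) (qWeyl q \<alpha> f) a y) b"
      by (rule wavelet_identity_RL[OF assms(4) g assms(7) b])
  next
    fix f assume "f \<in> Schwartz0 q (- 1/2)"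
    then have "f \<in> Schwartz q" by (simp add: Schwartz0_def)
    then show "q_wavelet_transform q (qWeyl q \<alpha> g) f a b =
            complex_of_real (1 / a powr (2 * \<alpha> + 1)) *
            qWeyl q \<alpha> (\<lambda>y. qBessel_wavelet_transform q \<alpha> (qK2 q \<alpha> g) (qRL q \<alpha> f) a y) b"
      by (rule wavelet_identity_Weyl[OF assms(4) g assms(7) b])
  qed
qed
end
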